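(* Let $\Gamma = (\Gamma, \le, \mu, (\varphi_x)_{x \in V(\Gamma)})$ be a trickle graph, with a fixed total order $\preceq$ on $V(\Gamma)$ extending $\le$, and for $g\in\mathrm{Tr}(\Gamma)$ let $\mathrm{nf}(g)\in (V(\Gamma)\sqcup V(\Gamma)^{-1})^*$ be the associated word. (1) The set $\mathcal L=\{\mathrm{nf}(g)\mid g\in\mathrm{Tr}(\Gamma)\}$ is a set of normal forms for $\mathrm{Tr}(\Gamma)$ based on $V(\Gamma)\sqcup V(\Gamma)^{-1}$; that is, for every $g\in\mathrm{Tr}(\Gamma)$ there is a unique $w\in\mathcal L$ representing $g$. (2) Suppose that $V(\Gamma)$ is finite. Then there exists an algorithm which, given a word $w\in(V(\Gamma)\sqcup V(\Gamma)^{-1})^*$, calculates $\mathrm{nf}(\overline w)$, where $\overline w$ is the element of $\mathrm{Tr}(\Gamma)$ represented by $w$. In particular, this algorithm is a solution to the word problem in $\mathrm{Tr}(\Gamma)$.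
   Context: **Trickle graphs.** For a simplicial graph $\Gamma$ (no loops or multiple edges, possibly infinite) with vertex set $V(\Gamma)$ and edge set $E(\Gamma)$, $\mathrm{star}_x(\Gamma)$ is the full subgraph spanned by $x$ and all vertices adjacent to $x$. A trickle graph is a quadruple $(\Gamma,\le,\mu,(\varphi_x)_{x\in V(\Gamma)})$ where $\Gamma$ is a simplicial graph, $\le$ is a partial order on $V(\Gamma)$, $\mu:V(\Gamma)\to\mathbb N_{\ge 2}\cup\{\infty\}$ is a labeling, and each $\varphi_x$ is a graph automorphism of $\mathrm{star}_x(\Gamma)$, such that, writing $x||y$ if $x\not\le y$ and $y\not\le x$, and $E_{||}(\Gamma)=\{\{x,y\}\in E(\Gamma)\mid x||y\}$: (a) if $x<y$ then $\{x,y\}\in E(\Gamma)$; (b) if $\{x,y\}\in E_{||}(\Gamma)$ and $z\le y$, then $\{x,z\}\in E_{||}(\Gamma)$; (c) for all $x$ and all $y,z\in \mathrm{star}_x(\Gamma)$: $z\le y$ iff $\varphi_x(z)\le\varphi_x(y)$; (d) for all $x$ and $y\in\mathrm{star}_x(\Gamma)$: if $\varphi_x(y)\ne y$ then $y<x$; (e) if $\mu(x)$ is finite, then $\varphi_x$ has finite order dividing $\mu(x)$; (f) $\mu(\varphi_x(y))=\mu(y)$ for all $x$ and $y\in \mathrm{star}_x(\Gamma)$; (g) if $z<y<x$ then $(\varphi_x\circ\varphi_y)(z)=(\varphi_{y'}\circ\varphi_x)(z)$ where $y'=\varphi_x(y)$. The trickle group is $\mathrm{Tr}(\Gamma)=\langle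 V(\Gamma)\mid x^{\mu(x)}=1 \text{ if }\mu(x)\ne\infty,\ \varphi_x(y)\,x=\varphi_y(x)\,y\text{ for }\{x,y\}\in E(\Gamma)\rangle$. **Strata and rewriting system.** $\mathbb Z_\mu=\mathbb Z/\mu\mathbb Z$ if $\mu\neq\infty$ and $\mathbb Z_\infty=\mathbb Z$. Syllables: $S(\Gamma)=\{x^a\mid x\in V(\Gamma),a\in\mathbb Z_{\mu(x)}\setminus\{0\}\}$ (formal symbols). A stratum is a finite set $U=\{x_1^{a_1},\dots,x_p^{a_p}\}\subseteq S(\Gamma)$ with $x_i\ne x_j$ and $\{x_i,x_j\}\in E(\Gamma)$ for $i\ne j$; $\mathrm{supp}(U)=\{x_1,\dots,x_p\}$; $\emptyset$ is a stratum. $\Omega$ is the set of strata; elements of the free monoid $\Omega^*$ are called pilings, $\epsilon$ is the empty piling. - For $x^a\in U$: $L(U,x^a)=U\setminus\{x^a\}$. - For $x_i^{a_i}\in U$, number $U$ so that $x_j>x_k$ implies $j<k$; then $\gamma(U,x_i^{a_i})=\big((\varphi_{x_1}^{a_1}\circ\cdots\circ\varphi_{x_{i-1}}^{a_{i-1}})(x_i)\big)^{a_i}$ (independent of the numbering). - $y^b\in S(\Gamma)$ can be added to $U$ if $y\in\mathrm{supp}(U)$ or $\{y,x_i\}\in E(\Gamma)$ for all $i$. Then $R(U,y^b)$ is: $\{\varphi_y^{-b}(x_1)^{a_1},\dots,\varphi_y^{-b}(x_p)^{a_p},y^b\}$ if $y\notin\mathrm{supp}(U)$; if $y=x_i$,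 it is $\{\varphi_y^{-b}(x_j)^{a_j}\mid j\ne i\}$ when $a_i+b=0$ in $\mathbb Z_{\mu(y)}$, and $\{\varphi_y^{-b}(x_j)^{a_j}\mid j\ne i\}\cup\{y^{a_i+b}\}$ when $a_i+b\neq0$. - $\mathcal R_1$ is the set of pairs $((U,V),(U',V'))\in\Omega^*\times\Omega^*$ such that for some $x^a\in V$: $V'=L(V,x^a)$, $y^a=\gamma(V,x^a)$ can be added to $U$, and $U'=R(U,y^a)$. $\mathcal R=\mathcal R_1\cup\{((\emptyset),\epsilon)\}$, where $(\emptyset)$ is the length-1 piling with entry $\emptyset$. A piling is $\mathcal R$-irreducible if it contains no factor equal to the left-hand side of a pair in $\mathcal R$. **Normal forms.** For a stratum $U=\{x_1^{a_1},\dots,x_p^{a_p}\}$ numbered so that $x_i>x_j$ implies $i<j$, set $\omega(U)=x_1^{a_1}\cdots x_p^{a_p}\in\mathrm{Tr}(\Gamma)$ (independent of numbering), $\omega(\emptyset)=1$; a piling $(U_1,\dots,U_p)$ represents $\omega(U_1)\cdots\omega(U_p)$. Every $g\in\mathrm{Tr}(\Gamma)$ is represented by a unique $\mathcal R$-irreducible piling (since $\mathcal R$ is a terminating confluent rewriting system for $\mathrm{Tr}(\Gamma)$). For $a\in\mathbb Z_\mu\setminus\{0\}$ let $\rho(a)=a$ if $\mu=\infty$, and otherwise $\rho(a)$ is the representative of $a$ in $\{1,\dots,\mu-1\}$. Fix a total order $\preceq$ on $V(\Gamma)$ such that $x\le y$ implies $x\preceq y$. For $U=\{x_1^{a_1},\dots,x_p^{a_p}\}$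 non-empty with $x_1\succ\cdots\succ x_p$, let $\hat\omega(U)=x_1^{\rho(a_1)}\cdots x_p^{\rho(a_p)}\in(V(\Gamma)\sqcup V(\Gamma)^{-1})^*$ (as a word). If $(U_1,\dots,U_p)$ is the unique $\mathcal R$-irreducible piling representing $g$, then $\mathrm{nf}(g)=\hat\omega(U_1)\cdot\hat\omega(U_2)\cdots\hat\omega(U_p)$. *)

theory Defs
  imports
    "HOL-Algebra.Bij"
    "HOL-Algebra.Elementary_Groups"
    "HOL-Algebra.Multiplicative_Group"
    "HOL-Library.Extended_Nat"
    "HOL-Library.Nat_Bijection"
    "HOL-Library.Sublist"
begin

section \<open>Groups given by generators and relations\<close>

text \<open>A word over \<open>X \<squnion> X\<inverse>\<close> is a list over two disjoint copies of \<open>X\<close>: \<open>Inl x\<close> is the letter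
  \<open>x\<close> and \<open>Inr x\<close> is the letter \<open>x\<inverse>\<close>.  A relation \<open>u = v\<close> is a pair \<open>(u, v)\<close> of words.  The group
  presented by \<open>\<langle>X | R\<rangle>\<close> is the quotient of the set of words by the congruence generated by \<open>R\<close> and
  by free cancellation.\<close>

type_synonym 'a word = "('a + 'a) list"

definition words_over :: "'a set \<Rightarrow> 'a word set" where
  "words_over X = lists (Inl ` X \<union> Inr ` X)"

inductive pres_eq :: "'a set \<Rightarrow> ('a word \<times> 'a word) set \<Rightarrow> 'a word \<Rightarrow> 'a word \<Rightarrow> bool"
  for X R where
  refl: "w \<in> words_over X \<Longrightarrow> pres_eq X R w w"
| sym: "pres_eq X R u v \<Longrightarrow> pres_eq X R v u"
| trans: "pres_eq X R u v \<Longrightarrow> pres_eq X R v w \<Longrightarrow> pres_eq X R u w"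
| append: "pres_eq X R u u' \<Longrightarrow> pres_eq X R v v' \<Longrightarrow> pres_eq X R (u @ v) (u' @ v')"
| cancel: "x \<in> X \<Longrightarrow> pres_eq X R [Inl x, Inr x] []"
| cancel': "x \<in> X \<Longrightarrow> pres_eq X R [Inr x, Inl x] []"
| rel: "(u, v) \<in> R \<Longrightarrow> u \<in> words_over X \<Longrightarrow> v \<in> words_over X \<Longrightarrow> pres_eq X R u v"

definition pres_class :: "'a set \<Rightarrow> ('a word \<times> 'a word) set \<Rightarrow> 'a word \<Rightarrow> 'a word set" where
  "pres_class X R w = {v. pres_eq X R w v}"

definition presented_group :: "'a set \<Rightarrow> ('a word \<times> 'a word) set \<Rightarrow> 'a word set monoid" where
  "presented_group X R =
     \<lparr>carrier = pres_class X R ` words_over X,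
      monoid.mult = (\<lambda>A B. {w. \<exists>u\<in>A. \<exists>v\<in>B. pres_eq X R (u @ v) w}),
      one = pres_class X R []\<rparr>"

lemma pres_eq_words: "pres_eq X R u v \<Longrightarrow> u \<in> words_over X \<and> v \<in> words_over X"
  by (induction rule: pres_eq.induct) (auto simp: words_over_def)

lemma pres_class_eq_iff:
  assumes "u \<in> words_over X"
  shows "pres_class X R u = pres_class X R v \<longleftrightarrow> pres_eq X R u v"
proof
  assume "pres_class X R u = pres_class X R v"
  then have "u \<in> pres_class X R v"
    using pres_eq.refl[OF assms] unfolding pres_class_def by blast
  then show "pres_eq X R u v"
    unfolding pres_class_def using pres_eq.sym by blast
next
  assume "pres_eq X R u v"
  then show "pres_class X R u = pres_class X R v"
    unfolding pres_class_def using pres_eq.sym pres_eq.trans by blast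
qed

lemma presented_group_mult:
  assumes "u \<in> words_over X" "v \<in> words_over X"
  shows "pres_class X R u \<otimes>\<^bsub>presented_group X R\<^esub> pres_class X R v = pres_class X R (u @ v)"
proof -
  have "(\<exists>u'\<in>pres_class X R u. \<exists>v'\<in>pres_class X R v. pres_eq X R (u' @ v') w)
        \<longleftrightarrow> pres_eq X R (u @ v) w" for w
  proof
    assume "\<exists>u'\<in>pres_class X R u. \<exists>v'\<in>pres_class X R v. pres_eq X R (u' @ v') w"
    then obtain u' v' where "pres_eq X R u u'" "pres_eq X R v v'" "pres_eq X R (u' @ v') w"
      unfolding pres_class_def by blast
    then show "pres_eq X R (u @ v) w" by (meson pres_eq.append pres_eq.trans)
  next
    assume "pres_eq X R (u @ v) w"
    then show "\<exists>u'\<in>pres_class X R u. \<exists>v'\<in>pres_class X R v. pres_eq X R (u' @ v') w"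
      using assms pres_eq.refl unfolding pres_class_def by blast
  qed
  then show ?thesis
    by (simp add: presented_group_def pres_class_def)
qed

lemma pres_left_inverse:
  "w \<in> words_over X \<Longrightarrow> \<exists>v\<in>words_over X. pres_eq X R (v @ w) []"
proof (induction w)
  case Nil
  then show ?case by (intro bexI[of _ "[]"]) (auto simp: words_over_def intro: pres_eq.refl)
next
  case (Cons l w)
  then obtain v where v: "v \<in> words_over X" "pres_eq X R (v @ w) []"
    by (auto simp: words_over_def)
  from Cons.prems have w: "w \<in> words_over X" by (auto simp: words_over_def)
  have "\<exists>l'\<in>Inl ` X \<union> Inr ` X. pres_eq X R [l', l] []"
  proof (cases l)
    case (Inl x)
    then show ?thesis
      using Cons.prems by (intro bexI[of _ "Inr x"]) (auto simp: words_over_def pres_eq.cancel')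
  next
    case (Inr x)
    then show ?thesis
      using Cons.prems by (intro bexI[of _ "Inl x"]) (auto simp: words_over_def pres_eq.cancel)
  qed
  then obtain l' where l': "l' \<in> Inl ` X \<union> Inr ` X" "pres_eq X R [l', l] []"
    by blast
  have "pres_eq X R ([l', l] @ w) w"
    using pres_eq.append[OF l'(2) pres_eq.refl[OF w]] by simp
  then have "pres_eq X R (v @ ([l', l] @ w)) (v @ w)"
    by (rule pres_eq.append[OF pres_eq.refl[OF v(1)]])
  then have "pres_eq X R ((v @ [l']) @ (l # w)) []"
    using pres_eq.trans[OF _ v(2)] by simp
  moreover have "v @ [l'] \<in> words_over X" using v l' by (auto simp: words_over_def)
  ultimately show ?case by blast
qed

lemma group_presented_group: "group (presented_group X R)"
proof -
  have carr: "carrier (presented_group X R) = pres_class X R ` words_over X"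
    and one: "\<one>\<^bsub>presented_group X R\<^esub> = pres_class X R []"
    by (simp_all add: presented_group_def)
  have nil: "[] \<in> words_over X" by (simp add: words_over_def)
  have app: "u @ v \<in> words_over X" if "u \<in> words_over X" "v \<in> words_over X" for u v :: "'a word"
    using that by (auto simp: words_over_def)
  show ?thesis
  proof (rule groupI, unfold carr one)
    fix x assume "x \<in> pres_class X R ` words_over X"
    then obtain w where w: "w \<in> words_over X" "x = pres_class X R w" by auto
    obtain v where v: "v \<in> words_over X" "pres_eq X R (v @ w) []"
      using pres_left_inverse[OF w(1)] by blast
    then have "pres_class X R v \<otimes>\<^bsub>presented_group X R\<^esub> x = pres_class X R []"
      using w app by (simp add: presented_group_mult pres_class_eq_iff)
    then show "\<exists>y\<in>pres_class X R ` words_over X. y \<otimes>\<^bsub>presented_group X R\<^esub> x = pres_class X R []"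
      using v by blast
  qed (auto simp: presented_group_mult nil app)
qed


section \<open>Trickle graphs\<close>

text \<open>The partial order \<open>\<le>\<close> is the relation \<open>vle\<close>, and \<open>perm x\<close> is the automorphism
  \<open>\<phi>\<^sub>x\<close> of the star of \<open>x\<close>.\<close>

record 'a trickle =
  verts :: "'a set"
  edges :: "'a set set"
  vle :: "'a rel"
  label :: "'a \<Rightarrow> enat"
  perm :: "'a \<Rightarrow> 'a \<Rightarrow> 'a"

definition vless :: "('a, 'm) trickle_scheme \<Rightarrow> 'a \<Rightarrow> 'a \<Rightarrow> bool" where
  "vless G x y \<longleftrightarrow> (x, y) \<in> vle G \<and> x \<noteq> y"

definition parallel_edges :: "('a, 'm) trickle_scheme \<Rightarrow> 'a set set" where
  "parallel_edges G = {{x, y} | x y. {x, y} \<in> edges G \<and> (x, y) \<notin> vle G \<and> (y, x) \<notin> vle G}"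

definition star :: "('a, 'm) trickle_scheme \<Rightarrow> 'a \<Rightarrow> 'a set" where
  "star G x = insert x {y \<in> verts G. {x, y} \<in> edges G}"

text \<open>Elements of \<open>Bij S\<close> are undefined outside \<open>S\<close>, so that an automorphism of the star is
  determined by its values on the star.\<close>

definition star_automorphism :: "('a, 'm) trickle_scheme \<Rightarrow> 'a \<Rightarrow> ('a \<Rightarrow> 'a) \<Rightarrow> bool" where
  "star_automorphism G x f \<longleftrightarrow>
     f \<in> Bij (star G x) \<and>
     (\<forall>y\<in>star G x. \<forall>z\<in>star G x. {f y, f z} \<in> edges G \<longleftrightarrow> {y, z} \<in> edges G)"

text \<open>In the clause on orders, \<open>group.ord\<close> is \<open>0\<close> for an element of infinite order, which is
  excluded because \<open>0\<close> does not divide \<open>n \<ge> 2\<close>.\<close>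

definition trickle_graph :: "('a, 'm) trickle_scheme \<Rightarrow> bool" where
  "trickle_graph G \<longleftrightarrow>
     (\<forall>e\<in>edges G. \<exists>x\<in>verts G. \<exists>y\<in>verts G. x \<noteq> y \<and> e = {x, y}) \<and>
     partial_order_on (verts G) (vle G) \<and>
     (\<forall>x\<in>verts G. 2 \<le> label G x) \<and>
     (\<forall>x\<in>verts G. star_automorphism G x (perm G x)) \<and>
     (\<forall>x\<in>verts G. \<forall>y\<in>verts G. vless G x y \<longrightarrow> {x, y} \<in> edges G) \<and>
     (\<forall>x\<in>verts G. \<forall>y\<in>verts G. \<forall>z\<in>verts G.
        {x, y} \<in> parallel_edges G \<and> (z, y) \<in> vle G \<longrightarrow> {x, z} \<in> parallel_edges G) \<and>
     (\<forall>x\<in>verts G. \<forall>y\<in>star G x. \<forall>z\<in>star G x.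
        (z, y) \<in> vle G \<longleftrightarrow> (perm G x z, perm G x y) \<in> vle G) \<and>
     (\<forall>x\<in>verts G. \<forall>y\<in>star G x. perm G x y \<noteq> y \<longrightarrow> vless G y x) \<and>
     (\<forall>x\<in>verts G. \<forall>n. label G x = enat n \<longrightarrow>
        group.ord (BijGroup (star G x)) (perm G x) dvd n) \<and>
     (\<forall>x\<in>verts G. \<forall>y\<in>star G x. label G (perm G x y) = label G y) \<and>
     (\<forall>x\<in>verts G. \<forall>y\<in>verts G. \<forall>z\<in>verts G. vless G z y \<and> vless G y x \<longrightarrow>
        perm G x (perm G y z) = perm G (perm G x y) (perm G x z))"

definition trickle_relators :: "('a, 'm) trickle_scheme \<Rightarrow> ('a word \<times> 'a word) set" where
  "trickle_relators G =
     {(replicate n (Inl x), []) | x n. x \<in> verts G \<and> label G x = enat n} \<union>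
     {([Inl (perm G x y), Inl x], [Inl (perm G y x), Inl y]) | x y. {x, y} \<in> edges G}"

definition trickle_words :: "('a, 'm) trickle_scheme \<Rightarrow> 'a word set" where
  "trickle_words G = words_over (verts G)"

definition Tr :: "('a, 'm) trickle_scheme \<Rightarrow> 'a word set monoid" where
  "Tr G = presented_group (verts G) (trickle_relators G)"

definition element :: "('a, 'm) trickle_scheme \<Rightarrow> 'a word \<Rightarrow> 'a word set" where
  "element G w = pres_class (verts G) (trickle_relators G) w"


section \<open>Strata and the rewriting system\<close>

text \<open>\<open>integer_mod_group n\<close> is \<open>\<int>/n\<int>\<close> with carrier \<open>{0..<n}\<close> for \<open>n > 0\<close>, and \<open>\<int>\<close> for \<open>n = 0\<close>.
  An exponent is thus always stored as its canonical integer representative, so the map \<open>\<rho>\<close>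
  is the identity on exponents.\<close>

definition Zlab :: "enat \<Rightarrow> int monoid" where
  "Zlab m = integer_mod_group (case m of enat n \<Rightarrow> n | \<infinity> \<Rightarrow> 0)"

type_synonym 'a syllable = "'a \<times> int"
type_synonym 'a stratum = "'a syllable set"
type_synonym 'a piling = "'a stratum list"

definition syllables :: "('a, 'm) trickle_scheme \<Rightarrow> 'a syllable set" where
  "syllables G = {(x, a). x \<in> verts G \<and> a \<in> carrier (Zlab (label G x)) \<and> a \<noteq> 0}"

definition strata :: "('a, 'm) trickle_scheme \<Rightarrow> 'a stratum set" where
  "strata G = {U. finite U \<and> U \<subseteq> syllables G \<and>
     (\<forall>s\<in>U. \<forall>t\<in>U. s \<noteq> t \<longrightarrow> fst s \<noteq> fst t \<and> {fst s, fst t} \<in> edges G)}"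

definition supp :: "'a stratum \<Rightarrow> 'a set" where
  "supp U = fst ` U"

definition numbering :: "('a, 'm) trickle_scheme \<Rightarrow> 'a stratum \<Rightarrow> 'a syllable list \<Rightarrow> bool" where
  "numbering G U ss \<longleftrightarrow> distinct ss \<and> set ss = U \<and>
     (\<forall>i<length ss. \<forall>j<length ss. vless G (fst (ss ! j)) (fst (ss ! i)) \<longrightarrow> i < j)"

definition perm_pow :: "('a, 'm) trickle_scheme \<Rightarrow> 'a \<Rightarrow> int \<Rightarrow> 'a \<Rightarrow> 'a" where
  "perm_pow G x a = perm G x [^]\<^bsub>BijGroup (star G x)\<^esub> a"

definition Lrem :: "'a stratum \<Rightarrow> 'a syllable \<Rightarrow> 'a stratum" where
  "Lrem U s = U - {s}"

text \<open>The result does not depend on the numbering, so any one may be selected.  The syllables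
  before \<open>s\<close> in the numbering are \<open>takeWhile (\<lambda>t. t \<noteq> s) ss\<close>.\<close>

definition \<gamma> :: "('a, 'm) trickle_scheme \<Rightarrow> 'a stratum \<Rightarrow> 'a syllable \<Rightarrow> 'a syllable" where
  "\<gamma> G U s = (let ss = (SOME ss. numbering G U ss) in
     (foldr (\<lambda>(x, a). perm_pow G x a) (takeWhile (\<lambda>t. t \<noteq> s) ss) (fst s), snd s))"

definition can_add :: "('a, 'm) trickle_scheme \<Rightarrow> 'a stratum \<Rightarrow> 'a syllable \<Rightarrow> bool" where
  "can_add G U s \<longleftrightarrow> fst s \<in> supp U \<or> (\<forall>x\<in>supp U. {fst s, x} \<in> edges G)"

definition Radd :: "('a, 'm) trickle_scheme \<Rightarrow> 'a stratum \<Rightarrow> 'a syllable \<Rightarrow> 'a stratum" where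
  "Radd G U s = (let y = fst s; b = snd s;
       rest = {(perm_pow G y (- b) x, a) | x a. (x, a) \<in> U \<and> x \<noteq> y}
     in if y \<notin> supp U then insert (y, b) rest
        else let c = (THE a. (y, a) \<in> U) \<otimes>\<^bsub>Zlab (label G y)\<^esub> b
             in if c = 0 then rest else insert (y, c) rest)"

definition rules1 :: "('a, 'm) trickle_scheme \<Rightarrow> ('a piling \<times> 'a piling) set" where
  "rules1 G = {([U, V], [U', V']) | U V U' V'.
     U \<in> strata G \<and> V \<in> strata G \<and> U' \<in> strata G \<and> V' \<in> strata G \<and>
     (\<exists>s\<in>V. V' = Lrem V s \<and> can_add G U (\<gamma> G V s) \<and> U' = Radd G U (\<gamma> G V s))}"

definition rules :: "('a, 'm) trickle_scheme \<Rightarrow> ('a piling \<times> 'a piling) set" where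
  "rules G = rules1 G \<union> {([{}], [])}"

definition irreducible_piling :: "('a, 'm) trickle_scheme \<Rightarrow> 'a piling \<Rightarrow> bool" where
  "irreducible_piling G p \<longleftrightarrow> p \<in> lists (strata G) \<and>
     (\<forall>(l, r)\<in>rules G. \<not> sublist l p)"


section \<open>Normal forms\<close>

text \<open>As for \<open>\<gamma>\<close>, the value of \<open>\<omega>\<close> does not depend on the selected numbering.\<close>

definition \<omega> :: "('a, 'm) trickle_scheme \<Rightarrow> 'a stratum \<Rightarrow> 'a word set" where
  "\<omega> G U = (let ss = (SOME ss. numbering G U ss) in
     foldr (\<lambda>(x, a) g. (element G [Inl x] [^]\<^bsub>Tr G\<^esub> a) \<otimes>\<^bsub>Tr G\<^esub> g) ss \<one>\<^bsub>Tr G\<^esub>)"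

definition piling_element :: "('a, 'm) trickle_scheme \<Rightarrow> 'a piling \<Rightarrow> 'a word set" where
  "piling_element G p = foldr (\<lambda>U g. \<omega> G U \<otimes>\<^bsub>Tr G\<^esub> g) p \<one>\<^bsub>Tr G\<^esub>"

fun power_word :: "'a syllable \<Rightarrow> 'a word" where
  "power_word (x, a) = (if a \<ge> 0 then replicate (nat a) (Inl x) else replicate (nat (- a)) (Inr x))"

text \<open>\<open>T\<close> is the total order \<open>\<preceq>\<close>; the syllables are listed in strictly decreasing order.\<close>

definition \<omega>_hat :: "'a rel \<Rightarrow> 'a stratum \<Rightarrow> 'a word" where
  "\<omega>_hat T U = concat (map power_word
     (THE ss. set ss = U \<and>
        sorted_wrt (\<lambda>s t. (fst t, fst s) \<in> T \<and> fst t \<noteq> fst s) ss))"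

definition nf :: "('a, 'm) trickle_scheme \<Rightarrow> 'a rel \<Rightarrow> 'a word set \<Rightarrow> 'a word" where
  "nf G T g = concat (map (\<omega>_hat T)
     (THE p. irreducible_piling G p \<and> piling_element G p = g))"

definition normal_forms :: "('a, 'm) trickle_scheme \<Rightarrow> 'a word set \<Rightarrow> bool" where
  "normal_forms G L \<longleftrightarrow> L \<subseteq> trickle_words G \<and>
     (\<forall>g\<in>carrier (Tr G). \<exists>!w. w \<in> L \<and> element G w = g)"


section \<open>Algorithms\<close>

text \<open>Algorithms are programs for partial recursive functions on the natural numbers, in Kleene's
  sense; \<open>rec_eval f xs y\<close> says that the program \<open>f\<close> halts on the arguments \<open>xs\<close> with result \<open>y\<close>.\<close>

datatype recf = Zero | Succ | Proj nat | Comp recf "recf list" | PrimRec recf recf | Mu recf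

inductive rec_eval :: "recf \<Rightarrow> nat list \<Rightarrow> nat \<Rightarrow> bool" where
  Zero: "rec_eval Zero xs 0"
| Succ: "rec_eval Succ [x] (Suc x)"
| Proj: "i < length xs \<Longrightarrow> rec_eval (Proj i) xs (xs ! i)"
| Comp: "list_all2 (\<lambda>g y. rec_eval g xs y) gs ys \<Longrightarrow> rec_eval f ys z \<Longrightarrow> rec_eval (Comp f gs) xs z"
| PrimRec_0: "rec_eval f xs y \<Longrightarrow> rec_eval (PrimRec f g) (0 # xs) y"
| PrimRec_Suc: "rec_eval (PrimRec f g) (n # xs) r \<Longrightarrow> rec_eval g (n # r # xs) y \<Longrightarrow>
    rec_eval (PrimRec f g) (Suc n # xs) y"
| Mu: "rec_eval f (n # xs) 0 \<Longrightarrow> (\<And>m. m < n \<Longrightarrow> \<exists>k. rec_eval f (m # xs) (Suc k)) \<Longrightarrow>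
    rec_eval (Mu f) xs n"

inductive_cases rec_eval_ZeroE: "rec_eval Zero xs y"
inductive_cases rec_eval_SuccE: "rec_eval Succ xs y"
inductive_cases rec_eval_ProjE: "rec_eval (Proj i) xs y"
inductive_cases rec_eval_CompE: "rec_eval (Comp f gs) xs y"
inductive_cases rec_eval_PrimRec_0E: "rec_eval (PrimRec f g) (0 # xs) y"
inductive_cases rec_eval_PrimRec_SucE: "rec_eval (PrimRec f g) (Suc n # xs) y"
inductive_cases rec_eval_MuE: "rec_eval (Mu f) xs y"

lemma rec_eval_deterministic: "rec_eval f xs y \<Longrightarrow> rec_eval f xs y' \<Longrightarrow> y = y'"
proof (induction arbitrary: y' rule: rec_eval.induct)
  case (Zero xs)
  then show ?case by (rule rec_eval_ZeroE) simp
next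
  case (Succ x)
  then show ?case by (rule rec_eval_SuccE) simp
next
  case (Proj i xs)
  from Proj.prems show ?case by (rule rec_eval_ProjE) simp
next
  case (Comp xs gs ys f z)
  from Comp.prems obtain ys' where ys': "list_all2 (\<lambda>g y. rec_eval g xs y) gs ys'" "rec_eval f ys' y'"
    by (rule rec_eval_CompE)
  have "ys = ys'"
    using Comp.IH(1) ys'(1) by (auto simp: list_all2_conv_all_nth intro!: nth_equalityI)
  then show ?case using Comp.IH(2) ys'(2) by blast
next
  case (PrimRec_0 f xs y g)
  from PrimRec_0.prems show ?case by (rule rec_eval_PrimRec_0E) (rule PrimRec_0.IH)
next
  case (PrimRec_Suc f g n xs r y)
  from PrimRec_Suc.prems obtain r' where "rec_eval (PrimRec f g) (n # xs) r'" "rec_eval g (n # r' # xs) y'"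
    by (rule rec_eval_PrimRec_SucE)
  then show ?case using PrimRec_Suc.IH by blast
next
  case (Mu f n xs)
  from Mu.prems have "rec_eval f (y' # xs) 0 \<and> (\<forall>m<y'. \<exists>k. rec_eval f (m # xs) (Suc k))"
    by (rule rec_eval_MuE) blast
  then have y': "rec_eval f (y' # xs) 0" "\<And>m. m < y' \<Longrightarrow> \<exists>k. rec_eval f (m # xs) (Suc k)"
    by auto
  have "\<not> y' < n"
  proof
    assume "y' < n"
    then obtain k where "\<forall>z. rec_eval f (y' # xs) z \<longrightarrow> Suc k = z"
      using Mu.IH(2) by blast
    then show False using y'(1) by blast
  qed
  moreover have "\<not> n < y'"
  proof
    assume "n < y'"
    then obtain k where "rec_eval f (n # xs) (Suc k)" using y'(2) by blast
    then show False using Mu.IH(1) by blast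
  qed
  ultimately show ?case by simp
qed

text \<open>A word is presented to a program as a single number, by means of an injective numbering \<open>e\<close>
  of the (finitely many) vertices.\<close>

definition word_code :: "('a \<Rightarrow> nat) \<Rightarrow> 'a word \<Rightarrow> nat" where
  "word_code e w = list_encode (map (\<lambda>l. sum_encode (map_sum e e l)) w)"

definition computes_nf ::
  "('a, 'm) trickle_scheme \<Rightarrow> 'a rel \<Rightarrow> ('a \<Rightarrow> nat) \<Rightarrow> recf \<Rightarrow> bool" where
  "computes_nf G T e f \<longleftrightarrow>
     (\<forall>w\<in>trickle_words G. rec_eval f [word_code e w] (word_code e (nf G T (element G w))))"

text \<open>The program \<open>f\<close> halts on every word, and its output is the empty word exactly when the input
  represents the identity.\<close>

definition output_detects_identity ::
  "('a, 'm) trickle_scheme \<Rightarrow> ('a \<Rightarrow> nat) \<Rightarrow> recf \<Rightarrow> bool" where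
  "output_detects_identity G e f \<longleftrightarrow>
     (\<forall>w\<in>trickle_words G. \<exists>y. rec_eval f [word_code e w] y \<and>
        (element G w = \<one>\<^bsub>Tr G\<^esub> \<longleftrightarrow> y = word_code e []))"

definition decides_word_problem ::
  "('a, 'm) trickle_scheme \<Rightarrow> ('a \<Rightarrow> nat) \<Rightarrow> recf \<Rightarrow> bool" where
  "decides_word_problem G e d \<longleftrightarrow>
     (\<forall>w\<in>trickle_words G. rec_eval d [word_code e w] (if element G w = \<one>\<^bsub>Tr G\<^esub> then 1 else 0))"

end

theory Submission
  imports Defs
begin

text \<open>Words in the syllables \<open>x\<^sup>a\<close> are considered up to shuffles, i.e. up to exchanging two adjacent
  syllables whose vertices span an edge.  The presentation of the shuffle monoid satisfies the cube
  condition, which is axiom (g), so Garside's argument computes common right multiples of letters.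
  Hence a reduced word determines the exponent of its possible first letter with a given vertex,
  \<open>x\<^sup>a\<close> acts on shuffle classes of reduced words by changing this exponent, and this gives an action
  of the whole trickle group.  Acting on the empty word shows that reduced words representing the same
  element differ by shuffles only.  The word of an irreducible piling is reduced, its first stratum is
  the least common multiple of its possible first letters, and a stratum is the set of last letters
  of its word; so irreducible pilings are unique.  They exist because every rule moves a syllable
  towards the front, and iterating the rules is a primitive recursive algorithm when there are
  finitely many vertices.\<close>

section \<open>Recursive functions\<close>

subsection \<open>Total recursive functions\<close>

text \<open>Shuffles preserve the number of syllables and never merge x^a with x^b, although the
  group does. A length-preserving presentation allows the induction behind Garside's lemma, and in
  it two letters with the same vertex and different exponents have no common right multiple. All
  merging is left to the action, which adds to the exponent of the head. Letters carry arbitrary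
  integer exponents, so reduction modulo labels matters only once syllables are formed. The two ends
  of a stratum word behave differently. Bringing a syllable to the front changes its vertex into
  that of \<open>\<gamma>\<close>, while it can be brought to the end unchanged. Hence the rules,
  which compare consecutive strata through \<open>\<gamma>\<close>, become statements about first
  letters, whereas recovering the set from the word needs last letters. Uniqueness does not go
  through confluence: irreducible pilings are compared as reduced words, so the rules only have to
  preserve the element and lower a weight.\<close>

definition computes :: "nat \<Rightarrow> (nat list \<Rightarrow> nat) \<Rightarrow> bool" where
  "computes n f \<longleftrightarrow> (\<exists>p. \<forall>xs. length xs = n \<longrightarrow> rec_eval p xs (f xs))"

lemma computes_cong:
  "computes n f \<Longrightarrow> (\<And>xs. length xs = n \<Longrightarrow> f xs = g xs) \<Longrightarrow> computes n g"
  unfolding computes_def by metis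

lemma computes_nth: "i < n \<Longrightarrow> computes n (\<lambda>xs. xs ! i)"
  unfolding computes_def using rec_eval.Proj by blast

lemma computes_zero: "computes n (\<lambda>_. 0)"
  unfolding computes_def using rec_eval.Zero by blast

lemma computes_comp1:
  assumes "computes 1 f" "computes n g"
  shows "computes n (\<lambda>xs. f [g xs])"
proof -
  obtain p q where "\<And>xs. length xs = 1 \<Longrightarrow> rec_eval p xs (f xs)"
    "\<And>xs. length xs = n \<Longrightarrow> rec_eval q xs (g xs)" using assms unfolding computes_def by metis
  then have "length xs = n \<Longrightarrow> rec_eval (Comp p [q]) xs (f [g xs])" for xs
    by (intro rec_eval.Comp[of _ _ "[g xs]"]) auto
  then show ?thesis unfolding computes_def by blast
qed

lemma computes_suc:
  assumes "computes n f" shows "computes n (\<lambda>xs. Suc (f xs))"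
proof -
  have "rec_eval Succ xs (Suc (hd xs))" if "length xs = 1" for xs
    using that rec_eval.Succ[of "hd xs"] by (cases xs) auto
  then have "computes 1 (\<lambda>xs. Suc (hd xs))" unfolding computes_def by blast
  from computes_comp1[OF this assms] show ?thesis by simp
qed

lemma computes_const: "computes n (\<lambda>_. k)"
  by (induction k) (auto intro: computes_zero computes_suc)

text \<open>Used to discard the counter and the accumulator that \<open>PrimRec\<close> puts in
  front of the parameters.\<close>

lemma computes_drop:
  assumes "computes n f"
  shows "computes (m + n) (\<lambda>xs. f (drop m xs))"
proof -
  obtain p where p: "\<And>xs. length xs = n \<Longrightarrow> rec_eval p xs (f xs)"
    using assms unfolding computes_def by metis
  have "rec_eval (Comp p (map Proj [m..<m + n])) xs (f (drop m xs))" if "length xs = m + n" for xs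
  proof (rule rec_eval.Comp)
    have "drop m xs = map ((!) xs) [m..<m + n]" using that by (simp add: list_eq_iff_nth_eq)
    then show "list_all2 (\<lambda>g. rec_eval g xs) (map Proj [m..<m + n]) (drop m xs)"
      using that by (auto simp: list_all2_conv_all_nth intro: rec_eval.Proj)
  qed (use that p in simp)
  then show ?thesis unfolding computes_def by blast
qed

lemma computes_rec:
  assumes "computes n k" "computes n z" "computes (Suc (Suc n)) s"
  shows "computes n (\<lambda>xs. rec_nat (z xs) (\<lambda>m r. s (m # r # xs)) (k xs))"
proof -
  obtain pk pz ps where p: "\<And>xs. length xs = n \<Longrightarrow> rec_eval pk xs (k xs)"
    "\<And>xs. length xs = n \<Longrightarrow> rec_eval pz xs (z xs)"
    "\<And>xs. length xs = Suc (Suc n) \<Longrightarrow> rec_eval ps xs (s xs)"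
    using assms unfolding computes_def by metis
  have r: "rec_eval (PrimRec pz ps) (m # xs) (rec_nat (z xs) (\<lambda>m r. s (m # r # xs)) m)"
    if "length xs = n" for m xs
    using that p by (induction m) (auto intro: rec_eval.PrimRec_0 rec_eval.PrimRec_Suc)
  have "rec_eval (Comp (PrimRec pz ps) (pk # map Proj [0..<n])) xs
      (rec_nat (z xs) (\<lambda>m r. s (m # r # xs)) (k xs))" if "length xs = n" for xs
  proof (rule rec_eval.Comp[OF _ r[OF that]])
    have "list_all2 (\<lambda>g. rec_eval g xs) (map Proj [0..<n]) xs"
      using that by (auto simp: list_all2_conv_all_nth intro: rec_eval.Proj)
    then show "list_all2 (\<lambda>g. rec_eval g xs) (pk # map Proj [0..<n]) (k xs # xs)"
      using that p(1) by simp
  qed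
  then show ?thesis unfolding computes_def by blast
qed

lemma computes_add:
  assumes "computes n f" "computes n g" shows "computes n (\<lambda>xs. f xs + g xs)"
proof (rule computes_cong)
  show "computes n (\<lambda>xs. rec_nat (g xs) (\<lambda>m r. (\<lambda>ys. Suc (ys ! 1)) (m # r # xs)) (f xs))"
    by (intro computes_rec computes_suc computes_nth assms) simp
  have "rec_nat b (\<lambda>_ r. Suc r) a = a + b" for a b :: nat by (induction a) auto
  then show "rec_nat (g xs) (\<lambda>m r. (\<lambda>ys. Suc (ys ! 1)) (m # r # xs)) (f xs) = f xs + g xs" for xs
    by simp
qed

lemma computes_pred:
  assumes "computes n f" shows "computes n (\<lambda>xs. f xs - 1)"
proof (rule computes_cong)
  show "computes n (\<lambda>xs. rec_nat 0 (\<lambda>m r. (\<lambda>ys. ys ! 0) (m # r # xs)) (f xs))"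
    by (intro computes_rec computes_zero computes_nth assms) simp
  show "rec_nat 0 (\<lambda>m r. (\<lambda>ys. ys ! 0) (m # r # xs)) (f xs) = f xs - 1" for xs
    by (cases "f xs") auto
qed

lemma computes_diff:
  assumes "computes n f" "computes n g" shows "computes n (\<lambda>xs. f xs - g xs)"
proof (rule computes_cong)
  show "computes n (\<lambda>xs. rec_nat (f xs) (\<lambda>m r. (\<lambda>ys. ys ! 1 - 1) (m # r # xs)) (g xs))"
    by (intro computes_rec computes_pred computes_nth assms) simp
  have "rec_nat a (\<lambda>_ r. r - 1) b = a - b" for a b :: nat by (induction b) auto
  then show "rec_nat (f xs) (\<lambda>m r. (\<lambda>ys. ys ! 1 - 1) (m # r # xs)) (g xs) = f xs - g xs" for xs
    by simp
qed

text \<open>A recursion whose step ignores its previous value returns the base value at 0 and the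
  step value elsewhere, so it branches on zero.\<close>

lemma computes_if:
  assumes "computes n c" "computes n f" "computes n g"
  shows "computes n (\<lambda>xs. if c xs = 0 then f xs else g xs)"
proof (rule computes_cong)
  show "computes n (\<lambda>xs. rec_nat (f xs) (\<lambda>m r. (\<lambda>ys. g (drop 2 ys)) (m # r # xs)) (c xs))"
    using computes_drop[OF assms(3), of 2] by (intro computes_rec assms) simp
  show "rec_nat (f xs) (\<lambda>m r. (\<lambda>ys. g (drop 2 ys)) (m # r # xs)) (c xs)
      = (if c xs = 0 then f xs else g xs)" for xs
    by (cases "c xs") auto
qed

text \<open>Two numbers are equal exactly when both truncated differences vanish.\<close>

lemma computes_if_eq:
  assumes "computes n a" "computes n b" "computes n f" "computes n g"
  shows "computes n (\<lambda>xs. if a xs = b xs then f xs else g xs)"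
proof (rule computes_cong)
  show "computes n (\<lambda>xs. if (a xs - b xs) + (b xs - a xs) = 0 then f xs else g xs)"
    by (intro computes_if computes_add computes_diff assms)
qed auto

lemma computes_triangle:
  assumes "computes n f" shows "computes n (\<lambda>xs. triangle (f xs))"
proof (rule computes_cong)
  show "computes n (\<lambda>xs. rec_nat 0 (\<lambda>m r. (\<lambda>ys. ys ! 1 + Suc (ys ! 0)) (m # r # xs)) (f xs))"
    by (intro computes_rec computes_zero computes_add computes_suc computes_nth assms) simp_all
  have "rec_nat 0 (\<lambda>m r. r + Suc m) a = triangle a" for a by (induction a) auto
  then show "rec_nat 0 (\<lambda>m r. (\<lambda>ys. ys ! 1 + Suc (ys ! 0)) (m # r # xs)) (f xs) = triangle (f xs)" for xs
    by simp
qed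

lemma computes_prod_encode:
  "computes n f \<Longrightarrow> computes n g \<Longrightarrow> computes n (\<lambda>xs. prod_encode (f xs, g xs))"
  unfolding prod_encode_def by (simp add: computes_triangle computes_add)

text \<open>\<open>diagonal z\<close> is the largest \<open>k\<close> with \<open>triangle k \<le> z\<close>, that is, \<open>m + n\<close> for
  \<open>z = prod_encode (m, n)\<close>.\<close>

definition diagonal :: "nat \<Rightarrow> nat" where
  "diagonal = rec_nat 0 (\<lambda>z r. if triangle (Suc r) = Suc z then Suc r else r)"

lemma diagonal_eq: "triangle k \<le> z \<Longrightarrow> z < triangle (Suc k) \<Longrightarrow> diagonal z = k"
proof (induction z arbitrary: k)
  case 0
  then show ?case by (cases k) (auto simp: diagonal_def)
next
  case (Suc z)
  have d: "diagonal (Suc z) = (if triangle (Suc (diagonal z)) = Suc z then Suc (diagonal z) else diagonal z)"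
    by (simp add: diagonal_def)
  show ?case
  proof (cases "triangle k \<le> z")
    case True
    then have "diagonal z = k" using Suc by simp
    then show ?thesis using Suc.prems d by simp
  next
    case False
    \<comment> \<open>The number \<open>Suc z\<close> opens the diagonal \<open>k\<close>, so
      \<open>z\<close> is the last number on the previous one and the test in the recursion
      succeeds.\<close>
    then have tk: "triangle k = Suc z" using Suc.prems by simp
    then obtain j where k: "k = Suc j" by (cases k) auto
    have "diagonal z = j" using tk k by (intro Suc.IH) auto
    then show ?thesis using tk k d by simp
  qed
qed

lemma diagonal_prod_encode: "diagonal (prod_encode (m, n)) = m + n"
  by (rule diagonal_eq) (simp_all add: prod_encode_def)

lemma computes_diagonal:
  assumes "computes n f" shows "computes n (\<lambda>xs. diagonal (f xs))"
proof (rule computes_cong)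
  let ?s = "\<lambda>ys. if triangle (Suc (ys ! 1)) = Suc (ys ! 0) then Suc (ys ! 1) else ys ! 1"
  show "computes n (\<lambda>xs. rec_nat 0 (\<lambda>m r. ?s (m # r # xs)) (f xs))"
    by (intro computes_rec computes_zero computes_if_eq computes_triangle computes_suc
        computes_nth assms) simp_all
qed (simp add: diagonal_def cong: if_cong)

lemma computes_prod_decode:
  assumes "computes n f"
  shows "computes n (\<lambda>xs. fst (prod_decode (f xs)))" "computes n (\<lambda>xs. snd (prod_decode (f xs)))"
proof -
  have 1: "fst (prod_decode z) = z - triangle (diagonal z)" for z
    using diagonal_prod_encode[of "fst (prod_decode z)" "snd (prod_decode z)"]
      prod_decode_inverse[of z] unfolding prod_encode_def split_beta
    by (metis add_diff_cancel_left' fst_conv prod.collapse snd_conv)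
  have 2: "snd (prod_decode z) = diagonal z - fst (prod_decode z)" for z
    using diagonal_prod_encode[of "fst (prod_decode z)" "snd (prod_decode z)"] by simp
  show *: "computes n (\<lambda>xs. fst (prod_decode (f xs)))"
    unfolding 1 by (intro computes_diff computes_triangle computes_diagonal assms)
  show "computes n (\<lambda>xs. snd (prod_decode (f xs)))"
    unfolding 2 by (intro computes_diff computes_diagonal assms *)
qed

text \<open>All data are coded by single numbers, with parameters packed into pairs, so unary
  functions suffice from here on.\<close>

definition recursive1 :: "(nat \<Rightarrow> nat) \<Rightarrow> bool" where
  "recursive1 g \<longleftrightarrow> computes 1 (\<lambda>xs. g (xs ! 0))"

lemma recursive1_comp: "recursive1 f \<Longrightarrow> recursive1 g \<Longrightarrow> recursive1 (\<lambda>x. f (g x))"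
  unfolding recursive1_def using computes_comp1[of "\<lambda>xs. f (xs ! 0)" 1] by simp

lemma recursive1_intros:
  "recursive1 (\<lambda>x. x)" "recursive1 (\<lambda>_. k)"
  "recursive1 f \<Longrightarrow> recursive1 (\<lambda>x. Suc (f x))"
  "recursive1 f \<Longrightarrow> recursive1 g \<Longrightarrow> recursive1 (\<lambda>x. f x + g x)"
  "recursive1 f \<Longrightarrow> recursive1 g \<Longrightarrow> recursive1 (\<lambda>x. f x - g x)"
  "recursive1 f \<Longrightarrow> recursive1 g \<Longrightarrow> recursive1 (\<lambda>x. prod_encode (f x, g x))"
  "recursive1 f \<Longrightarrow> recursive1 (\<lambda>x. fst (prod_decode (f x)))"
  "recursive1 f \<Longrightarrow> recursive1 (\<lambda>x. snd (prod_decode (f x)))"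
  "recursive1 a \<Longrightarrow> recursive1 b \<Longrightarrow> recursive1 f \<Longrightarrow> recursive1 g \<Longrightarrow>
     recursive1 (\<lambda>x. if a x = b x then f x else g x)"
  unfolding recursive1_def
  by (auto intro: computes_nth computes_const computes_suc computes_add computes_diff
      computes_prod_encode computes_prod_decode computes_if_eq)

text \<open>The step sees the parameter and the accumulator but not the counter, which is all that
  iterating a map requires.\<close>

lemma recursive1_rec:
  assumes "recursive1 k" "recursive1 z" "recursive1 s"
  shows "recursive1 (\<lambda>x. rec_nat (z x) (\<lambda>_ r. s (prod_encode (x, r))) (k x))"
  unfolding recursive1_def
proof (rule computes_cong)
  show "computes 1 (\<lambda>xs. rec_nat (z (xs ! 0))
      (\<lambda>m r. (\<lambda>ys. s (prod_encode (ys ! 2, ys ! 1))) (m # r # xs)) (k (xs ! 0)))"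
    using assms unfolding recursive1_def
    using computes_comp1[of "\<lambda>xs. s (xs ! 0)" 3 "\<lambda>ys. prod_encode (ys ! 2, ys ! 1)"]
    by (intro computes_rec) (simp_all add: computes_prod_encode computes_nth numeral_3_eq_3)
qed simp

lemma recursive1_program:
  assumes "recursive1 g" obtains p where "\<And>x. rec_eval p [x] (g x)"
  using assms unfolding recursive1_def computes_def
  by (metis One_nat_def length_Cons list.size(3) nth_Cons_0)

subsection \<open>Computable functions on encoded data\<close>

type_synonym 'b encoding = "'b set \<times> ('b \<Rightarrow> nat)"

text \<open>The witness is total recursive, with arbitrary values at numbers outside the image of the
  carrier.\<close>

definition computable :: "'b encoding \<Rightarrow> 'c encoding \<Rightarrow> ('b \<Rightarrow> 'c) \<Rightarrow> bool" where
  "computable E F f \<longleftrightarrow> (\<forall>x\<in>fst E. f x \<in> fst F) \<and>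
     (\<exists>g. recursive1 g \<and> (\<forall>x\<in>fst E. snd F (f x) = g (snd E x)))"

definition natE :: "nat encoding" where "natE = (UNIV, \<lambda>n. n)"

definition boolE :: "bool encoding" where "boolE = (UNIV, of_bool)"

text \<open>The positive and negative parts are directly usable as iteration counts for powers in
  either direction.\<close>

definition intE :: "int encoding" where
  "intE = (UNIV, \<lambda>a. prod_encode (nat a, nat (- a)))"

definition prodE :: "'b encoding \<Rightarrow> 'c encoding \<Rightarrow> ('b \<times> 'c) encoding" where
  "prodE E F = (fst E \<times> fst F, \<lambda>(x, y). prod_encode (snd E x, snd F y))"

definition listE :: "'b encoding \<Rightarrow> 'b list encoding" where
  "listE E = (lists (fst E), \<lambda>l. list_encode (map (snd E) l))"

lemma computableI:
  "recursive1 g \<Longrightarrow> (\<And>x. x \<in> fst E \<Longrightarrow> f x \<in> fst F \<and> snd F (f x) = g (snd E x)) \<Longrightarrow> computable E F f"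
  unfolding computable_def by blast

lemma computableD:
  "computable E F f \<Longrightarrow> \<exists>g. recursive1 g \<and> (\<forall>x\<in>fst E. f x \<in> fst F \<and> snd F (f x) = g (snd E x))"
  unfolding computable_def by blast

lemma computable_cong:
  "computable E F f \<Longrightarrow> (\<And>x. x \<in> fst E \<Longrightarrow> f x = g x) \<Longrightarrow> computable E F g"
  unfolding computable_def by simp

lemma computable_comp:
  assumes "computable F H g" "computable E F f"
  shows "computable E H (\<lambda>x. g (f x))"
proof -
  obtain a where "recursive1 a" "\<forall>x\<in>fst F. g x \<in> fst H \<and> snd H (g x) = a (snd F x)"
    using computableD[OF assms(1)] by blast
  moreover obtain b where "recursive1 b" "\<forall>x\<in>fst E. f x \<in> fst F \<and> snd F (f x) = b (snd E x)"
    using computableD[OF assms(2)] by blast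
  ultimately show ?thesis by (intro computableI[of "\<lambda>x. a (b x)"]) (auto intro: recursive1_comp)
qed

lemma computable_id: "computable E E (\<lambda>x. x)"
  by (rule computableI[OF recursive1_intros(1)]) simp

lemma computable_const: "c \<in> fst F \<Longrightarrow> computable E F (\<lambda>_. c)"
  by (rule computableI[OF recursive1_intros(2)]) simp

lemma computable_0: "computable E natE (\<lambda>_. 0)"
  by (rule computable_const) (simp add: natE_def)

lemma computable_pair:
  assumes "computable D E f" "computable D F g"
  shows "computable D (prodE E F) (\<lambda>x. (f x, g x))"
proof -
  obtain a where "recursive1 a" "\<forall>x\<in>fst D. f x \<in> fst E \<and> snd E (f x) = a (snd D x)"
    using computableD[OF assms(1)] by blast
  moreover obtain b where "recursive1 b" "\<forall>x\<in>fst D. g x \<in> fst F \<and> snd F (g x) = b (snd D x)"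
    using computableD[OF assms(2)] by blast
  ultimately show ?thesis
    by (intro computableI[of "\<lambda>x. prod_encode (a x, b x)"]) (auto intro: recursive1_intros simp: prodE_def)
qed

lemma computable_fst: "computable D (prodE E F) f \<Longrightarrow> computable D E (\<lambda>x. fst (f x))"
  by (rule computable_comp[where F = "prodE E F"], rule computableI[OF recursive1_intros(7)[OF recursive1_intros(1)]])
    (auto simp: prodE_def)

lemma computable_snd: "computable D (prodE E F) f \<Longrightarrow> computable D F (\<lambda>x. snd (f x))"
  by (rule computable_comp[where F = "prodE E F"], rule computableI[OF recursive1_intros(8)[OF recursive1_intros(1)]])
    (auto simp: prodE_def)

lemma computable_code: "computable D E f \<Longrightarrow> computable D natE (\<lambda>x. snd E (f x))"
  by (rule computable_comp[where F = E], rule computableI[OF recursive1_intros(1)]) (auto simp: natE_def)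

lemma computable_nat:
  assumes "computable D natE f"
  shows "computable D natE (\<lambda>x. Suc (f x))" "computable D boolE (\<lambda>x. f x = 0)"
proof -
  obtain g where g: "recursive1 g" "\<forall>x\<in>fst D. f x \<in> fst natE \<and> snd natE (f x) = g (snd D x)"
    using computableD[OF assms] by blast
  show "computable D natE (\<lambda>x. Suc (f x))"
    using g by (intro computableI[of "\<lambda>x. Suc (g x)"] recursive1_intros) (auto simp: natE_def)
  show "computable D boolE (\<lambda>x. f x = 0)"
    using g by (intro computableI[of "\<lambda>x. if g x = 0 then 1 else 0"] recursive1_intros)
      (auto simp: natE_def boolE_def)
qed

lemma computable_nat2:
  assumes "computable D natE f" "computable D natE g"
  shows "computable D natE (\<lambda>x. f x + g x)" "computable D natE (\<lambda>x. f x - g x)"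
    "computable D boolE (\<lambda>x. f x = g x)"
proof -
  obtain a where a: "recursive1 a" "\<forall>x\<in>fst D. f x \<in> fst natE \<and> snd natE (f x) = a (snd D x)"
    using computableD[OF assms(1)] by blast
  obtain b where b: "recursive1 b" "\<forall>x\<in>fst D. g x \<in> fst natE \<and> snd natE (g x) = b (snd D x)"
    using computableD[OF assms(2)] by blast
  note * = a(1) b(1) bspec[OF a(2), unfolded natE_def, simplified] bspec[OF b(2), unfolded natE_def, simplified]
  show "computable D natE (\<lambda>x. f x + g x)"
    using * by (intro computableI[of "\<lambda>x. a x + b x"] recursive1_intros) (auto simp: natE_def)
  show "computable D natE (\<lambda>x. f x - g x)"
    using * by (intro computableI[of "\<lambda>x. a x - b x"] recursive1_intros) (auto simp: natE_def)
  show "computable D boolE (\<lambda>x. f x = g x)"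
    using * by (intro computableI[of "\<lambda>x. if a x = b x then 1 else 0"] recursive1_intros)
      (auto simp: boolE_def)
qed

lemma computable_if:
  assumes "computable D boolE b" "computable D E f" "computable D E g"
  shows "computable D E (\<lambda>x. if b x then f x else g x)"
proof -
  obtain c where c: "recursive1 c"
      "\<forall>x\<in>fst D. b x \<in> fst boolE \<and> snd boolE (b x) = c (snd D x)"
    using computableD[OF assms(1)] by blast
  obtain p where p: "recursive1 p" "\<forall>x\<in>fst D. f x \<in> fst E \<and> snd E (f x) = p (snd D x)"
    using computableD[OF assms(2)] by blast
  obtain q where q: "recursive1 q" "\<forall>x\<in>fst D. g x \<in> fst E \<and> snd E (g x) = q (snd D x)"
    using computableD[OF assms(3)] by blast
  show ?thesis
  proof (rule computableI)
    show "recursive1 (\<lambda>x. if c x = 0 then q x else p x)"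
      by (intro recursive1_intros c p q)
    fix x assume x: "x \<in> fst D"
    then have "c (snd D x) = of_bool (b x)" using c(2) by (simp add: boolE_def)
    then show "(if b x then f x else g x) \<in> fst E \<and> snd E (if b x then f x else g x)
        = (if c (snd D x) = 0 then q (snd D x) else p (snd D x))"
      using bspec[OF p(2) x] bspec[OF q(2) x] by simp
  qed
qed

lemma computable_bool:
  assumes "computable D boolE b"
  shows "computable D boolE (\<lambda>x. \<not> b x)"
    "computable D boolE c \<Longrightarrow> computable D boolE (\<lambda>x. b x \<and> c x)"
    "computable D boolE c \<Longrightarrow> computable D boolE (\<lambda>x. b x \<or> c x)"
proof -
  have *: "computable D boolE (\<lambda>_. k)" for k by (rule computable_const) (simp add: boolE_def)
  show "computable D boolE (\<lambda>x. \<not> b x)"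
    by (rule computable_cong[OF computable_if[OF assms *[of False] *[of True]]]) simp
  show "computable D boolE (\<lambda>x. b x \<and> c x)" if "computable D boolE c"
    by (rule computable_cong[OF computable_if[OF assms that *[of False]]]) simp
  show "computable D boolE (\<lambda>x. b x \<or> c x)" if "computable D boolE c"
    by (rule computable_cong[OF computable_if[OF assms *[of True] that]]) simp
qed

text \<open>The only form of recursion used on encoded data; folds, arithmetic and the final
  algorithm are all reduced to iterating a map.\<close>

lemma computable_funpow:
  assumes "computable D natE n" "computable (prodE D E) E (\<lambda>x. f (fst x) (snd x))" "computable D E z"
  shows "computable D E (\<lambda>d. (f d ^^ n d) (z d))"
proof -
  obtain k where k: "recursive1 k" "\<forall>x\<in>fst D. n x \<in> fst natE \<and> snd natE (n x) = k (snd D x)"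
    using computableD[OF assms(1)] by blast
  obtain s where s: "recursive1 s" "\<forall>x\<in>fst (prodE D E).
      f (fst x) (snd x) \<in> fst E \<and> snd E (f (fst x) (snd x)) = s (snd (prodE D E) x)"
    using computableD[OF assms(2)] by blast
  obtain c where c: "recursive1 c" "\<forall>x\<in>fst D. z x \<in> fst E \<and> snd E (z x) = c (snd D x)"
    using computableD[OF assms(3)] by blast
  have k2: "n x = k (snd D x)" if "x \<in> fst D" for x using bspec[OF k(2) that] by (simp add: natE_def)
  have s2: "f d x \<in> fst E \<and> snd E (f d x) = s (prod_encode (snd D d, snd E x))"
    if "d \<in> fst D" "x \<in> fst E" for d x
    using bspec[OF s(2), of "(d, x)"] that by (simp add: prodE_def)
  have *: "(f d ^^ m) (z d) \<in> fst E \<and>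
      snd E ((f d ^^ m) (z d)) = rec_nat (c (snd D d)) (\<lambda>_ r. s (prod_encode (snd D d, r))) m"
    if "d \<in> fst D" for d m
    using that c(2) s2 by (induction m) auto
  show ?thesis
    by (rule computableI[OF recursive1_rec[OF k(1) c(1) s(1)]]) (simp only: k2 *)
qed

section \<open>Operations on lists\<close>

lemma computable_Nil: "computable D (listE E) (\<lambda>_. [])"
  by (rule computable_const) (simp add: listE_def)

lemma computable_Cons:
  assumes "computable D E f" "computable D (listE E) g"
  shows "computable D (listE E) (\<lambda>x. f x # g x)"
proof -
  obtain a where a: "recursive1 a" "\<forall>x\<in>fst D. f x \<in> fst E \<and> snd E (f x) = a (snd D x)"
    using computableD[OF assms(1)] by blast
  obtain b where b: "recursive1 b"
      "\<forall>x\<in>fst D. g x \<in> fst (listE E) \<and> snd (listE E) (g x) = b (snd D x)"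
    using computableD[OF assms(2)] by blast
  show ?thesis
  proof (rule computableI)
    show "recursive1 (\<lambda>x. Suc (prod_encode (a x, b x)))" by (intro recursive1_intros a b)
    fix x assume x: "x \<in> fst D"
    show "f x # g x \<in> fst (listE E) \<and> snd (listE E) (f x # g x) = Suc (prod_encode (a (snd D x), b (snd D x)))"
      using bspec[OF a(2) x] bspec[OF b(2) x] by (simp add: listE_def)
  qed
qed

lemma computable_list_case:
  assumes "computable D (listE E) l" "computable D F z"
    "computable (prodE D (prodE E (listE E))) F (\<lambda>x. f (fst x) (fst (snd x)) (snd (snd x)))"
  shows "computable D F (\<lambda>d. case l d of [] \<Rightarrow> z d | a # as \<Rightarrow> f d a as)"
proof -
  obtain k where k: "recursive1 k"
      "\<forall>x\<in>fst D. l x \<in> fst (listE E) \<and> snd (listE E) (l x) = k (snd D x)"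
    using computableD[OF assms(1)] by blast
  obtain c where c: "recursive1 c" "\<forall>x\<in>fst D. z x \<in> fst F \<and> snd F (z x) = c (snd D x)"
    using computableD[OF assms(2)] by blast
  obtain s where s: "recursive1 s" "\<forall>x\<in>fst (prodE D (prodE E (listE E))).
      f (fst x) (fst (snd x)) (snd (snd x)) \<in> fst F \<and>
      snd F (f (fst x) (fst (snd x)) (snd (snd x))) = s (snd (prodE D (prodE E (listE E))) x)"
    using computableD[OF assms(3)] by blast
  have s2: "f d a as \<in> fst F \<and> snd F (f d a as) =
      s (prod_encode (snd D d, prod_encode (snd E a, list_encode (map (snd E) as))))"
    if "d \<in> fst D" "a \<in> fst E" "as \<in> lists (fst E)" for d a as
    using bspec[OF s(2), of "(d, a, as)"] that by (simp add: prodE_def listE_def)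
  show ?thesis
  \<comment> \<open>A nonempty list has code one plus the pair of the codes of head and tail, so the
    predecessor of the code is the argument that \<open>s\<close> expects.\<close>
  proof (rule computableI[of "\<lambda>x. if k x = 0 then c x else s (prod_encode (x, k x - 1))"])
    show "recursive1 (\<lambda>x. if k x = 0 then c x else s (prod_encode (x, k x - 1)))"
      by (intro recursive1_intros(2,9) recursive1_comp[OF s(1) recursive1_intros(6)]
          recursive1_intros(1,5) k c)
    fix d assume d: "d \<in> fst D"
    then show "(case l d of [] \<Rightarrow> z d | a # as \<Rightarrow> f d a as) \<in> fst F \<and>
      snd F (case l d of [] \<Rightarrow> z d | a # as \<Rightarrow> f d a as) =
      (if k (snd D d) = 0 then c (snd D d) else s (prod_encode (snd D d, k (snd D d) - 1)))"
    proof -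
      have "k (snd D d) = list_encode (map (snd E) (l d))" "l d \<in> lists (fst E)"
        using bspec[OF k(2) d] by (auto simp: listE_def)
      then show ?thesis using s2[OF d] bspec[OF c(2) d] by (cases "l d") auto
    qed
  qed
qed

text \<open>Lets the code of a list serve as an iteration bound before the length is known to be
  computable.\<close>

lemma length_le_list_encode: "length l \<le> list_encode l"
proof (induction l)
  case (Cons a l)
  then show ?case using le_prod_encode_2[of "list_encode l" a] by simp
qed simp

text \<open>Surplus iterations are harmless, since a state with an empty remaining list is a fixed
  point. Any upper bound for the length is therefore good enough.\<close>

lemma foldl_funpow:
  assumes "length l \<le> n"
  shows "((\<lambda>s. case snd s of [] \<Rightarrow> s | a # as \<Rightarrow> (f (fst s) a, as)) ^^ n) (z, l) = (foldl f z l, [])"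
    (is "(?F ^^ n) _ = _")
  using assms
proof (induction n arbitrary: z l)
  case (Suc n)
  have "(?F ^^ Suc n) (z, l) = (?F ^^ n) (?F (z, l))" by (simp only: funpow_Suc_right comp_apply)
  then show ?case using Suc by (cases l) auto
qed simp

lemma computable_foldl:
  assumes "computable D (listE A) l" "computable D B z"
    "computable (prodE D (prodE B A)) B (\<lambda>x. f (fst x) (fst (snd x)) (snd (snd x)))"
  shows "computable D B (\<lambda>d. foldl (f d) (z d) (l d))"
proof -
  let ?F = "\<lambda>d s. case snd s of [] \<Rightarrow> s | a # as \<Rightarrow> (f d (fst s) a, as)"
  have f: "computable (prodE (prodE D (prodE B (listE A))) (prodE A (listE A))) B
      (\<lambda>x. f (fst (fst x)) (fst (snd (fst x))) (fst (snd x)))"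
    by (rule computable_comp[OF assms(3), where f = "\<lambda>x. (fst (fst x), fst (snd (fst x)), fst (snd x))",
          unfolded fst_conv snd_conv])
      (rule computable_id computable_pair computable_fst computable_snd)+
  have n: "computable D natE (\<lambda>d. list_encode (map (snd A) (l d)))"
    using computable_code[OF assms(1)] by (simp add: listE_def)
  have "computable D (prodE B (listE A)) (\<lambda>d. (?F d ^^ list_encode (map (snd A) (l d))) (z d, l d))"
  proof (rule computable_funpow[OF n])
    show "computable (prodE D (prodE B (listE A))) (prodE B (listE A)) (\<lambda>x. ?F (fst x) (snd x))"
    proof (rule computable_list_case)
      show "computable (prodE (prodE D (prodE B (listE A))) (prodE A (listE A))) (prodE B (listE A))
          (\<lambda>x. (f (fst (fst x)) (fst (snd (fst x))) (fst (snd x)), snd (snd x)))"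
        by (rule computable_pair[OF f]) (rule computable_id computable_snd)+
    qed (rule computable_id computable_snd)+
    show "computable D (prodE B (listE A)) (\<lambda>d. (z d, l d))" by (rule computable_pair assms)+
  qed
  then have "computable D B (\<lambda>d. fst ((?F d ^^ list_encode (map (snd A) (l d))) (z d, l d)))"
    by (rule computable_fst)
  moreover have "length (l d) \<le> list_encode (map (snd A) (l d))" for d
    using length_le_list_encode[of "map (snd A) (l d)"] by simp
  ultimately show ?thesis by (simp only: foldl_funpow fst_conv)
qed

lemma computable_rev:
  assumes "computable D (listE A) l"
  shows "computable D (listE A) (\<lambda>d. rev (l d))"
proof -
  have "foldl (\<lambda>r a. a # r) k xs = rev xs @ k" for k and xs :: "'b list" by (induction xs arbitrary: k) auto
  moreover have "computable D (listE A) (\<lambda>d. foldl ((\<lambda>_ r a. a # r) d) [] (l d))"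
    by (rule computable_id computable_foldl assms computable_Nil computable_Cons computable_fst computable_snd)+
  ultimately show ?thesis by simp
qed

lemma computable_foldr:
  assumes "computable D (listE A) l" "computable D B z"
    "computable (prodE D (prodE A B)) B (\<lambda>x. f (fst x) (fst (snd x)) (snd (snd x)))"
  shows "computable D B (\<lambda>d. foldr (f d) (l d) (z d))"
proof -
  have f: "computable (prodE D (prodE B A)) B (\<lambda>x. f (fst x) (snd (snd x)) (fst (snd x)))"
    by (rule computable_comp[OF assms(3), where f = "\<lambda>x. (fst x, snd (snd x), fst (snd x))",
          unfolded fst_conv snd_conv])
      (rule computable_id computable_pair computable_fst computable_snd)+
  show ?thesis
    unfolding foldr_conv_foldl
    by (rule computable_id computable_foldl[where f = "\<lambda>d x y. f d y x"] computable_rev assms f)+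
qed

lemma computable_map:
  assumes "computable D (listE A) l" "computable (prodE D A) B (\<lambda>x. f (fst x) (snd x))"
  shows "computable D (listE B) (\<lambda>d. map (f d) (l d))"
proof -
  have "map (f d) k = foldr (\<lambda>a r. f d a # r) k []" for d k by (induction k) auto
  moreover have f: "computable (prodE D (prodE A (listE B))) B (\<lambda>x. f (fst x) (fst (snd x)))"
    by (rule computable_comp[OF assms(2), where f = "\<lambda>x. (fst x, fst (snd x))", unfolded fst_conv snd_conv])
      (rule computable_id computable_pair computable_fst computable_snd)+
  have "computable D (listE B) (\<lambda>d. foldr ((\<lambda>d a r. f d a # r) d) (l d) [])"
    by (rule computable_id computable_foldr assms f computable_Nil computable_Cons computable_snd)+
  ultimately show ?thesis by simp
qed

lemma computable_filter:
  assumes "computable D (listE A) l" "computable (prodE D A) boolE (\<lambda>x. P (fst x) (snd x))"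
  shows "computable D (listE A) (\<lambda>d. filter (P d) (l d))"
proof -
  have "filter (P d) k = foldr (\<lambda>a r. if P d a then a # r else r) k []" for d k by (induction k) auto
  moreover have f: "computable (prodE D (prodE A (listE A))) boolE (\<lambda>x. P (fst x) (fst (snd x)))"
    by (rule computable_comp[OF assms(2), where f = "\<lambda>x. (fst x, fst (snd x))", unfolded fst_conv snd_conv])
      (rule computable_id computable_pair computable_fst computable_snd)+
  have "computable D (listE A) (\<lambda>d. foldr ((\<lambda>d a r. if P d a then a # r else r) d) (l d) [])"
    by (rule computable_id computable_foldr assms f computable_if computable_Nil computable_Cons computable_fst computable_snd)+
  ultimately show ?thesis by simp
qed

lemma computable_append:
  assumes "computable D (listE A) l" "computable D (listE A) k"
  shows "computable D (listE A) (\<lambda>d. l d @ k d)"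
proof -
  have "a @ b = foldr (\<lambda>x r. x # r) a b" for a b :: "'b list" by (induction a) auto
  moreover have "computable D (listE A) (\<lambda>d. foldr ((\<lambda>_ x r. x # r) d) (l d) (k d))"
    by (rule computable_id computable_foldr assms computable_Cons computable_fst computable_snd)+
  ultimately show ?thesis by simp
qed

lemma computable_concat:
  assumes "computable D (listE (listE A)) l"
  shows "computable D (listE A) (\<lambda>d. concat (l d))"
proof -
  have "concat a = foldr (\<lambda>x r. x @ r) a []" for a :: "'b list list" by (induction a) auto
  moreover have "computable D (listE A) (\<lambda>d. foldr ((\<lambda>_ x r. x @ r) d) (l d) [])"
    by (rule computable_id computable_foldr assms computable_append computable_Nil computable_fst computable_snd)+
  ultimately show ?thesis by simp
qed

lemma computable_length:
  assumes "computable D (listE A) l"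
  shows "computable D natE (\<lambda>d. length (l d))"
proof -
  have "length a = foldr (\<lambda>_ n. Suc n) a 0" for a :: "'b list" by (induction a) auto
  moreover have "computable D natE (\<lambda>d. foldr ((\<lambda>_ _ n. Suc n) d) (l d) 0)"
    by (rule computable_id computable_foldr assms computable_nat computable_0 computable_snd)+
  ultimately show ?thesis by simp
qed

lemma computable_is_Nil:
  assumes "computable D (listE A) l"
  shows "computable D boolE (\<lambda>d. l d = [])"
proof -
  have "computable D boolE (\<lambda>d. length (l d) = 0)" by (rule computable_id computable_nat computable_length assms)+
  then show ?thesis by simp
qed

text \<open>A table is a chain of equality tests on codes, which injectivity of the coding makes
  unambiguous. In this way an arbitrary finite trickle graph becomes part of the program.\<close>

lemma computable_finite:
  assumes "finite (fst E)" "inj_on (snd E) (fst E)" "\<And>x. x \<in> fst E \<Longrightarrow> f x \<in> fst F"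
  shows "computable E F f"
proof -
  have "\<exists>g. recursive1 g \<and> (\<forall>x\<in>A. snd F (f x) = g (snd E x))" if "A \<subseteq> fst E" "finite A" for A
    using that(2,1)
  proof (induction A rule: finite_induct)
    case empty
    then show ?case using recursive1_intros(1) by blast
  next
    case (insert a A)
    then obtain g where g: "recursive1 g" "\<forall>x\<in>A. snd F (f x) = g (snd E x)" by blast
    have "snd E x \<noteq> snd E a" if "x \<in> A" for x
      using insert that assms(2) by (auto simp: inj_on_def subset_iff)
    then show ?case using g
      by (intro exI[of _ "\<lambda>n. if n = snd E a then snd F (f a) else g n"]) (auto intro: recursive1_intros)
  qed
  then obtain g where "recursive1 g" "\<forall>x\<in>fst E. snd F (f x) = g (snd E x)" using assms(1) by blast
  then show ?thesis using assms(3) by (auto intro: computableI)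
qed

section \<open>Arithmetic of integers and residues\<close>

lemma computable_int_nat:
  assumes "computable D intE a"
  shows "computable D natE (\<lambda>x. nat (a x))" "computable D natE (\<lambda>x. nat (- a x))"
proof -
  have "computable D (prodE natE natE) (\<lambda>x. (nat (a x), nat (- a x)))"
    using assms by (simp add: computable_def prodE_def natE_def intE_def)
  from computable_fst[OF this] computable_snd[OF this]
  show "computable D natE (\<lambda>x. nat (a x))" "computable D natE (\<lambda>x. nat (- a x))" by simp_all
qed

lemma computable_int_diff:
  assumes "computable D natE p" "computable D natE q"
  shows "computable D intE (\<lambda>x. int (p x) - int (q x))"
proof -
  have "computable D (prodE natE natE) (\<lambda>x. (p x - q x, q x - p x))"
    by (rule computable_id computable_pair computable_nat2 assms)+
  then obtain g where "recursive1 g" "\<forall>x\<in>fst D.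
      (p x - q x, q x - p x) \<in> fst (prodE natE natE) \<and>
      snd (prodE natE natE) (p x - q x, q x - p x) = g (snd D x)"
    using computableD by blast
  moreover have "nat (int a - int b) = a - b \<and> nat (- (int a - int b)) = b - a" for a b by auto
  ultimately show ?thesis by (intro computableI[of g]) (auto simp: intE_def prodE_def natE_def)
qed

lemma computable_carrier: "computable D E f \<Longrightarrow> d \<in> fst D \<Longrightarrow> f d \<in> fst E"
  by (simp add: computable_def)

lemma computable_comp2:
  assumes "computable (prodE A B) C (\<lambda>x. F (fst x) (snd x))" "computable D A f" "computable D B g"
  shows "computable D C (\<lambda>d. F (f d) (g d))"
  using computable_comp[OF assms(1) computable_pair[OF assms(2,3)]] by simp

lemmas computable_proj = computable_id computable_fst computable_snd computable_pair

lemma computable_int_0: "computable D intE (\<lambda>_. 0)"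
  by (rule computable_const) (simp add: intE_def)

lemma computable_int_add:
  assumes "computable D intE a" "computable D intE b"
  shows "computable D intE (\<lambda>d. a d + b d)"
proof -
  have e: "int (nat (a d) + nat (b d)) - int (nat (- a d) + nat (- b d)) = a d + b d" for d by simp
  have "computable D intE (\<lambda>d. int (nat (a d) + nat (b d)) - int (nat (- a d) + nat (- b d)))"
    by (rule computable_int_diff computable_nat2(1) computable_int_nat assms)+
  then show ?thesis by (simp only: e)
qed

lemma computable_int_minus:
  assumes "computable D intE a"
  shows "computable D intE (\<lambda>d. - a d)"
proof -
  have "- a d = int (nat (- a d)) - int (nat (a d))" for d by simp
  then show ?thesis
    using computable_int_diff[OF computable_int_nat(2)[OF assms] computable_int_nat(1)[OF assms]] by simp
qed

lemma computable_nat_mod: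
  assumes "computable D natE n" "computable D natE m"
  shows "computable D natE (\<lambda>d. n d mod m d)"
proof -
  \<comment> \<open>A counter that is reset on reaching \<open>m\<close>. For \<open>m = 0\<close>
    it is never reset, which agrees with \<open>n mod 0 = n\<close>.\<close>
  have "((\<lambda>r. if Suc r = m then 0 else Suc r) ^^ n) 0 = n mod m" for n m :: nat
    by (induction n) (auto simp: mod_Suc)
  moreover have "computable (prodE D natE) natE (\<lambda>x. if Suc (snd x) = m (fst x) then 0 else Suc (snd x))"
    by (rule computable_if computable_0 computable_nat computable_nat2 computable_id computable_snd
        computable_comp[OF assms(2)] computable_fst)+
  then have "computable D natE (\<lambda>d. ((\<lambda>r. if Suc r = m d then 0 else Suc r) ^^ n d) 0)"
    by (rule computable_funpow[OF assms(1) _ computable_0])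
  ultimately show ?thesis by simp
qed

lemma computable_int_mod:
  assumes "computable D intE a" "computable D natE m"
  shows "computable D intE (\<lambda>d. a d mod int (m d))"
proof -
  \<comment> \<open>For negative \<open>a d = - k\<close> the residue is \<open>m - k mod m\<close>,
    reduced once more for the case that \<open>m\<close> divides \<open>k\<close>. Modulus 0 returns
    the number itself.\<close>
  let ?f = "\<lambda>d. if nat (- a d) = 0 then int (nat (a d) mod m d) - int 0 else
      if m d = 0 then a d else int ((m d - nat (- a d) mod m d) mod m d) - int 0"
  have "?f d = a d mod int (m d)" for d
  proof (cases "a d \<ge> 0 \<or> m d = 0")
    case True
    then show ?thesis by (auto simp: zmod_int)
  next
    case False
    let ?k = "nat (- a d)"
    have "a d mod int (m d) = (- int ?k) mod int (m d)" using False by simp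
    also have "\<dots> = (int (m d) - int ?k) mod int (m d)"
      using mod_add_self2[of "- int ?k" "int (m d)"] by (simp only: uminus_add_conv_diff)
    also have "\<dots> = (int (m d) - int ?k mod int (m d)) mod int (m d)"
      by (simp only: mod_diff_right_eq)
    also have "\<dots> = int ((m d - ?k mod m d) mod m d)"
      using False by (simp add: zmod_int of_nat_diff)
    finally show ?thesis using False by simp
  qed
  moreover have "computable D intE ?f"
    by (rule computable_if computable_int_diff computable_0 computable_nat_mod computable_nat computable_nat2(2)
        computable_int_nat assms)+
  ultimately show ?thesis by simp
qed

lemma computable_times:
  assumes "computable D natE n" "computable D natE m"
  shows "computable D natE (\<lambda>d. n d * m d)"
proof -
  have "((\<lambda>r. m + r) ^^ n) 0 = n * m" for n m :: nat by (induction n) auto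
  moreover have "computable (prodE D natE) natE (\<lambda>x. m (fst x) + snd x)"
    by (rule computable_nat2 computable_id computable_snd computable_comp[OF assms(2)] computable_fst)+
  then have "computable D natE (\<lambda>d. ((\<lambda>r. m d + r) ^^ n d) 0)"
    by (rule computable_funpow[OF assms(1) _ computable_0])
  ultimately show ?thesis by simp
qed

section \<open>Trickle groups\<close>

lemma (in group) conj_int_pow:
  assumes c: "h \<in> carrier G" "y \<in> carrier G" "z \<in> carrier G" and hy: "h \<otimes> y = z \<otimes> h"
  shows "h \<otimes> y [^] (b :: int) = z [^] b \<otimes> h"
proof (induction b rule: int_induct[where k = 0])
  case base
  then show ?case using c by simp
next
  case (step1 i)
  have "h \<otimes> y [^] (i + 1) = (h \<otimes> y [^] i) \<otimes> y" using c by (simp add: int_pow_mult m_assoc)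
  also have "\<dots> = z [^] i \<otimes> (h \<otimes> y)" using c step1 by (simp add: m_assoc)
  also have "\<dots> = z [^] (i + 1) \<otimes> h" using c hy by (simp add: int_pow_mult m_assoc)
  finally show ?case .
next
  case (step2 i)
  \<comment> \<open>The downward step multiplies by \<open>y\<close> on the right to reach the
    exponent \<open>i\<close>, and cancels \<open>y\<close> at the end.\<close>
  have "(h \<otimes> y [^] (i - 1)) \<otimes> y = h \<otimes> (y [^] (i - 1) \<otimes> y [^] (1::int))"
    using c by (simp add: m_assoc)
  also have "\<dots> = h \<otimes> y [^] i" using c by (simp only: int_pow_mult[symmetric]) simp
  also have "\<dots> = (z [^] (i - 1) \<otimes> z [^] (1::int)) \<otimes> h"
    using c step2 by (simp only: int_pow_mult[symmetric]) simp
  also have "\<dots> = (z [^] (i - 1) \<otimes> h) \<otimes> y" using c hy by (simp add: m_assoc)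
  finally show ?case using c by simp
qed

section \<open>Powers of the star automorphisms and the cube condition\<close>

locale trickle_group =
  fixes G :: "('a, 'm) trickle_scheme"
  assumes trickle_graph: "trickle_graph G"
begin

abbreviation V :: "'a set" where "V \<equiv> verts G"

abbreviation prec (infix "\<prec>" 50) where "x \<prec> y \<equiv> vless G x y"

definition edge :: "'a \<Rightarrow> 'a \<Rightarrow> bool" where "edge x y \<longleftrightarrow> {x, y} \<in> edges G"

text \<open>Since \<open>perm_pow\<close> is undefined outside the star, it is extended by the
  identity; the power laws and injectivity then hold for all arguments.\<close>

definition ph :: "'a \<Rightarrow> int \<Rightarrow> 'a \<Rightarrow> 'a" where
  "ph x a y = (if y \<in> star G x then perm_pow G x a y else y)"

text \<open>Since \<open>k mod 0 = k\<close>, reduction modulo \<open>modulus x\<close> also covers the infinite label.\<close>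

definition modulus :: "'a \<Rightarrow> int" where
  "modulus x = (case label G x of enat n \<Rightarrow> int n | \<infinity> \<Rightarrow> 0)"

lemma edge_sym: "edge x y \<longleftrightarrow> edge y x"
  by (simp add: edge_def insert_commute)

lemma edgeD:
  assumes "edge x y" shows "x \<in> V" "y \<in> V" "x \<noteq> y"
proof -
  have "\<forall>e\<in>edges G. \<exists>x\<in>verts G. \<exists>y\<in>verts G. x \<noteq> y \<and> e = {x, y}"
    using trickle_graph by (simp add: trickle_graph_def)
  with assms obtain u v where "u \<in> V" "v \<in> V" "u \<noteq> v" "{x, y} = {u, v}"
    unfolding edge_def by blast
  then show "x \<in> V" "y \<in> V" "x \<noteq> y" by (auto simp: doubleton_eq_iff)
qed

lemma edge_irrefl: "\<not> edge x x"
  using edgeD by blast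

lemma star_iff: "y \<in> star G x \<longleftrightarrow> y = x \<or> edge x y"
  using edgeD unfolding star_def edge_def by auto

lemma po: "partial_order_on V (vle G)"
  using trickle_graph by (simp add: trickle_graph_def)

lemma less_V: "x \<prec> y \<Longrightarrow> x \<in> V \<and> y \<in> V"
  using po unfolding vless_def partial_order_on_def preorder_on_def by blast

lemma less_trans: "x \<prec> y \<Longrightarrow> y \<prec> z \<Longrightarrow> x \<prec> z"
  using po unfolding vless_def partial_order_on_def preorder_on_def
  by (metis antisymD transD)

lemma less_irrefl: "\<not> x \<prec> x"
  by (simp add: vless_def)

lemma less_asym: "x \<prec> y \<Longrightarrow> \<not> y \<prec> x"
  using less_trans less_irrefl by blast

lemma less_edge: "x \<prec> y \<Longrightarrow> edge x y"
proof -
  assume "x \<prec> y"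
  moreover have "\<forall>x\<in>verts G. \<forall>y\<in>verts G. vless G x y \<longrightarrow> {x, y} \<in> edges G"
    using trickle_graph unfolding trickle_graph_def by (elim conjE)
  ultimately show ?thesis using less_V unfolding edge_def by blast
qed

lemma vle_iff: "x \<in> V \<Longrightarrow> (x, y) \<in> vle G \<longleftrightarrow> x = y \<or> x \<prec> y"
  using po unfolding vless_def partial_order_on_def preorder_on_def refl_on_def by auto

lemma parallel_edges_iff:
  "{x, y} \<in> parallel_edges G \<longleftrightarrow> edge x y \<and> \<not> x \<prec> y \<and> \<not> y \<prec> x"
proof
  assume "{x, y} \<in> parallel_edges G"
  then obtain u v where uv: "{x, y} = {u, v}" "{u, v} \<in> edges G" "(u, v) \<notin> vle G" "(v, u) \<notin> vle G"
    unfolding parallel_edges_def by blast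
  show "edge x y \<and> \<not> x \<prec> y \<and> \<not> y \<prec> x"
    using uv unfolding edge_def vless_def
    by (auto simp: doubleton_eq_iff insert_commute)
next
  assume *: "edge x y \<and> \<not> x \<prec> y \<and> \<not> y \<prec> x"
  then have "(x, y) \<notin> vle G" "(y, x) \<notin> vle G" using edgeD[of x y] vle_iff by auto
  then show "{x, y} \<in> parallel_edges G"
    using * unfolding parallel_edges_def edge_def by blast
qed

lemma parallel_down:
  assumes "edge x y" "\<not> x \<prec> y" "\<not> y \<prec> x" "z \<prec> y"
  shows "edge x z" "\<not> x \<prec> z" "\<not> z \<prec> x"
proof -
  have "\<forall>x\<in>verts G. \<forall>y\<in>verts G. \<forall>z\<in>verts G.
        {x, y} \<in> parallel_edges G \<and> (z, y) \<in> vle G \<longrightarrow> {x, z} \<in> parallel_edges G"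
    using trickle_graph unfolding trickle_graph_def by (elim conjE)
  moreover have "{x, y} \<in> parallel_edges G" using assms parallel_edges_iff by blast
  moreover have "(z, y) \<in> vle G" using assms by (simp add: vless_def)
  ultimately have "{x, z} \<in> parallel_edges G" using edgeD[OF assms(1)] less_V[OF assms(4)] by blast
  then show "edge x z" "\<not> x \<prec> z" "\<not> z \<prec> x" using parallel_edges_iff by auto
qed

lemma perm_Bij: "x \<in> V \<Longrightarrow> perm G x \<in> carrier (BijGroup (star G x))"
  using trickle_graph by (simp add: trickle_graph_def star_automorphism_def BijGroup_def)

lemma perm_pow_Bij: "x \<in> V \<Longrightarrow> perm_pow G x a \<in> Bij (star G x)"
proof -
  assume "x \<in> V"
  then have "perm_pow G x a \<in> carrier (BijGroup (star G x))"
    unfolding perm_pow_def by (intro group.int_pow_closed group_BijGroup perm_Bij)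
  then show ?thesis by (simp add: BijGroup_def)
qed

lemma ph_star: "x \<in> V \<Longrightarrow> y \<in> star G x \<Longrightarrow> ph x a y \<in> star G x"
  using Bij_imp_funcset[OF perm_pow_Bij] unfolding ph_def by auto

lemma ph_star_iff: "x \<in> V \<Longrightarrow> ph x a y \<in> star G x \<longleftrightarrow> y \<in> star G x"
  using ph_star by (metis ph_def)

lemma ph_0: "x \<in> V \<Longrightarrow> ph x 0 y = y"
  by (simp add: ph_def perm_pow_def BijGroup_def)

lemma ph_1: "x \<in> V \<Longrightarrow> y \<in> star G x \<Longrightarrow> ph x 1 y = perm G x y"
  by (simp add: ph_def perm_pow_def group.int_pow_1[OF group_BijGroup] perm_Bij)

lemma ph_add:
  assumes x: "x \<in> V"
  shows "ph x (a + b) y = ph x a (ph x b y)"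
proof (cases "y \<in> star G x")
  case True
  have "perm_pow G x (a + b) = perm_pow G x a \<otimes>\<^bsub>BijGroup (star G x)\<^esub> perm_pow G x b"
    unfolding perm_pow_def by (rule group.int_pow_mult[OF group_BijGroup perm_Bij[OF x]])
  also have "\<dots> = compose (star G x) (perm_pow G x a) (perm_pow G x b)"
    using perm_pow_Bij[OF x] by (simp add: BijGroup_def)
  finally show ?thesis
    using True ph_star[OF x True, of b] by (simp add: ph_def compose_def)
qed (simp add: ph_def)

lemma ph_inverse: "x \<in> V \<Longrightarrow> ph x (- a) (ph x a y) = y" "x \<in> V \<Longrightarrow> ph x a (ph x (- a) y) = y"
  using ph_add[of x "- a" a y] ph_add[of x a "- a" y] by (simp_all add: ph_0)

lemma ph_inj: "x \<in> V \<Longrightarrow> ph x a y = ph x a z \<longleftrightarrow> y = z"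
  using ph_inverse by metis

lemma perm_edge: "x \<in> V \<Longrightarrow> y \<in> star G x \<Longrightarrow> z \<in> star G x \<Longrightarrow>
    edge (perm G x y) (perm G x z) \<longleftrightarrow> edge y z"
  using trickle_graph by (simp add: trickle_graph_def star_automorphism_def edge_def)

lemma perm_vle: "x \<in> V \<Longrightarrow> y \<in> star G x \<Longrightarrow> z \<in> star G x \<Longrightarrow>
    (perm G x z, perm G x y) \<in> vle G \<longleftrightarrow> (z, y) \<in> vle G"
  using trickle_graph unfolding trickle_graph_def by blast

lemma perm_fix: "x \<in> V \<Longrightarrow> y \<in> star G x \<Longrightarrow> perm G x y \<noteq> y \<Longrightarrow> y \<prec> x"
  using trickle_graph unfolding trickle_graph_def by blast

lemma perm_label: "x \<in> V \<Longrightarrow> y \<in> star G x \<Longrightarrow> label G (perm G x y) = label G y"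
  using trickle_graph unfolding trickle_graph_def by blast

lemma perm_perm: "z \<prec> y \<Longrightarrow> y \<prec> x \<Longrightarrow>
    perm G x (perm G y z) = perm G (perm G x y) (perm G x z)"
proof -
  assume zy: "z \<prec> y" "y \<prec> x"
  have "\<forall>x\<in>verts G. \<forall>y\<in>verts G. \<forall>z\<in>verts G. vless G z y \<and> vless G y x \<longrightarrow>
        perm G x (perm G y z) = perm G (perm G x y) (perm G x z)"
    using trickle_graph by (simp add: trickle_graph_def)
  then show ?thesis using zy less_V by blast
qed

lemma star_V: "x \<in> V \<Longrightarrow> y \<in> star G x \<Longrightarrow> y \<in> V"
  using edgeD star_iff by auto

lemma ph_V: "x \<in> V \<Longrightarrow> ph x a y \<in> V \<longleftrightarrow> y \<in> V"
  using ph_star_iff[of x a y] star_V by (metis ph_def)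

lemma self_star [simp]: "x \<in> star G x"
  by (simp add: star_iff)

lemma ph_edge:
  assumes "x \<in> V" "y \<in> star G x" "z \<in> star G x"
  shows "edge (ph x a y) (ph x a z) \<longleftrightarrow> edge y z"
proof (induction a rule: int_induct[where k = 0])
  case base
  then show ?case by (simp add: ph_0[OF assms(1)])
next
  case (step1 i)
  then show ?case using perm_edge[of x "ph x i y" "ph x i z"] assms ph_star ph_1
      ph_add[OF assms(1), of 1 i] by (simp add: add.commute)
next
  case (step2 i)
  then show ?case using perm_edge[of x "ph x (i - 1) y" "ph x (i - 1) z"] assms ph_star ph_1
      ph_add[OF assms(1), of 1 "i - 1"] by simp
qed

lemma ph_vle:
  assumes "x \<in> V" "y \<in> star G x" "z \<in> star G x"
  shows "(ph x a y, ph x a z) \<in> vle G \<longleftrightarrow> (y, z) \<in> vle G"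
proof (induction a rule: int_induct[where k = 0])
  case base
  then show ?case by (simp add: ph_0[OF assms(1)])
next
  case (step1 i)
  then show ?case using perm_vle[of x "ph x i z" "ph x i y"] assms ph_star ph_1
      ph_add[OF assms(1), of 1 i] by (simp add: add.commute)
next
  case (step2 i)
  then show ?case using perm_vle[of x "ph x (i - 1) z" "ph x (i - 1) y"] assms ph_star ph_1
      ph_add[OF assms(1), of 1 "i - 1"] by simp
qed

lemma ph_less:
  assumes "x \<in> V" "y \<in> star G x" "z \<in> star G x"
  shows "ph x a y \<prec> ph x a z \<longleftrightarrow> y \<prec> z"
  using ph_vle[OF assms] ph_inj[OF assms(1)] by (simp add: vless_def)

text \<open>Axiom (d) gives this for the automorphism itself, and a fixed point is fixed by all
  powers. Most later case distinctions rest on it: of two adjacent vertices at most one is moved by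
  the other.\<close>

lemma ph_fix:
  assumes x: "x \<in> V" and y: "\<not> y \<prec> x"
  shows "ph x a y = y"
proof (cases "y \<in> star G x")
  case True
  have *: "ph x 1 y = y" using perm_fix[OF x True] y ph_1[OF x True] by auto
  show ?thesis
  proof (induction a rule: int_induct[where k = 0])
    case base
    then show ?case by (simp add: ph_0 x)
  next
    case (step1 i)
    then show ?case using ph_add[OF x, of i 1 y] * by simp
  next
    case (step2 i)
    then show ?case using ph_add[OF x, of "i - 1" 1 y] * by simp
  qed
qed (simp add: ph_def)

lemma ph_self [simp]: "x \<in> V \<Longrightarrow> ph x a x = x"
  by (rule ph_fix) (auto simp: less_irrefl)

lemma less_star: "y \<prec> x \<Longrightarrow> y \<in> star G x"
  using less_edge edge_sym star_iff by blast

lemma ph_less_self: "x \<in> V \<Longrightarrow> ph x a y \<prec> x \<longleftrightarrow> y \<prec> x"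
proof (cases "y \<in> star G x")
  case True
  assume "x \<in> V"
  then show ?thesis using ph_less[of x y x a] True by simp
qed (simp add: ph_def)

lemma self_less_ph: "x \<in> V \<Longrightarrow> x \<prec> ph x a y \<longleftrightarrow> x \<prec> y"
  using ph_fix less_asym ph_less_self by metis

lemma ph_edge_self: "x \<in> V \<Longrightarrow> edge x (ph x a y) \<longleftrightarrow> edge x y"
proof (cases "y \<in> star G x")
  case True
  assume "x \<in> V"
  then show ?thesis using ph_edge[of x x y a] True by simp
qed (simp add: ph_def)

lemma ph_label:
  assumes x: "x \<in> V"
  shows "label G (ph x a y) = label G y"
proof (cases "y \<in> star G x")
  case True
  show ?thesis
  proof (induction a rule: int_induct[where k = 0])
    case base
    then show ?case by (simp add: ph_0 x)
  next
    case (step1 i)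
    then show ?case using perm_label[OF x, of "ph x i y"] ph_star[OF x True] ph_1[OF x]
      ph_add[OF x, of 1 i] by (simp add: add.commute)
  next
    case (step2 i)
    then show ?case using perm_label[OF x, of "ph x (i - 1) y"] ph_star[OF x True] ph_1[OF x]
      ph_add[OF x, of 1 "i - 1"] by simp
  qed
qed (simp add: ph_def)

text \<open>Here the condition on the order of \<open>perm G x\<close> enters: conjugation by a
  syllable depends only on the residue class of its exponent.\<close>

lemma ph_mod:
  assumes x: "x \<in> V"
  shows "ph x (a mod modulus x) y = ph x a y"
proof (cases "label G x")
  case (enat n)
  let ?B = "BijGroup (star G x)"
  have "group.ord ?B (perm G x) dvd n"
    using trickle_graph x enat unfolding trickle_graph_def by blast
  then have *: "perm G x [^]\<^bsub>?B\<^esub> (int n * k) = \<one>\<^bsub>?B\<^esub>" for k :: int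
    using group.int_pow_eq_id[OF group_BijGroup perm_Bij[OF x]] by (simp add: dvd_mult2)
  have "ph x (int n * k) z = z" for k z
    using * by (auto simp: ph_def perm_pow_def BijGroup_def)
  then have "ph x (a mod int n) y = ph x (a mod int n + int n * (a div int n)) y"
    by (simp only: ph_add[OF x])
  also have "a mod int n + int n * (a div int n) = a" by simp
  finally show ?thesis by (simp add: modulus_def enat)
qed (simp add: modulus_def)

text \<open>For \<open>z < y\<close> this is an iterate of axiom (g); otherwise both sides equal \<open>\<phi>\<^sub>x\<^sup>a(z)\<close>.\<close>

lemma ph_ph_less:
  assumes yx: "y \<prec> x" and z: "z \<in> star G x"
  shows "ph x a (ph y b z) = ph (ph x a y) b (ph x a z)"
proof (cases "z \<prec> y")
  case False
  have x: "x \<in> V" and y: "y \<in> V" using less_V[OF yx] by auto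
  have "\<not> ph x a z \<prec> ph x a y" using False ph_less[OF x z less_star[OF yx]] by simp
  then show ?thesis using ph_fix[OF y False] ph_fix x y ph_V by auto
next
  case True
  have xV: "x \<in> V" using less_V[OF yx] by auto
  have base: "ph x 1 (ph y 1 z) = ph (ph x 1 y) 1 (ph x 1 z)" if "z \<prec> y" "y \<prec> x" for y z
  proof -
    have y: "y \<in> V" and z: "z \<prec> x" using that less_V less_trans by blast+
    have "ph y 1 z = perm G y z" "ph x 1 y = perm G x y" "ph x 1 z = perm G x z"
      using ph_1 xV y that less_star z by auto
    moreover have "ph x 1 z \<prec> ph x 1 y"
      using that z ph_less[OF xV less_star less_star] by blast
    then have "ph (ph x 1 y) 1 (ph x 1 z) = perm G (ph x 1 y) (ph x 1 z)"
      using ph_1 less_star less_V by blast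
    moreover have "ph y 1 z \<prec> x" using that less_trans ph_less_self[OF y] by blast
    then have "ph x 1 (ph y 1 z) = perm G x (ph y 1 z)" using ph_1 xV less_star by blast
    ultimately show ?thesis using perm_perm[OF that] by simp
  qed
  have b: "ph x 1 (ph y b z) = ph (ph x 1 y) b (ph x 1 z)" if "z \<prec> y" "y \<prec> x" for y z and b :: int
  proof -
    have y: "y \<in> V" and y': "ph x 1 y \<in> V" using that less_V ph_V xV by blast+
    show ?thesis
    proof (induction b rule: int_induct[where k = 0])
      case base
      then show ?case by (simp add: ph_0 y y')
    next
      case (step1 i)
      then show ?case using base[of "ph y i z" y] that ph_less_self[OF y]
          ph_add[OF y, of 1 i z] ph_add[OF y', of 1 i "ph x 1 z"] by (simp add: add.commute)
    next
      case (step2 i)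
      then have "ph (ph x 1 y) 1 (ph x 1 (ph y (i - 1) z)) = ph (ph x 1 y) i (ph x 1 z)"
        using base[of "ph y (i - 1) z" y] that ph_less_self[OF y] ph_add[OF y, of 1 "i - 1" z] by simp
      also have "\<dots> = ph (ph x 1 y) 1 (ph (ph x 1 y) (i - 1) (ph x 1 z))"
        using ph_add[OF y', of 1 "i - 1" "ph x 1 z"] by simp
      finally show ?case using ph_inj[OF y'] by simp
    qed
  qed
  show ?thesis
  proof (induction a rule: int_induct[where k = 0])
    case base
    then show ?case by (simp add: ph_0 xV)
  next
    case (step1 i)
    have "ph x i z \<prec> ph x i y" "ph x i y \<prec> x"
      using True yx ph_less[OF xV z less_star[OF yx]] ph_less_self[OF xV] by auto
    from b[OF this] step1 show ?case using ph_add[OF xV, of 1 i] by (simp add: add.commute)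
  next
    case (step2 i)
    have "ph x (i - 1) z \<prec> ph x (i - 1) y" "ph x (i - 1) y \<prec> x"
      using True yx ph_less[OF xV z less_star[OF yx]] ph_less_self[OF xV] by auto
    from b[OF this, of b] step2
    have "ph x 1 (ph (ph x (i - 1) y) b (ph x (i - 1) z)) = ph x 1 (ph x (i - 1) (ph y b z))"
      using ph_add[OF xV, of 1 "i - 1"] by simp
    then show ?case using ph_inj[OF xV] by simp
  qed
qed

text \<open>If \<open>x\<close> and \<open>y\<close> are comparable, symmetry allows
  \<open>y \<prec> x\<close>; then \<open>ph y b\<close> fixes \<open>x\<close> and the claim is the
  iterated axiom (g). If they are parallel, both are fixed, and by axiom (b) a vertex below one of
  them is not below the other, so the two maps commute on \<open>z\<close>.\<close>

lemma cube_condition: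
  assumes xy: "edge x y" and xz: "edge x z" and yz: "edge y z"
  shows "ph (ph x a y) b (ph x a z) = ph (ph y b x) a (ph y b z)"
proof -
  have *: "ph (ph x a y) b (ph x a z) = ph (ph y b x) a (ph y b z)"
    if "edge x y" "edge x z" "edge y z" "y \<prec> x" for x y and a b :: int
  proof -
    have "ph y b x = x" using that less_asym ph_fix edgeD by blast
    then show ?thesis using ph_ph_less[of y x z a b] that star_iff by simp
  qed
  have x: "x \<in> V" and y: "y \<in> V" using edgeD[OF xy] by auto
  consider "y \<prec> x" | "x \<prec> y" | "\<not> x \<prec> y" "\<not> y \<prec> x" by blast
  then show ?thesis
  proof cases
    case 1
    then show ?thesis using * assms by blast
  next
    case 2
    then show ?thesis using *[of y x b a] assms edge_sym by metis
  next
    case 3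
    have **: "ph y b (ph x a z) = ph x a (ph y b z)"
      if "edge x y" "\<not> x \<prec> y" "\<not> y \<prec> x" "z \<prec> x" for x y and a b :: int
    proof -
      have V: "x \<in> V" "y \<in> V" using edgeD[OF that(1)] by auto
      have "edge y x" using that edge_sym by blast
      then have "\<not> z \<prec> y" "\<not> ph x a z \<prec> y"
        using parallel_down(3)[of y x] that V ph_less_self by blast+
      then show ?thesis using ph_fix V by simp
    qed
    have "ph y b (ph x a z) = ph x a (ph y b z)"
    proof (cases "z \<prec> x \<or> z \<prec> y")
      case True
      then show ?thesis using **[of x y b a] **[of y x a b] xy 3 edge_sym by metis
    next
      case False
      then show ?thesis using ph_fix x y by simp
    qed
    then show ?thesis using 3 ph_fix x y by simp
  qed
qed

text \<open>At most one of \<open>x\<close> and \<open>y\<close> is moved by the other, so in each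
  case one of the maps is the identity. The equations relate the vertices of a pair of letters
  before and after it has been exchanged.\<close>

lemma ph_back:
  assumes "edge x y"
  shows "ph (ph x a y) b x = ph y b x" "ph (ph y b x) a' (ph x a y) = ph x (a + a') y"
proof -
  have V: "x \<in> V" "y \<in> V" using edgeD[OF assms] by auto
  show "ph (ph x a y) b x = ph y b x"
  proof (cases "y \<prec> x")
    case True
    then show ?thesis using V ph_fix less_asym ph_less_self ph_V by metis
  qed (simp add: ph_fix V)
  show "ph (ph y b x) a' (ph x a y) = ph x (a + a') y"
  proof (cases "y \<prec> x")
    case True
    then have "ph y b x = x" using V ph_fix less_asym by blast
    then show ?thesis using ph_add[OF V(1), of a' a] by (simp add: add.commute)
  next
    case False
    then have *: "ph x c y = y" for c using V ph_fix by blast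
    have "\<not> y \<prec> ph y b x"
      using False V self_less_ph by blast
    then show ?thesis using * V ph_fix ph_V by simp
  qed
qed

lemma modulus_ph: "x \<in> V \<Longrightarrow> modulus (ph x a y) = modulus y"
  by (simp add: modulus_def ph_label)

text \<open>Canonical exponents become the fixed points of reduction, a form that also covers the
  infinite label, where \<open>mod 0\<close> is the identity.\<close>

lemma carrier_Zlab: "0 < m \<Longrightarrow> a \<in> carrier (Zlab m) \<longleftrightarrow>
    a mod (case m of enat n \<Rightarrow> int n | \<infinity> \<Rightarrow> 0) = a"
proof (cases m)
  case (enat n)
  moreover assume "0 < m"
  ultimately have "0 < int n" by (simp add: zero_enat_def)
  then have "0 \<le> a \<and> a < int n \<longleftrightarrow> a mod int n = a"
    by (metis mod_pos_pos_trivial pos_mod_bound pos_mod_sign)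
  then show ?thesis using \<open>0 < int n\<close> enat by (simp add: Zlab_def carrier_integer_mod_group)
qed (simp add: Zlab_def carrier_integer_mod_group)

lemma label_ge: "x \<in> V \<Longrightarrow> 2 \<le> label G x"
  using trickle_graph by (simp add: trickle_graph_def)

lemma syllables_iff: "(x, a) \<in> syllables G \<longleftrightarrow> x \<in> V \<and> a \<noteq> 0 \<and> a mod modulus x = a"
proof (cases "x \<in> V")
  case True
  have "(0::enat) < 2" by simp
  then have "0 < label G x" using label_ge[OF True] by (rule less_le_trans)
  then show ?thesis using True by (auto simp: syllables_def carrier_Zlab modulus_def)
qed (simp add: syllables_def)

subsection \<open>Letters and shuffles\<close>

abbreviation adj :: "'a syllable \<Rightarrow> 'a syllable \<Rightarrow> bool" where
  "adj s t \<equiv> edge (fst s) (fst t)"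

text \<open>\<open>res s t\<close> is what remains of \<open>t\<close> after \<open>s\<close>: for adjacent \<open>s\<close>, \<open>t\<close> the words \<open>[s, res s t]\<close>
  and \<open>[t, res t s]\<close> represent the same element.  The exponents are arbitrary integers here.\<close>

definition res :: "'a syllable \<Rightarrow> 'a syllable \<Rightarrow> 'a syllable" where
  "res s t = (ph (fst s) (- snd s) (fst t), snd t)"

definition unres :: "'a syllable \<Rightarrow> 'a syllable \<Rightarrow> 'a syllable" where
  "unres s t = (ph (fst s) (snd s) (fst t), snd t)"

inductive shuffle1 :: "'a syllable list \<Rightarrow> 'a syllable list \<Rightarrow> bool" where
  "adj s t \<Longrightarrow> shuffle1 (u @ s # res s t # v) (u @ t # res t s # v)"

definition shuffle :: "'a syllable list \<Rightarrow> 'a syllable list \<Rightarrow> bool" (infix "\<approx>" 50) where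
  "u \<approx> v \<longleftrightarrow> shuffle1\<^sup>*\<^sup>* u v"

lemma adj_sym: "adj s t \<Longrightarrow> adj t s"
  by (simp add: edge_sym)

lemma shuffle_refl [simp, intro]: "u \<approx> u"
  by (simp add: shuffle_def)

lemma shuffle_trans [trans]: "u \<approx> v \<Longrightarrow> v \<approx> w \<Longrightarrow> u \<approx> w"
  by (simp add: shuffle_def)

lemma shuffle1_sym: "shuffle1 u v \<Longrightarrow> shuffle1 v u"
  by (metis adj_sym shuffle1.simps)

lemma shuffle_sym: "u \<approx> v \<Longrightarrow> v \<approx> u"
  unfolding shuffle_def
  by (metis shuffle1_sym symp_rtranclp sympD sympI)

lemma shuffle1_append: "shuffle1 u v \<Longrightarrow> shuffle1 (x @ u @ y) (x @ v @ y)"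
proof (induction rule: shuffle1.induct)
  case (1 s t u v)
  from shuffle1.intros[OF this, of "x @ u" "v @ y"] show ?case by simp
qed

lemma shuffle_append_both: "u \<approx> v \<Longrightarrow> x @ u @ y \<approx> x @ v @ y"
  unfolding shuffle_def
proof (induction rule: rtranclp_induct)
  case (step y z)
  then show ?case using shuffle1_append rtranclp.rtrancl_into_rtrancl by metis
qed simp

lemma shuffle_append: "u \<approx> v \<Longrightarrow> u' \<approx> v' \<Longrightarrow> u @ u' \<approx> v @ v'"
  using shuffle_append_both[of u v "[]" u'] shuffle_append_both[of u' v' v "[]"] shuffle_trans
  by auto

lemma shuffle_Cons: "u \<approx> v \<Longrightarrow> s # u \<approx> s # v"
  using shuffle_append_both[of u v "[s]" "[]"] by simp

lemma shuffle_swap: "adj s t \<Longrightarrow> s # res s t # v \<approx> t # res t s # v"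
  using shuffle1.intros[of s t "[]" v] by (simp add: shuffle_def r_into_rtranclp)

lemma shuffle_length: "u \<approx> v \<Longrightarrow> length u = length v"
  unfolding shuffle_def
  by (induction rule: rtranclp_induct) (auto simp: shuffle1.simps)

lemma shuffle_Nil [simp]: "u \<approx> [] \<longleftrightarrow> u = []" "[] \<approx> u \<longleftrightarrow> u = []"
  using shuffle_length by fastforce+

lemma adj_V: "adj s t \<Longrightarrow> fst s \<in> V" "adj s t \<Longrightarrow> fst t \<in> V"
  using edgeD by auto

lemma adj_neq: "adj s t \<Longrightarrow> s \<noteq> t"
  using edge_irrefl by auto

lemma res_unres: "fst s \<in> V \<Longrightarrow> res s (unres s t) = t" "fst s \<in> V \<Longrightarrow> unres s (res s t) = t"
  by (simp_all add: res_def unres_def ph_inverse)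

lemma adj_res: "fst s \<in> V \<Longrightarrow> adj s (res s t) \<longleftrightarrow> adj s t"
  by (simp add: res_def ph_edge_self)

lemma adj_unres: "fst s \<in> V \<Longrightarrow> adj s (unres s t) \<longleftrightarrow> adj s t"
  by (simp add: unres_def ph_edge_self)

lemma adj_res_res: "adj s t \<Longrightarrow> adj s r \<Longrightarrow> adj (res s t) (res s r) \<longleftrightarrow> adj t r"
  by (simp add: res_def ph_edge star_iff adj_V)

lemma res_inj: "fst s \<in> V \<Longrightarrow> res s t = res s r \<longleftrightarrow> t = r"
  using res_unres by metis

text \<open>What remains of \<open>r\<close> after the common multiple of \<open>s\<close> and
  \<open>t\<close> does not depend on which of the two is taken first.\<close>

lemma res_cube:
  assumes "adj s t" "adj s r" "adj t r"
  shows "res (res s t) (res s r) = res (res t s) (res t r)"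
  using cube_condition[OF assms, of "- snd s" "- snd t"] by (simp add: res_def)

text \<open>This is Garside's lemma on common multiples: the induction on the length combines with the cube
  condition in the same way as for braid monoids.\<close>

lemma shuffle_Cons_Cons:
  assumes "s # w \<approx> t # w'"
  shows "(s = t \<and> w \<approx> w') \<or> (adj s t \<and> (\<exists>v. w \<approx> res s t # v \<and> w' \<approx> res t s # v))"
  using assms
proof (induction "length w" arbitrary: s t w w' rule: less_induct)
  case less
  \<comment> \<open>The outer induction is on the length of the tail, the inner one on the chain of
    exchanges. Only an exchange at the very front needs the outer hypothesis, applied to the words
    behind \<open>p\<close>.\<close>
  have "shuffle1\<^sup>*\<^sup>* (s # w) (t # w')" using less.prems by (simp add: shuffle_def)
  then show ?case
  proof (induction "t # w'" arbitrary: t w' rule: rtranclp_induct)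
    case base
    then show ?case by simp
  next
    case (step y)
    have sy: "s # w \<approx> y" using step.hyps(1) by (simp add: shuffle_def)
    then have len: "length y = Suc (length w)" using shuffle_length by fastforce
    from step.hyps(2) obtain p q u z where pq: "adj p q" "y = u @ p # res p q # z"
      "t # w' = u @ q # res q p # z" by (auto simp: shuffle1.simps)
    show ?case
    proof (cases u)
      case (Cons r u')
      then have y: "y = t # u' @ p # res p q # z" and w': "w' = u' @ q # res q p # z"
        using pq by auto
      have "u' @ p # res p q # z \<approx> w'"
        using shuffle1.intros[OF pq(1)] w' by (simp add: shuffle_def r_into_rtranclp)
      then show ?thesis using step.hyps(3)[OF y] shuffle_trans shuffle_sym by meson
    next
      case Nil
      then have y: "y = p # res p t # z" and q: "q = t" and w': "w' = res t p # z"
        using pq by auto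
      have pt: "adj p t" using pq q by simp
      have z: "length z < length w" using len y by simp
      from step.hyps(3)[OF y] show ?thesis
      proof (elim disjE conjE exE)
        assume "s = p" "w \<approx> res p t # z"
        then show ?thesis using w' pt by blast
      next
        fix v assume sp: "adj s p" and w: "w \<approx> res s p # v" and v: "res p t # z \<approx> res p s # v"
        have ps: "adj p s" using sp adj_sym by blast
        from less.hyps[OF z v] show ?thesis
        proof (elim disjE conjE exE)
          assume "res p t = res p s" and zv: "z \<approx> v"
          then have "t = s" using res_inj adj_V(1)[OF pt] by blast
          moreover have "w \<approx> w'"
            using w w' zv \<open>t = s\<close> shuffle_Cons shuffle_trans shuffle_sym by metis
          ultimately show ?thesis by simp
        next
          fix e assume a: "adj (res p t) (res p s)" and ze: "z \<approx> res (res p t) (res p s) # e"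
            and ve: "v \<approx> res (res p s) (res p t) # e"
          \<comment> \<open>The letters \<open>s\<close>, \<open>p\<close> and \<open>t\<close> are
            now pairwise adjacent, and \<open>e\<close> is what follows their common multiple. The
            three cube identities rewrite \<open>w\<close> and \<open>w'\<close> so that both end in
            the same word.\<close>
          have ts: "adj t s" using a adj_res_res pt ps by blast
          have st: "adj s t" using ts adj_sym by blast
          have tp: "adj t p" using pt adj_sym by blast
          have 1: "res (res p s) (res p t) = res (res s p) (res s t)"
            by (rule res_cube[OF ps pt st])
          have 2: "res (res p t) (res p s) = res (res t p) (res t s)"
            by (rule res_cube[OF pt ps ts])
          have 3: "res (res s t) (res s p) = res (res t s) (res t p)"
            by (rule res_cube[OF st sp tp])
          have "w \<approx> res s p # res (res s p) (res s t) # e"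
            using w ve 1 shuffle_Cons shuffle_trans by metis
          also have "\<dots> \<approx> res s t # res (res s t) (res s p) # e"
            using shuffle_swap adj_res_res[OF sp st] pt by blast
          finally have wf: "w \<approx> res s t # res (res s t) (res s p) # e" .
          have "w' \<approx> res t p # res (res t p) (res t s) # e"
            using w' ze 2 shuffle_Cons by metis
          also have "\<dots> \<approx> res t s # res (res t s) (res t p) # e"
            using shuffle_swap adj_res_res[OF tp ts] ps by blast
          finally have "w' \<approx> res t s # res (res s t) (res s p) # e" using 3 by simp
          then show ?thesis using wf st by blast
        qed
      qed
    qed
  qed
qed

lemma shuffle_Cons_cancel: "s # w \<approx> s # w' \<longleftrightarrow> w \<approx> w'"
  using shuffle_Cons_Cons[of s w s w'] edge_irrefl shuffle_Cons by blast

lemma shuffle_append_cancel: "u @ w \<approx> u @ w' \<longleftrightarrow> w \<approx> w'"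
  by (induction u) (auto simp: shuffle_Cons_cancel)

text \<open>Letters with equal vertices are not adjacent, which excludes the second case of
  \<open>shuffle_Cons_Cons\<close>. Hence the vertex of a possible head determines its exponent and,
  up to shuffles, the tail.\<close>

lemma shuffle_Cons_same_vertex: "(x, a) # w \<approx> (x, b) # w' \<longleftrightarrow> a = b \<and> w \<approx> w'"
  using shuffle_Cons_Cons[of "(x, a)" w "(x, b)" w'] edge_irrefl shuffle_Cons by auto

definition nohead :: "'a \<Rightarrow> 'a syllable list \<Rightarrow> bool" where
  "nohead x w \<longleftrightarrow> (\<forall>b w'. \<not> w \<approx> (x, b) # w')"

lemma nohead_cong: "w \<approx> w' \<Longrightarrow> nohead x w \<longleftrightarrow> nohead x w'"
  unfolding nohead_def using shuffle_trans shuffle_sym by meson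

lemma nohead_Nil [simp]: "nohead x []"
  by (simp add: nohead_def)

text \<open>A letter with vertex \<open>x\<close> that can be brought in front of
  \<open>(y, b)\<close> stands behind it with vertex \<open>ph y (- b) x\<close>.\<close>

lemma nohead_Cons:
  assumes xy: "edge x y"
  shows "nohead x ((y, b) # w) \<longleftrightarrow> nohead (ph y (- b) x) w"
proof
  assume n: "nohead (ph y (- b) x) w"
  show "nohead x ((y, b) # w)"
    unfolding nohead_def
  proof (intro allI notI)
    fix k e assume "(y, b) # w \<approx> (x, k) # e"
    from shuffle_Cons_Cons[OF this] obtain v where "w \<approx> res (y, b) (x, k) # v"
      using edgeD[OF xy] by auto
    then show False using n by (simp add: nohead_def res_def)
  qed
next
  assume n: "nohead x ((y, b) # w)"
  show "nohead (ph y (- b) x) w"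
    unfolding nohead_def
  proof (intro allI notI)
    fix k e assume "w \<approx> (ph y (- b) x, k) # e"
    then have "(y, b) # w \<approx> (y, b) # res (y, b) (x, k) # e"
      using shuffle_Cons by (simp add: res_def)
    also have "\<dots> \<approx> (x, k) # res (x, k) (y, b) # e"
      using shuffle_swap xy edge_sym by simp
    finally show False using n by (simp add: nohead_def)
  qed
qed

subsection \<open>Reduced words\<close>

text \<open>Closure under shuffles is built in; in return, the conditions on an arbitrary possible
  first letter have to be recovered in \<open>reduced_head\<close>.\<close>

inductive reduced :: "'a syllable list \<Rightarrow> bool" where
  Nil: "reduced []"
| Cons: "reduced w \<Longrightarrow> (x, a) \<in> syllables G \<Longrightarrow> nohead x w \<Longrightarrow> reduced ((x, a) # w)"
| shuffle: "reduced w \<Longrightarrow> w \<approx> w' \<Longrightarrow> reduced w'"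

lemma syllable_ph: "x \<in> V \<Longrightarrow> (ph x a y, b) \<in> syllables G \<longleftrightarrow> (y, b) \<in> syllables G"
  by (simp add: syllables_iff modulus_ph ph_V)

text \<open>If the head \<open>(y, b)\<close> is exchanged for \<open>(x, a)\<close>, the two tails
  are x' e and y' e with the residual letters in front. The induction hypothesis for x' e makes
  \<open>e\<close> reduced, and \<open>nohead_Cons\<close> carries the absence of heads across the
  exchange in both directions.\<close>

lemma reduced_head:
  assumes "reduced w" and "w \<approx> (x, a) # c"
  shows "reduced c \<and> nohead x c \<and> (x, a) \<in> syllables G"
  using assms
proof (induction arbitrary: x a c rule: reduced.induct)
  case Nil
  then show ?case by simp
next
  case (Cons w y b)
  from shuffle_Cons_Cons[OF Cons.prems] show ?case
  proof (elim disjE conjE exE)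
    assume "(y, b) = (x, a)" "w \<approx> c"
    then show ?thesis using Cons.hyps reduced.shuffle nohead_cong by auto
  next
    fix e assume "adj (y, b) (x, a)" and w: "w \<approx> res (y, b) (x, a) # e"
      and c: "c \<approx> res (x, a) (y, b) # e"
    define x' y' where "x' = ph y (- b) x" and "y' = ph x (- a) y"
    have yx: "edge y x" and xy: "edge x y"
      using \<open>adj (y, b) (x, a)\<close> by (auto simp: edge_sym)
    then have V: "x \<in> V" "y \<in> V" using edgeD by auto
    have w: "w \<approx> (x', a) # e" and c: "c \<approx> (y', b) # e"
      using w c by (simp_all add: res_def x'_def y'_def)
    have IH: "reduced e" "nohead x' e" "(x', a) \<in> syllables G" using Cons.IH[OF w] by auto
    have xa: "(x, a) \<in> syllables G" using IH(3) syllable_ph V unfolding x'_def by simp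
    have "edge y x'" using ph_edge_self yx V unfolding x'_def by simp
    moreover have "ph x' (- a) y = y'"
      using ph_back(1)[OF yx, of "- b" "- a"] unfolding x'_def y'_def .
    ultimately have "nohead y' e"
      using nohead_Cons[of y x' a e] nohead_cong[OF w] Cons.hyps(3) by simp
    then have "reduced ((y', b) # e)"
      using reduced.Cons IH(1) Cons.hyps(2) syllable_ph V unfolding y'_def by simp
    then have rc: "reduced c" using c reduced.shuffle shuffle_sym by blast
    have "edge x y'" using ph_edge_self xy V unfolding y'_def by simp
    moreover have "ph y' (- b) x = x'"
      using ph_back(1)[OF xy, of "- a" "- b"] unfolding x'_def y'_def .
    ultimately have "nohead x c" using nohead_Cons[of x y' b e] nohead_cong[OF c] IH(2) by simp
    then show ?thesis using rc xa by simp
  qed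
next
  case (shuffle w w')
  then show ?case using shuffle_trans by blast
qed

subsection \<open>The action on reduced words\<close>

definition mk :: "'a \<Rightarrow> int \<Rightarrow> 'a syllable list \<Rightarrow> 'a syllable list" where
  "mk x a w = (let c = a mod modulus x in if c = 0 then w else (x, c) # w)"

text \<open>The choice is immaterial: by \<open>shuffle_Cons_same_vertex\<close> the exponent is
  unique and the tail is unique up to shuffles.\<close>

definition act :: "'a \<Rightarrow> int \<Rightarrow> 'a syllable list \<Rightarrow> 'a syllable list" where
  "act x a w = (if nohead x w then mk x a w
     else let (b, w') = SOME (b, w'). w \<approx> (x, b) # w' in mk x (a + b) w')"

lemma mk_cong: "w \<approx> w' \<Longrightarrow> mk x a w \<approx> mk x a w'"
  by (auto simp: mk_def Let_def shuffle_Cons)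

lemma mk_mod_cong: "a mod modulus x = b mod modulus x \<Longrightarrow> mk x a w = mk x b w"
  by (simp add: mk_def)

text \<open>The exponent \<open>b\<close> may be trivial, so words with and without a head at
  \<open>x\<close> are treated alike. Together with \<open>reduced_decomp\<close> this replaces the
  definition of \<open>act\<close> in all later computations.\<close>

lemma act_mk:
  assumes w: "w \<approx> mk x b w'" and n: "nohead x w'"
  shows "act x a w \<approx> mk x (a + b) w'"
proof (cases "b mod modulus x = 0")
  case True
  then have ww': "w \<approx> w'" using w by (simp add: mk_def)
  have "mk x (a + b) w' = mk x a w'"
    using True by (intro mk_mod_cong) (simp add: mod_0_imp_dvd mod_add_eq[symmetric, of a b])
  then show ?thesis using n ww' nohead_cong[OF ww'] mk_cong by (simp add: act_def)
next
  case False
  let ?c = "b mod modulus x" and ?P = "\<lambda>(b, w'). w \<approx> (x, b) # w'"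
  have w: "w \<approx> (x, ?c) # w'" using w False by (simp add: mk_def)
  then have "?P (?c, w')" by simp
  then have "?P (SOME p. ?P p)" by (rule someI)
  then obtain b2 w2 where p: "(SOME p. ?P p) = (b2, w2)" and "w \<approx> (x, b2) # w2"
    by (cases "SOME p. ?P p") auto
  then have "(x, b2) # w2 \<approx> (x, ?c) # w'" using w shuffle_sym shuffle_trans by blast
  then have b2: "b2 = ?c" "w2 \<approx> w'" by (auto simp: shuffle_Cons_same_vertex)
  have "act x a w = mk x (a + b2) w2" using p w by (auto simp: act_def nohead_def)
  also have "\<dots> = mk x (a + b) w2" using b2 by (intro mk_mod_cong) (simp add: mod_add_right_eq)
  also have "\<dots> \<approx> mk x (a + b) w'" using b2 mk_cong by blast
  finally show ?thesis .
qed

lemma reduced_mk: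
  assumes "reduced w" "nohead x w" "x \<in> V"
  shows "reduced (mk x a w)"
  using assms by (auto simp: mk_def Let_def syllables_iff intro!: reduced.Cons)

lemma reduced_decomp:
  assumes "reduced w" "x \<in> V"
  obtains b w' where "w \<approx> mk x b w'" "nohead x w'" "reduced w'"
proof (cases "nohead x w")
  case True
  show ?thesis by (rule that[of 0 w]) (use assms True in \<open>auto simp: mk_def\<close>)
next
  case False
  then obtain b w' where w: "w \<approx> (x, b) # w'" by (auto simp: nohead_def)
  from reduced_head[OF assms(1) w] show ?thesis
    using w that[of b w'] by (auto simp: mk_def syllables_iff)
qed

lemma act_reduced:
  assumes "reduced w" "x \<in> V"
  shows "reduced (act x a w)"
  using reduced_decomp[OF assms] act_mk reduced_mk assms reduced.shuffle shuffle_sym by metis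

lemma act_cong:
  assumes "reduced w" "x \<in> V" "w \<approx> v"
  shows "act x a w \<approx> act x a v"
proof -
  obtain c w' where w: "w \<approx> mk x c w'" "nohead x w'" using reduced_decomp[OF assms(1,2)] by metis
  have "v \<approx> mk x c w'" using w(1) assms(3) shuffle_sym shuffle_trans by blast
  then show ?thesis using act_mk[OF _ w(2)] w(1) shuffle_sym shuffle_trans by blast
qed

lemma act_add:
  assumes "reduced w" "x \<in> V"
  shows "act x a (act x b w) \<approx> act x (a + b) w"
proof -
  obtain c w' where w: "w \<approx> mk x c w'" "nohead x w'" using reduced_decomp[OF assms] by metis
  have "act x a (act x b w) \<approx> mk x (a + (b + c)) w'"
    by (rule act_mk[OF act_mk[OF w] w(2)])
  also have "\<dots> = mk x ((a + b) + c) w'" by (simp add: add.assoc)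
  also have "\<dots> \<approx> act x (a + b) w" by (rule shuffle_sym[OF act_mk[OF w]])
  finally show ?thesis .
qed

lemma act_id:
  assumes "reduced w" "x \<in> V" "a mod modulus x = 0"
  shows "act x a w \<approx> w"
proof -
  obtain c w' where w: "w \<approx> mk x c w'" "nohead x w'" using reduced_decomp[OF assms(1,2)] by metis
  have "act x a w \<approx> mk x (a + c) w'" by (rule act_mk[OF w])
  also have "\<dots> = mk x c w'" using assms(3) by (intro mk_mod_cong) (simp add: mod_add_left_eq[symmetric, of a c])
  also have "\<dots> \<approx> w" by (rule shuffle_sym[OF w(1)])
  finally show ?thesis .
qed

text \<open>For nontrivial exponents this is a single exchange, in which \<open>x\<close> is
  unchanged because it is not below \<open>z\<close>. If \<open>p\<close> reduces to 0, then
  \<open>ph x p\<close> is the identity by \<open>ph_mod\<close>.\<close>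

lemma mk_swap:
  assumes xz: "edge x z" and n: "\<not> x \<prec> z"
  shows "mk x p (mk z q w) \<approx> mk (ph x p z) q (mk x p w)"
proof -
  have V: "x \<in> V" "z \<in> V" using edgeD[OF xz] by auto
  have m: "modulus (ph x p z) = modulus z" using V modulus_ph by blast
  show ?thesis
  proof (cases "p mod modulus x = 0 \<or> q mod modulus z = 0")
    case True
    have "ph x p z = z" if "p mod modulus x = 0"
      using ph_mod[OF V(1), of p z] that ph_0[OF V(1)] by simp
    then show ?thesis using True m by (auto simp: mk_def Let_def)
  next
    case False
    let ?p = "p mod modulus x" and ?q = "q mod modulus z"
    define y where "y = ph x ?p z"
    have y: "ph x p z = y" using ph_mod V y_def by simp
    have xy: "edge x y" using xz V ph_edge_self y_def by simp
    have "\<not> x \<prec> y" using n V self_less_ph y_def by simp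
    then have "res (y, ?q) (x, ?p) = (x, ?p)"
      using ph_fix edgeD[OF xy] by (simp add: res_def)
    moreover have "res (x, ?p) (y, ?q) = (z, ?q)"
      using ph_inverse V by (simp add: res_def y_def)
    ultimately show ?thesis
      using shuffle_swap[of "(x, ?p)" "(y, ?q)" w] xy False m y by (simp add: mk_def)
  qed
qed

lemma nohead_mk:
  assumes xz: "edge x z" and n: "\<not> x \<prec> z"
  shows "nohead x (mk z q w) \<longleftrightarrow> nohead x w"
proof -
  have "ph z (- (q mod modulus z)) x = x" using ph_fix edgeD[OF xz] n by simp
  then show ?thesis using nohead_Cons[OF xz] by (simp add: mk_def Let_def)
qed

lemma nohead_mk':
  assumes xz: "edge x z"
  shows "nohead (ph x p z) (mk x p w) \<longleftrightarrow> nohead z w"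
proof -
  have x: "x \<in> V" using edgeD[OF xz] by simp
  have "edge (ph x p z) x" using xz x ph_edge_self edge_sym by simp
  from nohead_Cons[OF this, of "p mod modulus x" w]
  have "nohead (ph x p z) ((x, p mod modulus x) # w) \<longleftrightarrow> nohead z w"
    using ph_inverse(1)[OF x] ph_mod[OF x, of p z] by metis
  moreover have "ph x p z = z" if "p mod modulus x = 0"
    using ph_mod[OF x, of p z] that ph_0[OF x] by simp
  ultimately show ?thesis by (auto simp: mk_def Let_def)
qed

text \<open>The word is written as x^p z^q d, where \<open>d\<close> has no head at \<open>z\<close>
  and x^p can be exchanged with any power of \<open>z\<close>. Both sides then become x^(a+p)
  z^(b+q) d.\<close>

lemma act_swap:
  assumes r: "reduced w" and xy: "edge x y" and n: "\<not> x \<prec> y"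
  shows "act x a (act y b w) \<approx> act (ph x a y) b (act x a w)"
proof -
  have V: "x \<in> V" "y \<in> V" using edgeD[OF xy] by auto
  obtain p c where c: "w \<approx> mk x p c" "nohead x c" "reduced c"
    using reduced_decomp[OF r V(1)] by metis
  \<comment> \<open>The vertex that \<open>y\<close> acquires when it is moved behind x^p.\<close>
  define z where "z = ph x (- p) y"
  have zV: "z \<in> V" and xz: "edge x z" and nz: "\<not> x \<prec> z"
    using V ph_V ph_edge_self xy n self_less_ph by (auto simp: z_def)
  have y: "ph x p z = y" using ph_inverse V z_def by simp
  obtain q d where d: "c \<approx> mk z q d" "nohead z d" "reduced d"
    using reduced_decomp[OF c(3) zV] by metis
  have nx: "nohead x (mk z k d)" for k
    using nohead_mk[OF xz nz] nohead_cong[OF d(1)] c(2) by simp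
  have ny: "nohead (ph x k z) (mk x k d)" for k
    using nohead_mk'[OF xz] d(2) by blast
  have w: "w \<approx> mk x p (mk z q d)" using c(1) d(1) mk_cong shuffle_trans by blast
  also have "\<dots> \<approx> mk y q (mk x p d)" using mk_swap[OF xz nz] y by metis
  finally have "act y b w \<approx> mk y (b + q) (mk x p d)" using act_mk ny y by metis
  also have "\<dots> \<approx> mk x p (mk z (b + q) d)" using mk_swap[OF xz nz] y shuffle_sym by metis
  finally have 1: "act x a (act y b w) \<approx> mk x (a + p) (mk z (b + q) d)"
    using act_mk nx by blast
  define y2 where "y2 = ph x (a + p) z"
  have y2: "ph x a y = y2" using ph_add[OF V(1), of a p z] y y2_def by simp
  have "act x a w \<approx> mk x (a + p) (mk z q d)" using act_mk[OF w] nx by blast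
  also have "\<dots> \<approx> mk y2 q (mk x (a + p) d)" using mk_swap[OF xz nz] y2_def by metis
  finally have "act y2 b (act x a w) \<approx> mk y2 (b + q) (mk x (a + p) d)"
    using act_mk ny y2_def by metis
  also have "\<dots> \<approx> mk x (a + p) (mk z (b + q) d)"
    using mk_swap[OF xz nz] y2_def shuffle_sym by metis
  finally show ?thesis using 1 y2 shuffle_sym shuffle_trans by blast
qed

subsection \<open>Words and the trickle group\<close>

abbreviation peq :: "'a word \<Rightarrow> 'a word \<Rightarrow> bool" where
  "peq \<equiv> pres_eq V (trickle_relators G)"

fun letter_act :: "'a + 'a \<Rightarrow> 'a syllable list \<Rightarrow> 'a syllable list" where
  "letter_act (Inl x) w = act x 1 w"
| "letter_act (Inr x) w = act x (- 1) w"

abbreviation word_act :: "'a word \<Rightarrow> 'a syllable list \<Rightarrow> 'a syllable list" where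
  "word_act u w \<equiv> foldr letter_act u w"

definition syl_word :: "'a syllable list \<Rightarrow> 'a word" where
  "syl_word ss = concat (map power_word ss)"

lemma words_over_simps [simp]: "[] \<in> words_over X"
  "l # w \<in> words_over X \<longleftrightarrow> l \<in> Inl ` X \<union> Inr ` X \<and> w \<in> words_over X"
  "u @ v \<in> words_over X \<longleftrightarrow> u \<in> words_over X \<and> v \<in> words_over X"
  by (auto simp: words_over_def)

lemma letter_act_reduced: "l \<in> Inl ` V \<union> Inr ` V \<Longrightarrow> reduced w \<Longrightarrow> reduced (letter_act l w)"
  by (auto simp: act_reduced)

lemma letter_act_cong: "l \<in> Inl ` V \<union> Inr ` V \<Longrightarrow> reduced w \<Longrightarrow> w \<approx> w' \<Longrightarrow>
    letter_act l w \<approx> letter_act l w'"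
  by (auto simp: act_cong)

lemma word_act_reduced: "u \<in> words_over V \<Longrightarrow> reduced w \<Longrightarrow> reduced (word_act u w)"
  by (induction u) (auto simp: act_reduced)

lemma word_act_cong:
  "u \<in> words_over V \<Longrightarrow> reduced w \<Longrightarrow> w \<approx> w' \<Longrightarrow> word_act u w \<approx> word_act u w'"
proof (induction u)
  case (Cons l u)
  then show ?case using letter_act_cong[of l] word_act_reduced[of u w] by simp
qed simp

lemma word_act_replicate:
  assumes "reduced w" "x \<in> V"
  shows "word_act (replicate n (Inl x)) w \<approx> act x (int n) w"
    "word_act (replicate n (Inr x)) w \<approx> act x (- int n) w"
proof (induction n)
  case 0
  case 1 show ?case using act_id[OF assms, of 0] shuffle_sym by simp
  case 2 show ?case using act_id[OF assms, of 0] shuffle_sym by simp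
next
  case (Suc n)
  have r: "reduced (word_act (replicate n l) w)" if "l \<in> Inl ` V \<union> Inr ` V" for l
    using that by (induction n) (auto intro: assms letter_act_reduced simp del: letter_act.simps)
  case 1
  have "word_act (replicate (Suc n) (Inl x)) w \<approx> act x 1 (act x (int n) w)"
    using act_cong[OF r assms(2) Suc(1)] assms by simp
  also have "\<dots> \<approx> act x (int (Suc n)) w" using act_add[OF assms, of 1 "int n"] by (simp add: add.commute)
  finally show ?case .
  case 2
  have "word_act (replicate (Suc n) (Inr x)) w \<approx> act x (- 1) (act x (- int n) w)"
    using act_cong[OF r assms(2) Suc(2)] assms by simp
  also have "\<dots> \<approx> act x (- int (Suc n)) w" using act_add[OF assms, of "- 1" "- int n"] by simp
  finally show ?case .
qed

lemma word_act_power_word: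
  assumes "reduced w" "x \<in> V"
  shows "word_act (power_word (x, a)) w \<approx> act x a w"
  using word_act_replicate[OF assms, of "nat a"] word_act_replicate[OF assms, of "nat (- a)"]
  by auto

lemma power_word_words: "x \<in> V \<Longrightarrow> power_word (x, a) \<in> words_over V"
  by (auto simp: words_over_def)

lemma syl_word_Cons: "syl_word (s # ss) = power_word s @ syl_word ss"
  by (simp add: syl_word_def)

lemma syl_word_append: "syl_word (ss @ ss') = syl_word ss @ syl_word ss'"
  by (simp add: syl_word_def)

lemma syl_word_words: "fst ` set ss \<subseteq> V \<Longrightarrow> syl_word ss \<in> words_over V"
  by (induction ss) (auto simp: syl_word_Cons syl_word_def power_word_words simp del: power_word.simps)

lemma relator_act:
  assumes "(u, v) \<in> trickle_relators G" "reduced w"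
  shows "word_act u w \<approx> word_act v w"
  using assms(1) unfolding trickle_relators_def
proof (elim UnE CollectE exE conjE)
  fix x n assume *: "(u, v) = (replicate n (Inl x), [])" "x \<in> V" "label G x = enat n"
  have "word_act u w \<approx> act x (int n) w" using * word_act_replicate assms(2) by simp
  also have "\<dots> \<approx> w" using * act_id assms(2) by (simp add: modulus_def)
  finally show ?thesis using * by simp
next
  \<comment> \<open>One of two adjacent vertices is not below the other. The relation is symmetric
    in them, so it may be oriented such that \<open>perm G y x = x\<close>, as
    \<open>act_swap\<close> requires.\<close>
  have sw: "act (perm G x y) 1 (act x 1 w) \<approx> act (perm G y x) 1 (act y 1 w)"
    if "edge x y" "\<not> x \<prec> y" for x y
  proof -
    have V: "x \<in> V" "y \<in> V" and st: "y \<in> star G x" "x \<in> star G y"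
      using that edgeD edge_sym star_iff by auto
    have "perm G x y = ph x 1 y" "perm G y x = x" using V st ph_1 ph_fix[OF V(2) that(2), of 1] by auto
    then show ?thesis using act_swap[OF assms(2) that, of 1 1] shuffle_sym by simp
  qed
  fix x y assume *: "(u, v) = ([Inl (perm G x y), Inl x], [Inl (perm G y x), Inl y])" "{x, y} \<in> edges G"
  then have "edge x y" by (simp add: edge_def)
  then have "act (perm G x y) 1 (act x 1 w) \<approx> act (perm G y x) 1 (act y 1 w)"
    using sw edge_sym less_asym shuffle_sym by metis
  then show ?thesis using * by simp
qed

lemma peq_word_act: "peq u v \<Longrightarrow> reduced w \<Longrightarrow> word_act u w \<approx> word_act v w"
proof (induction arbitrary: w rule: pres_eq.induct)
  case (sym u v)
  then show ?case using shuffle_sym by blast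
next
  case (trans u v w')
  then show ?case using shuffle_trans by blast
next
  case (append u u' v v')
  have "u \<in> words_over V" "v \<in> words_over V" "v' \<in> words_over V"
    using append.hyps pres_eq_words by blast+
  then have "word_act u (word_act v w) \<approx> word_act u (word_act v' w)"
    using append word_act_cong word_act_reduced by blast
  also have "\<dots> \<approx> word_act u' (word_act v' w)"
    using append \<open>v' \<in> words_over V\<close> word_act_reduced by blast
  finally show ?case by simp
next
  case (cancel x)
  then show ?case using act_add[of w x 1 "- 1"] act_id[of w x 0] shuffle_trans by auto
next
  case (cancel' x)
  then show ?case using act_add[of w x "- 1" 1] act_id[of w x 0] shuffle_trans by auto
next
  case (rel u v)
  then show ?case using relator_act by blast
qed simp

text \<open>Acting on the empty word rebuilds a reduced word: each syllable meets a tail without a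
  head at its vertex and is simply prepended.\<close>

lemma reduced_syl_word: "reduced ss \<Longrightarrow> word_act (syl_word ss) [] \<approx> ss"
proof (induction ss)
  case Nil
  then show ?case by (simp add: syl_word_def)
next
  case (Cons s ss)
  obtain x a where s: "s = (x, a)" by fastforce
  from reduced_head[OF Cons.prems, of x a ss] have r: "reduced ss" "nohead x ss" "(x, a) \<in> syllables G"
    using s by auto
  have x: "x \<in> V" and a: "a mod modulus x = a" "a \<noteq> 0" using r(3) syllables_iff by auto
  have IH: "ss \<approx> word_act (syl_word ss) []" using Cons.IH[OF r(1)] shuffle_sym by blast
  then have "reduced (word_act (syl_word ss) [])" using r(1) reduced.shuffle by blast
  then have "word_act (syl_word (s # ss)) [] \<approx> act x a (word_act (syl_word ss) [])"
    using word_act_power_word x by (simp add: s syl_word_Cons del: power_word.simps)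
  also have "\<dots> \<approx> act x a ss" using act_cong[OF r(1) x IH] shuffle_sym by blast
  also have "\<dots> = s # ss" using r(2) a s by (simp add: act_def mk_def)
  finally show ?case .
qed

theorem reduced_unique:
  assumes "reduced ss" "reduced ss'" "peq (syl_word ss) (syl_word ss')"
  shows "ss \<approx> ss'"
  using peq_word_act[OF assms(3) reduced.Nil] reduced_syl_word[OF assms(1)]
    reduced_syl_word[OF assms(2)] shuffle_sym shuffle_trans by blast

section \<open>Products of syllables in the trickle group\<close>

abbreviation gen :: "'a \<Rightarrow> 'a word set" where "gen x \<equiv> element G [Inl x]"

sublocale Tr: group "Tr G"
  unfolding Tr_def by (rule group_presented_group)

lemma element_closed: "w \<in> words_over V \<Longrightarrow> element G w \<in> carrier (Tr G)"
  by (simp add: element_def Tr_def presented_group_def)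

lemma gen_closed [simp]: "x \<in> V \<Longrightarrow> gen x \<in> carrier (Tr G)"
  by (simp add: element_closed)

lemma carrier_Tr: "carrier (Tr G) = element G ` words_over V"
  by (simp add: element_def[abs_def] Tr_def presented_group_def)

lemma element_append: "u \<in> words_over V \<Longrightarrow> v \<in> words_over V \<Longrightarrow>
    element G (u @ v) = element G u \<otimes>\<^bsub>Tr G\<^esub> element G v"
  by (simp add: element_def Tr_def presented_group_mult)

lemma element_Nil: "element G [] = \<one>\<^bsub>Tr G\<^esub>"
  by (simp add: element_def Tr_def presented_group_def)

lemma element_eq_iff: "u \<in> words_over V \<Longrightarrow> element G u = element G v \<longleftrightarrow> peq u v"
  by (simp add: element_def pres_class_eq_iff)

lemma element_Inr: "x \<in> V \<Longrightarrow> element G [Inr x] = inv\<^bsub>Tr G\<^esub> gen x"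
proof -
  assume x: "x \<in> V"
  have "element G ([Inr x] @ [Inl x]) = \<one>\<^bsub>Tr G\<^esub>"
    using x pres_eq.cancel' by (simp flip: element_Nil add: element_eq_iff)
  then show ?thesis
    using x element_append[of "[Inr x]" "[Inl x]"] element_closed[of "[Inr x]"] Tr.inv_equality by simp
qed

lemma element_replicate: "l \<in> Inl ` V \<union> Inr ` V \<Longrightarrow>
    element G (replicate n l) = element G [l] [^]\<^bsub>Tr G\<^esub> n"
proof (induction n)
  case (Suc n)
  have "replicate n l \<in> words_over V" using Suc.prems by (auto simp: words_over_def)
  then show ?case using element_append[of "replicate n l" "[l]"] Suc
    by (simp flip: replicate_append_same)
qed (simp add: element_Nil)

lemma element_power_word: "x \<in> V \<Longrightarrow> element G (power_word (x, a)) = gen x [^]\<^bsub>Tr G\<^esub> a"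
proof (cases "a \<ge> 0")
  case True
  assume "x \<in> V"
  moreover have "gen x [^]\<^bsub>Tr G\<^esub> a = gen x [^]\<^bsub>Tr G\<^esub> nat a"
    using True int_pow_int[of "Tr G" "gen x" "nat a"] by simp
  ultimately show ?thesis using True by (simp add: element_replicate)
next
  case False
  assume x: "x \<in> V"
  then have "gen x [^]\<^bsub>Tr G\<^esub> a = inv\<^bsub>Tr G\<^esub> (gen x [^]\<^bsub>Tr G\<^esub> nat (- a))"
    using False Tr.int_pow_neg_int[of "gen x" "nat (- a)"] by simp
  then show ?thesis using False x by (simp add: element_replicate element_Inr Tr.int_pow_inv)
qed

text \<open>The fold inside \<open>\<omega>\<close>, for arbitrary lists of syllables.\<close>

definition syl_prod :: "'a syllable list \<Rightarrow> 'a word set" where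
  "syl_prod ss = foldr (\<lambda>(x, a) g. (gen x [^]\<^bsub>Tr G\<^esub> a) \<otimes>\<^bsub>Tr G\<^esub> g) ss \<one>\<^bsub>Tr G\<^esub>"

lemma syl_prod_Nil: "syl_prod [] = \<one>\<^bsub>Tr G\<^esub>"
  by (simp add: syl_prod_def)

lemma syl_prod_Cons: "syl_prod ((x, a) # ss) = gen x [^]\<^bsub>Tr G\<^esub> a \<otimes>\<^bsub>Tr G\<^esub> syl_prod ss"
  by (simp add: syl_prod_def)

lemma syl_prod_word: "fst ` set ss \<subseteq> V \<Longrightarrow> syl_prod ss = element G (syl_word ss)"
proof (induction ss)
  case (Cons s ss)
  obtain x a where "s = (x, a)" by fastforce
  then show ?case using Cons syl_word_words[of ss]
    by (simp add: syl_prod_Cons syl_word_Cons element_append power_word_words element_power_word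
        del: power_word.simps)
qed (simp add: syl_prod_Nil syl_word_def element_Nil)

lemma syl_prod_closed: "fst ` set ss \<subseteq> V \<Longrightarrow> syl_prod ss \<in> carrier (Tr G)"
  using syl_prod_word syl_word_words element_closed by simp

lemma syl_prod_append: "fst ` set ss \<subseteq> V \<Longrightarrow> fst ` set ss' \<subseteq> V \<Longrightarrow>
    syl_prod (ss @ ss') = syl_prod ss \<otimes>\<^bsub>Tr G\<^esub> syl_prod ss'"
  by (simp add: syl_prod_word image_Un syl_word_append element_append syl_word_words)

lemma gen_conj:
  assumes xy: "edge x y" and n: "\<not> x \<prec> y"
  shows "gen x \<otimes>\<^bsub>Tr G\<^esub> gen y = gen (ph x 1 y) \<otimes>\<^bsub>Tr G\<^esub> gen x"
proof -
  have V: "x \<in> V" "y \<in> V" and st: "y \<in> star G x" "x \<in> star G y"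
    using xy edgeD edge_sym star_iff by auto
  have 1: "perm G x y = ph x 1 y" "perm G y x = x" "ph x 1 y \<in> V"
    using V ph_1[OF V(1) st(1)] ph_1[OF V(2) st(2)] ph_fix[OF V(2) n, of 1] ph_V[OF V(1), of 1 y] by auto
  have "([Inl (perm G x y), Inl x], [Inl (perm G y x), Inl y]) \<in> trickle_relators G"
    using xy unfolding trickle_relators_def edge_def by blast
  then have "peq ([Inl (ph x 1 y)] @ [Inl x]) ([Inl x] @ [Inl y])"
    using 1 V by (auto intro!: pres_eq.rel)
  then have "element G ([Inl (ph x 1 y)] @ [Inl x]) = element G ([Inl x] @ [Inl y])"
    using 1 V by (subst element_eq_iff) auto
  moreover have "[Inl (ph x 1 y)] \<in> words_over V" "[Inl x] \<in> words_over V" "[Inl y] \<in> words_over V"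
    using 1 V by auto
  ultimately show ?thesis by (simp only: element_append)
qed

text \<open>The defining relation concerns exponents 1. Conjugation by one factor
  \<open>gen x\<close> gives every exponent \<open>b\<close> at once and applies \<phi>_x once to
  the vertex, so induction on \<open>a\<close> accumulates the power \<open>ph x a\<close>.\<close>

lemma gen_swap:
  assumes xy: "edge x y" and n: "\<not> x \<prec> y"
  shows "gen x [^]\<^bsub>Tr G\<^esub> (a::int) \<otimes>\<^bsub>Tr G\<^esub> gen y [^]\<^bsub>Tr G\<^esub> (b::int) =
    gen (ph x a y) [^]\<^bsub>Tr G\<^esub> b \<otimes>\<^bsub>Tr G\<^esub> gen x [^]\<^bsub>Tr G\<^esub> a"
proof -
  have V: "x \<in> V" "y \<in> V" and phV: "ph x a y \<in> V" for a using edgeD[OF xy] ph_V by auto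
  have phV': "ph x 1 (ph x i y) \<in> V" for i using ph_V V by simp
  have 1: "gen x \<otimes>\<^bsub>Tr G\<^esub> gen (ph x i y) [^]\<^bsub>Tr G\<^esub> b
      = gen (ph x (1 + i) y) [^]\<^bsub>Tr G\<^esub> b \<otimes>\<^bsub>Tr G\<^esub> gen x" for i
    using Tr.conj_int_pow[of "gen x" "gen (ph x i y)" "gen (ph x (1 + i) y)" b]
      gen_conj[of x "ph x i y"] xy n phV phV' V ph_edge_self self_less_ph
    by (simp add: ph_add)
  show ?thesis
  proof (induction a rule: int_induct[where k = 0])
    case base
    then show ?case using V by (simp add: ph_0)
  next
    case (step1 i)
    have "gen x [^]\<^bsub>Tr G\<^esub> (1 + i) \<otimes>\<^bsub>Tr G\<^esub> gen y [^]\<^bsub>Tr G\<^esub> b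
        = gen x \<otimes>\<^bsub>Tr G\<^esub> (gen (ph x i y) [^]\<^bsub>Tr G\<^esub> b \<otimes>\<^bsub>Tr G\<^esub> gen x [^]\<^bsub>Tr G\<^esub> i)"
      using V step1 phV by (simp add: Tr.int_pow_mult Tr.m_assoc)
    also have "\<dots> = (gen x \<otimes>\<^bsub>Tr G\<^esub> gen (ph x i y) [^]\<^bsub>Tr G\<^esub> b) \<otimes>\<^bsub>Tr G\<^esub> gen x [^]\<^bsub>Tr G\<^esub> i"
      using V phV by (simp add: Tr.m_assoc)
    also have "\<dots> = gen (ph x (1 + i) y) [^]\<^bsub>Tr G\<^esub> b \<otimes>\<^bsub>Tr G\<^esub> gen x [^]\<^bsub>Tr G\<^esub> (1 + i)"
      using V phV by (simp add: 1 Tr.int_pow_mult Tr.m_assoc)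
    finally show ?case by (simp add: add.commute)
  next
    case (step2 i)
    have x: "gen x [^]\<^bsub>Tr G\<^esub> i = gen x \<otimes>\<^bsub>Tr G\<^esub> gen x [^]\<^bsub>Tr G\<^esub> (i - 1)"
      using V Tr.int_pow_mult[of "gen x" 1 "i - 1"] by simp
    have "gen x \<otimes>\<^bsub>Tr G\<^esub> (gen x [^]\<^bsub>Tr G\<^esub> (i - 1) \<otimes>\<^bsub>Tr G\<^esub> gen y [^]\<^bsub>Tr G\<^esub> b)
        = gen (ph x i y) [^]\<^bsub>Tr G\<^esub> b \<otimes>\<^bsub>Tr G\<^esub> (gen x \<otimes>\<^bsub>Tr G\<^esub> gen x [^]\<^bsub>Tr G\<^esub> (i - 1))"
      using V step2 x by (simp add: Tr.m_assoc)
    also have "\<dots> = (gen x \<otimes>\<^bsub>Tr G\<^esub> gen (ph x (i - 1) y) [^]\<^bsub>Tr G\<^esub> b) \<otimes>\<^bsub>Tr G\<^esub> gen x [^]\<^bsub>Tr G\<^esub> (i - 1)"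
      using V phV 1[of "i - 1"] by (simp add: Tr.m_assoc)
    also have "\<dots> = gen x \<otimes>\<^bsub>Tr G\<^esub> (gen (ph x (i - 1) y) [^]\<^bsub>Tr G\<^esub> b \<otimes>\<^bsub>Tr G\<^esub> gen x [^]\<^bsub>Tr G\<^esub> (i - 1))"
      using V phV by (simp add: Tr.m_assoc)
    finally show ?case using V phV by simp
  qed
qed

lemma gen_modulus:
  assumes "x \<in> V"
  shows "gen x [^]\<^bsub>Tr G\<^esub> (a mod modulus x) = gen x [^]\<^bsub>Tr G\<^esub> a"
proof -
  have 1: "gen x [^]\<^bsub>Tr G\<^esub> modulus x = \<one>\<^bsub>Tr G\<^esub>"
  proof (cases "label G x")
    case (enat n)
    then have "(replicate n (Inl x), []) \<in> trickle_relators G"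
      using assms unfolding trickle_relators_def by blast
    moreover have w: "replicate n (Inl x) \<in> words_over V" using assms by (auto simp: words_over_def)
    ultimately have "peq (replicate n (Inl x)) []" by (intro pres_eq.rel) auto
    then have "element G (replicate n (Inl x)) = \<one>\<^bsub>Tr G\<^esub>"
      using w by (simp flip: element_Nil add: element_eq_iff)
    then show ?thesis using assms enat by (simp add: element_replicate modulus_def int_pow_int)
  qed (simp add: modulus_def)
  have "gen x [^]\<^bsub>Tr G\<^esub> (modulus x * k) = \<one>\<^bsub>Tr G\<^esub>" for k :: int
    using Tr.int_pow_pow[of "gen x" "modulus x" k] 1 assms by simp
  then have "gen x [^]\<^bsub>Tr G\<^esub> (a mod modulus x + modulus x * (a div modulus x))
      = gen x [^]\<^bsub>Tr G\<^esub> (a mod modulus x)"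
    using assms by (simp only: Tr.int_pow_mult gen_closed) simp
  then show ?thesis by simp
qed

lemma shuffle1_vertices: "shuffle1 u v \<Longrightarrow> fst ` set u \<subseteq> V \<longleftrightarrow> fst ` set v \<subseteq> V"
  by (induction rule: shuffle1.induct) (auto simp: res_def ph_V edgeD)

lemma shuffle_vertices: "u \<approx> v \<Longrightarrow> fst ` set u \<subseteq> V \<longleftrightarrow> fst ` set v \<subseteq> V"
  unfolding shuffle_def
  by (induction rule: rtranclp_induct) (simp_all add: shuffle1_vertices)

lemma shuffle_syl_prod: "u \<approx> v \<Longrightarrow> fst ` set u \<subseteq> V \<Longrightarrow> syl_prod u = syl_prod v"
  unfolding shuffle_def
proof (induction rule: rtranclp_induct)
  case (step y z)
  from step.hyps(1) step.prems have yV: "fst ` set y \<subseteq> V"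
    using shuffle_vertices unfolding shuffle_def by blast
  \<comment> \<open>An exchange is symmetric in \<open>s\<close> and \<open>t\<close>, so it
    suffices to treat the case where \<open>t\<close> leaves \<open>s\<close> unchanged.\<close>
  have *: "syl_prod [s, res s t] = syl_prod [t, res t s]" if "adj s t" "\<not> fst s \<prec> fst t" for s t
  proof -
    obtain x a y b where st: "s = (x, a)" "t = (y, b)" by fastforce
    have xy: "edge x y" "\<not> x \<prec> y" and V: "x \<in> V" "y \<in> V" using that st edgeD by auto
    have "edge x (ph x (- a) y)" "\<not> x \<prec> ph x (- a) y"
      using xy V ph_edge_self self_less_ph by auto
    from gen_swap[OF this, of a b] show ?thesis
      using V xy by (simp add: st res_def ph_fix ph_inverse syl_prod_Cons syl_prod_Nil ph_V)
  qed
  from step.hyps(2) obtain s t p q where st: "adj s t" "y = p @ [s, res s t] @ q"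
    "z = p @ [t, res t s] @ q" by (auto simp: shuffle1.simps)
  have "syl_prod [s, res s t] = syl_prod [t, res t s]"
    using * st(1) adj_sym less_asym by metis
  moreover have "fst ` set [s, res s t] \<subseteq> V" "fst ` set [t, res t s] \<subseteq> V"
    using st(1) edgeD ph_V by (auto simp: res_def)
  moreover have pq: "fst ` set p \<subseteq> V" "fst ` set q \<subseteq> V" using yV st(2) by auto
  have "syl_prod (p @ m @ q) = syl_prod p \<otimes>\<^bsub>Tr G\<^esub> (syl_prod m \<otimes>\<^bsub>Tr G\<^esub> syl_prod q)"
    if "fst ` set m \<subseteq> V" for m
    using pq that by (simp add: syl_prod_append image_Un)
  ultimately have "syl_prod y = syl_prod z" unfolding st(2,3) by (simp only:)
  then show ?case using step by simp
qed simp

subsection \<open>Strata as lists\<close>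

definition slist :: "'a syllable list \<Rightarrow> bool" where
  "slist l \<longleftrightarrow> set l \<subseteq> syllables G \<and> sorted_wrt (\<lambda>s t. adj s t \<and> \<not> fst s \<prec> fst t) l"

text \<open>The entries of \<open>hds l\<close> are the pairs \<open>(\<gamma>(U, s), U - {s})\<close> where \<open>l\<close> numbers \<open>U\<close>.\<close>

fun hds :: "'a syllable list \<Rightarrow> ('a syllable \<times> 'a syllable list) list" where
  "hds [] = []"
| "hds (s # l) = (s, l) # map (\<lambda>(h, r). (unres s h, s # r)) (hds l)"

lemma res_fix: "fst s \<in> V \<Longrightarrow> \<not> fst t \<prec> fst s \<Longrightarrow> res s t = t"
  by (cases t) (simp add: res_def ph_fix)

lemma slist_Nil [simp]: "slist []"
  by (simp add: slist_def)

lemma slist_Cons: "slist (s # l) \<longleftrightarrow>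
    s \<in> syllables G \<and> slist l \<and> (\<forall>t\<in>set l. adj s t \<and> \<not> fst s \<prec> fst t)"
  by (auto simp: slist_def)

lemma slist_append: "slist (l @ l') \<longleftrightarrow>
    slist l \<and> slist l' \<and> (\<forall>s\<in>set l. \<forall>t\<in>set l'. adj s t \<and> \<not> fst s \<prec> fst t)"
  by (auto simp: slist_def sorted_wrt_append)

lemma syllables_V: "s \<in> syllables G \<Longrightarrow> fst s \<in> V"
  by (auto simp: syllables_def)

lemma slist_V: "slist l \<Longrightarrow> fst ` set l \<subseteq> V"
  by (auto simp: slist_def dest: syllables_V)

lemma slist_distinct: "slist l \<Longrightarrow> distinct l"
  by (induction l) (auto simp: slist_Cons edge_irrefl)

lemma slist_vertex_unique: "slist l \<Longrightarrow> (x, a) \<in> set l \<Longrightarrow> (x, b) \<in> set l \<Longrightarrow> a = b"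
  by (induction l) (auto simp: slist_Cons edge_irrefl)

lemma slist_adj: "slist l \<Longrightarrow> s \<in> set l \<Longrightarrow> t \<in> set l \<Longrightarrow> s \<noteq> t \<Longrightarrow> adj s t"
  by (induction l) (auto simp: slist_Cons edge_sym)

lemma slist_iff_strata:
  "slist l \<longleftrightarrow> set l \<in> strata G \<and> distinct l \<and> sorted_wrt (\<lambda>s t. \<not> fst s \<prec> fst t) l"
proof
  assume l: "slist l"
  then have "set l \<in> strata G"
    using slist_adj[OF l] edge_irrefl unfolding strata_def slist_def edge_def by fastforce
  then show "set l \<in> strata G \<and> distinct l \<and> sorted_wrt (\<lambda>s t. \<not> fst s \<prec> fst t) l"
    using l slist_distinct unfolding slist_def by (auto intro: sorted_wrt_mono_rel[rotated])
next
  assume l: "set l \<in> strata G \<and> distinct l \<and> sorted_wrt (\<lambda>s t. \<not> fst s \<prec> fst t) l"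
  then have *: "set l \<subseteq> syllables G" "\<And>s t. s \<in> set l \<Longrightarrow> t \<in> set l \<Longrightarrow> s \<noteq> t \<Longrightarrow> adj s t"
    by (auto simp: strata_def edge_def)
  have "sorted_wrt (\<lambda>s t. s \<noteq> t \<and> \<not> fst s \<prec> fst t) l"
    using l by (auto simp: sorted_wrt_iff_nth_less nth_eq_iff_index_eq)
  then have "sorted_wrt (\<lambda>s t. adj s t \<and> \<not> fst s \<prec> fst t) l"
    by (rule sorted_wrt_mono_rel[rotated]) (use *(2) in blast)
  then show "slist l" using * by (simp add: slist_def)
qed

lemma slist_iff_numbering: "slist l \<longleftrightarrow> set l \<in> strata G \<and> numbering G (set l) l"
proof -
  have "sorted_wrt (\<lambda>s t. \<not> fst s \<prec> fst t) l \<longleftrightarrow>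
      (\<forall>i<length l. \<forall>j<length l. fst (l ! j) \<prec> fst (l ! i) \<longrightarrow> i < j)"
    (is "_ \<longleftrightarrow> ?R")
  proof
    assume s: "sorted_wrt (\<lambda>s t. \<not> fst s \<prec> fst t) l"
    show ?R
    proof (intro allI impI)
      fix i j assume ij: "i < length l" "fst (l ! j) \<prec> fst (l ! i)"
      then have "\<not> j < i" using s by (auto simp: sorted_wrt_iff_nth_less)
      moreover have "i \<noteq> j" using ij less_irrefl by auto
      ultimately show "i < j" by simp
    qed
  next
    assume ?R
    then show "sorted_wrt (\<lambda>s t. \<not> fst s \<prec> fst t) l"
      unfolding sorted_wrt_iff_nth_less by (metis order.asym order.strict_trans)
  qed
  then show ?thesis unfolding slist_iff_strata numbering_def by auto
qed

text \<open>In the inductive case the vertex of \<open>t\<close> is not below that of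
  \<open>s\<close>, hence fixed by its powers. These preserve edges and order, so the relation of
  \<open>t\<close> to a head of the rest passes to the conjugated head.\<close>

lemma hds_adj:
  assumes "slist (t # l)" "(h, r) \<in> set (hds l)"
  shows "adj t h \<and> \<not> fst t \<prec> fst h"
  using assms
proof (induction l arbitrary: t h r)
  case (Cons s l)
  show ?case
  proof (cases "(h, r) = (s, l)")
    case False
    then obtain h' r' where h: "(h', r') \<in> set (hds l)" "h = unres s h'" using Cons.prems(2) by auto
    have "slist (s # l)" "slist (t # l)" and ts: "adj t s" "\<not> fst t \<prec> fst s"
      using Cons.prems(1) by (auto simp: slist_Cons)
    with Cons.IH h(1) have 1: "adj s h'" "adj t h'" "\<not> fst t \<prec> fst h'" by blast+
    have V: "fst s \<in> V" using ts edgeD by blast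
    have st: "fst t \<in> star G (fst s)" "fst h' \<in> star G (fst s)"
      using ts 1 edge_sym star_iff by auto
    have "ph (fst s) (snd s) (fst t) = fst t" using ph_fix V ts by blast
    then show ?thesis
      using ph_edge[OF V st, of "snd s"] ph_less[OF V st, of "snd s"] 1 h(2) by (simp add: unres_def)
  qed (use Cons.prems in \<open>auto simp: slist_Cons\<close>)
qed simp

lemma hds_set: "(h, r) \<in> set (hds l) \<Longrightarrow> set r \<subseteq> set l \<and> Suc (length r) = length l"
  by (induction l arbitrary: h r) fastforce+

lemma hds_sorted: "(h, r) \<in> set (hds l) \<Longrightarrow> sorted_wrt P l \<Longrightarrow> sorted_wrt P r"
proof (induction l arbitrary: h r)
  case (Cons s l)
  then show ?case using hds_set by fastforce
qed simp

lemma hds_slist: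
  assumes "slist l" "(h, r) \<in> set (hds l)"
  shows "slist r" "h \<in> syllables G" "l \<approx> h # r"
proof -
  show "slist r" using assms hds_set hds_sorted unfolding slist_def by blast
  have "h \<in> syllables G \<and> l \<approx> h # r"
    using assms
  proof (induction l arbitrary: h r)
    case (Cons s l)
    show ?case
    proof (cases "(h, r) = (s, l)")
      case False
      then obtain h' r' where h: "(h', r') \<in> set (hds l)" "h = unres s h'" "r = s # r'"
        using Cons.prems(2) by auto
      have s: "slist l" "fst s \<in> V" using Cons.prems(1) slist_Cons syllables_V by auto
      have IH: "h' \<in> syllables G" "l \<approx> h' # r'" using Cons.IH[OF s(1) h(1)] by auto
      have sh: "adj s h'" "\<not> fst s \<prec> fst h'" using hds_adj[OF Cons.prems(1) h(1)] by auto
      \<comment> \<open>The vertex of \<open>s\<close> is not below that of \<open>h'\<close>, and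
        conjugation by \<open>s\<close> does not change this, so \<open>s\<close> is left unchanged
        when \<open>h\<close> moves in front of it.\<close>
      have "res h s = s"
        using sh s(2) self_less_ph ph_V adj_V ph_fix by (simp add: res_def h(2) unres_def)
      moreover have "adj s h" using sh adj_unres s h(2) by simp
      ultimately have "s # h' # r' \<approx> h # s # r'"
        using shuffle_swap[of s h r'] res_unres(1)[OF s(2)] h(2) by simp
      then have "s # l \<approx> h # r" using shuffle_Cons[OF IH(2)] h(3) shuffle_trans by metis
      moreover have "h \<in> syllables G"
        using IH(1) s(2) syllable_ph[of "fst s" "snd s" "fst h'" "snd h'"] by (simp add: h(2) unres_def)
      ultimately show ?thesis by simp
    qed (use Cons.prems in \<open>auto simp: slist_Cons\<close>)
  qed simp
  then show "h \<in> syllables G" "l \<approx> h # r" by auto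
qed

text \<open>The vertex of \<open>s\<close> lies below none of those in \<open>l\<close>, so
  \<open>s\<close> travels unchanged and only conjugates the letters that it passes.\<close>

lemma shuffle_commuting:
  assumes "\<forall>t\<in>set l. adj t s \<and> \<not> fst s \<prec> fst t"
  shows "l @ s # v \<approx> s # map (res s) l @ v"
  using assms
proof (induction l)
  case (Cons t l)
  have "t # l @ s # v \<approx> t # s # map (res s) l @ v" using Cons shuffle_Cons by simp
  also have "res t s = s" using Cons.prems res_fix adj_V(1)[of t s] by simp
  then have "t # s # map (res s) l @ v \<approx> s # res s t # map (res s) l @ v"
    using shuffle_swap[of t s] Cons.prems by simp
  finally show ?case by simp
qed simp

text \<open>The reason why \<open>\<omega>\<close> does not depend on the numbering. Letters
  preceding \<open>s\<close> in \<open>l'\<close> but following it in \<open>l\<close> are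
  incomparable with \<open>s\<close>, so passing them changes nothing.\<close>

lemma slist_shuffle:
  assumes "slist l" "slist l'" "set l = set l'"
  shows "l \<approx> l'"
  using assms
proof (induction l arbitrary: l')
  case (Cons s l)
  then obtain p q where l': "l' = p @ s # q" using split_list by (metis list.set_intros(1))
  have s: "slist l" "\<forall>t\<in>set l. adj s t \<and> \<not> fst s \<prec> fst t" using Cons.prems by (auto simp: slist_Cons)
  have pq: "slist (p @ q)" and p: "\<forall>t\<in>set p. adj t s \<and> \<not> fst t \<prec> fst s" and "s \<notin> set (p @ q)"
    using Cons.prems(2) slist_distinct[OF Cons.prems(2)] unfolding l'
    by (auto simp: slist_append slist_Cons)
  moreover have "s \<notin> set l" using slist_distinct[OF Cons.prems(1)] by simp
  ultimately have set: "set l = set (p @ q)" using Cons.prems(3) l' by auto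
  then have "\<forall>t\<in>set p. adj t s \<and> \<not> fst s \<prec> fst t" using s p by auto
  then have "p @ s # q \<approx> s # map (res s) p @ q" by (rule shuffle_commuting)
  moreover have "map (res s) p = p"
    using p res_fix syllables_V Cons.prems(1) by (intro map_idI) (auto simp: slist_Cons)
  moreover have "l \<approx> p @ q" using Cons.IH[OF s(1) pq set] .
  ultimately show ?case using l' shuffle_Cons shuffle_sym shuffle_trans by metis
qed simp

subsection \<open>Divisors of stratum words\<close>

lemma slist_head_cases:
  assumes "slist l" "l @ v \<approx> h # w"
  shows "h \<in> fst ` set (hds l) \<or> (\<exists>h' w'. v \<approx> h' # w' \<and> (\<forall>t\<in>set l. adj t h'))"
proof -
  \<comment> \<open>The last clause strengthens the induction: once a letter is put in front of
    \<open>l\<close>, it must also be adjacent to the head of \<open>v\<close>, whereas a priori it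
    is adjacent only to the head of \<open>l @ v\<close>.\<close>
  have "h \<in> fst ` set (hds l) \<or> (\<exists>h' w'. v \<approx> h' # w' \<and> (\<forall>t\<in>set l. adj t h') \<and>
      (\<forall>t. slist (t # l) \<and> adj t h \<longrightarrow> adj t h'))"
    using assms
  proof (induction l arbitrary: h w)
    case (Cons s l)
    then have "s # (l @ v) \<approx> h # w" by simp
    from shuffle_Cons_Cons[OF this] show ?case
    proof (elim disjE conjE exE)
      assume "s = h"
      then show ?thesis by simp
    next
      fix e assume sh: "adj s h" and e: "l @ v \<approx> res s h # e"
      have s: "slist l" "fst s \<in> V" using Cons.prems(1) slist_Cons syllables_V by auto
      from Cons.IH[OF s(1) e] show ?thesis
      proof (elim disjE exE conjE)
        assume "res s h \<in> fst ` set (hds l)"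
        then have "unres s (res s h) \<in> fst ` set (hds (s # l))" by force
        then show ?thesis using res_unres s(2) by simp
      next
        fix h' w' assume *: "v \<approx> h' # w'" "\<forall>t\<in>set l. adj t h'"
          "\<forall>t. slist (t # l) \<and> adj t (res s h) \<longrightarrow> adj t h'"
        have "adj s h'" using *(3) Cons.prems(1) sh s(2) adj_res by blast
        moreover have "adj t h'" if t: "slist (t # s # l)" "adj t h" for t
        proof -
          have "adj t s" "\<not> fst t \<prec> fst s" using t(1) by (auto simp: slist_Cons)
          then have "res s t = t" "adj s t" using res_fix s(2) adj_sym by auto
          then have "adj t (res s h)" using adj_res_res[of s t h] sh t(2) by simp
          moreover have "slist (t # l)" using t(1) by (simp add: slist_Cons)
          ultimately show ?thesis using *(3) by blast
        qed
        ultimately have "(\<forall>t\<in>set (s # l). adj t h') \<and> (\<forall>t. slist (t # s # l) \<and> adj t h \<longrightarrow> adj t h')"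
          using *(2) by simp
        then show ?thesis using *(1) by blast
      qed
    qed
  next
    case Nil
    then have "v \<approx> h # w" by simp
    then show ?case by (intro disjI2 exI[of _ h] exI[of _ w]) simp
  qed
  then show ?thesis by blast
qed

lemma hds_iff: "slist l \<Longrightarrow> h \<in> fst ` set (hds l) \<longleftrightarrow> (\<exists>w. l \<approx> h # w)"
  using slist_head_cases[of l "[]" h] hds_slist(3) by fastforce

text \<open>The vertex \<open>x\<close> is not below any vertex of \<open>l\<close>, so a head with
  this vertex comes through \<open>l\<close> unchanged; it cannot stem from \<open>l\<close>, whose
  vertices differ from \<open>x\<close>.\<close>

lemma slist_same_vertex_head:
  assumes "slist ((x, a) # l)" "l @ v \<approx> (x, b) # w"
  shows "\<exists>w. v \<approx> (x, b) # w"
  using assms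
proof (induction l arbitrary: w)
  case (Cons s l)
  have s: "slist ((x, a) # l)" "edge x (fst s)" "\<not> x \<prec> fst s" using Cons.prems by (auto simp: slist_Cons)
  have "s # (l @ v) \<approx> (x, b) # w" using Cons.prems by simp
  from shuffle_Cons_Cons[OF this] obtain e where "l @ v \<approx> res s (x, b) # e"
    using s(2) edge_irrefl by auto
  moreover have "res s (x, b) = (x, b)" using ph_fix edgeD s by (simp add: res_def)
  ultimately show ?case using Cons.IH[OF s(1)] by simp
qed auto

text \<open>After division of \<open>c\<close> by the first letter \<open>s\<close>, every head
  \<open>h\<close> of the remaining list divides the quotient, because \<open>unres s h\<close>
  divides \<open>c\<close> and has residue \<open>h\<close> after \<open>s\<close>.\<close>

lemma slist_lcm:
  assumes "slist l" "\<And>h. h \<in> fst ` set (hds l) \<Longrightarrow> \<exists>w. c \<approx> h # w"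
  shows "\<exists>v. c \<approx> l @ v"
  using assms
proof (induction l arbitrary: c)
  case (Cons s l)
  have s: "slist l" "fst s \<in> V" using Cons.prems(1) slist_Cons syllables_V by auto
  obtain c1 where c1: "c \<approx> s # c1" using Cons.prems(2)[of s] by auto
  have "\<exists>w. c1 \<approx> h # w" if h: "h \<in> fst ` set (hds l)" for h
  proof -
    have sh: "adj s h" using hds_adj[OF Cons.prems(1)] h by fastforce
    have "unres s h \<in> fst ` set (hds (s # l))" using h by force
    then obtain c2 where "c \<approx> unres s h # c2" using Cons.prems(2) by blast
    then have "s # c1 \<approx> unres s h # c2" using c1 shuffle_sym shuffle_trans by blast
    moreover have "adj s (unres s h)" using sh adj_unres s(2) by simp
    ultimately obtain e where "c1 \<approx> res s (unres s h) # e"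
      using shuffle_Cons_Cons adj_neq by blast
    then show ?thesis using res_unres(1) s(2) by auto
  qed
  then obtain v where "c1 \<approx> l @ v" using Cons.IH[OF s(1)] by blast
  then show ?case using c1 shuffle_Cons shuffle_trans append_Cons by metis
qed auto

text \<open>Turns last letters into first letters. Exponents are negated without reduction, which is
  enough because shuffles admit arbitrary integers.\<close>

definition inv_word :: "'a syllable list \<Rightarrow> 'a syllable list" where
  "inv_word w = rev (map (\<lambda>(x, a). (x, - a)) w)"

lemma shuffle_inv_word: "u \<approx> v \<Longrightarrow> inv_word u \<approx> inv_word v"
  unfolding shuffle_def
proof (induction rule: rtranclp_induct)
  case (step y z)
  from step.hyps(2) have "shuffle1 (inv_word y) (inv_word z)"
  proof (induction rule: shuffle1.induct)
    case (1 s t u v)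
    obtain x a y b where st: "s = (x, a)" "t = (y, b)" by fastforce
    \<comment> \<open>The inverses of \<open>res s t\<close> and \<open>res t s\<close>. By
      \<open>ph_back\<close> their residues are the inverses of \<open>s\<close> and
      \<open>t\<close>, so the exchange read backwards is again an exchange.\<close>
    let ?p = "(ph x (- a) y, - b)" and ?q = "(ph y (- b) x, - a)"
    have e: "edge x y" "edge y x" and V: "x \<in> V" "y \<in> V"
      using 1 edgeD edge_sym by (auto simp: st)
    have "adj ?p ?q"
    proof (cases "x \<prec> y")
      case True
      then have "ph x (- a) y = y" using ph_fix less_asym V by blast
      then show ?thesis using e ph_edge_self V by simp
    next
      case False
      then have "ph y (- b) x = x" using ph_fix V by blast
      then show ?thesis using e ph_edge_self[of x "- a" y] V edge_sym by simp
    qed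
    moreover have "ph (ph y (- b) x) a (ph x (- a) y) = y" "ph (ph x (- a) y) b (ph y (- b) x) = x"
      using ph_back(2)[OF e(1), of "- b" a "- a"] ph_back(2)[OF e(2), of "- a" b "- b"] V ph_0 by simp_all
    then have "res ?p ?q = (x, - a)" "res ?q ?p = (y, - b)" by (simp_all add: res_def)
    ultimately show ?case
      using shuffle1.intros[of ?p ?q "inv_word v" "inv_word u"]
      by (simp add: inv_word_def st res_def)
  qed
  then show ?case using step by simp
qed simp

text \<open>In contrast to \<open>hds\<close>, bringing a letter to the front changes nothing here:
  it is not below any letter in front of it, and is therefore fixed by them.\<close>

lemma head_of_increasing:
  assumes "sorted_wrt (\<lambda>s t. adj s t \<and> \<not> fst t \<prec> fst s) l" "l \<approx> h # w"
  shows "h \<in> set l"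
  using assms
proof (induction l arbitrary: w h)
  case (Cons s l)
  from shuffle_Cons_Cons[OF Cons.prems(2)] show ?case
  proof (elim disjE conjE exE)
    fix e assume sh: "adj s h" and e: "l \<approx> res s h # e"
    then have r: "res s h \<in> set l" using Cons by simp
    then have "\<not> fst (res s h) \<prec> fst s" using Cons.prems by simp
    then have "\<not> fst h \<prec> fst s" using ph_less_self adj_V[OF sh] by (simp add: res_def)
    then have "res s h = h" using ph_fix adj_V[OF sh] by (simp add: res_def)
    then show ?thesis using r by simp
  qed auto
qed simp

text \<open>The syllables of a stratum are recovered as the last letters of the stratum word, that is, as
  the first letters of the inverse word.\<close>

lemma slist_shuffle_set:
  assumes "slist l" "slist l'" "l \<approx> l'"
  shows "set l = set l'"
proof -
  have "set l \<subseteq> set l'" if l: "slist l" "slist l'" "l \<approx> l'" for l l'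
  proof
    fix s assume "s \<in> set l"
    then obtain p q where pq: "l = p @ s # q" using split_list by metis
    have q: "\<forall>t\<in>set q. adj s t \<and> \<not> fst s \<prec> fst t" using l(1) pq by (auto simp: slist_append slist_Cons)
    have "\<exists>q'. s # q \<approx> q' @ [s]" using q
    proof (induction q)
      case (Cons t q)
      then obtain q' where q': "s # q \<approx> q' @ [s]" by auto
      have st: "adj s t" "\<not> fst s \<prec> fst t" using Cons.prems by auto
      have "adj s (unres s t)" "\<not> fst s \<prec> fst (unres s t)"
        using st adj_unres self_less_ph adj_V[OF st(1)] by (auto simp: unres_def)
      then have "s # t # q \<approx> unres s t # s # q"
        using shuffle_swap[of s "unres s t" q] res_unres(1)[of s t] adj_V[OF st(1)]
          ph_fix[of "fst (unres s t)" "fst s"] adj_V(2)[of s "unres s t"]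
        by (simp add: res_def[of "unres s t" s])
      also have "\<dots> \<approx> unres s t # q' @ [s]" using q' shuffle_Cons by blast
      finally show ?case by (metis append_Cons)
    qed (auto intro: exI[of _ "[]"])
    then obtain q' where "p @ s # q \<approx> p @ q' @ [s]" using shuffle_append by blast
    then have "l' \<approx> p @ q' @ [s]" using l(3) pq shuffle_sym shuffle_trans by blast
    from shuffle_inv_word[OF this] have "inv_word l' \<approx> (fst s, - snd s) # inv_word (p @ q')"
      by (simp add: inv_word_def split_beta)
    moreover have "sorted_wrt (\<lambda>s t. adj s t \<and> \<not> fst t \<prec> fst s) (inv_word l')"
      using l(2) unfolding slist_def inv_word_def
      by (auto simp: sorted_wrt_rev sorted_wrt_map split_beta edge_sym intro: sorted_wrt_mono_rel[rotated])
    ultimately have "(fst s, - snd s) \<in> set (inv_word l')" using head_of_increasing by blast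
    then show "s \<in> set l'" by (auto simp: inv_word_def)
  qed
  then show ?thesis using assms shuffle_sym by blast
qed

subsection \<open>Irreducible pilings\<close>

definition can_addl :: "'a syllable list \<Rightarrow> 'a syllable \<Rightarrow> bool" where
  "can_addl l h \<longleftrightarrow> (\<exists>t\<in>set l. fst t = fst h) \<or> (\<forall>t\<in>set l. adj t h)"

lemma can_addl_iff: "can_addl l h \<longleftrightarrow> can_add G (set l) h"
proof -
  have "fst h \<in> supp (set l) \<longleftrightarrow> (\<exists>t\<in>set l. fst t = fst h)" by (metis image_iff supp_def)
  moreover have "(\<forall>x\<in>supp (set l). {fst h, x} \<in> edges G) \<longleftrightarrow> (\<forall>t\<in>set l. adj t h)"
    by (simp add: supp_def edge_def insert_commute)
  ultimately show ?thesis by (simp add: can_addl_def can_add_def)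
qed

fun irr :: "'a syllable list list \<Rightarrow> bool" where
  "irr [] \<longleftrightarrow> True"
| "irr (l # p) \<longleftrightarrow> slist l \<and> l \<noteq> [] \<and> irr p \<and>
     (case p of [] \<Rightarrow> True | k # _ \<Rightarrow> \<forall>h\<in>fst ` set (hds k). \<not> can_addl l h)"

text \<open>A head coming from behind \<open>l\<close> would be a head of the next stratum, by
  induction, and adjacent to all of \<open>l\<close>; such a syllable could be added to
  \<open>l\<close>.\<close>

lemma irr_head:
  "irr (l # p) \<Longrightarrow> concat (l # p) \<approx> h # w \<Longrightarrow> h \<in> fst ` set (hds l)"
proof (induction p arbitrary: l h w)
  case Nil
  then show ?case using slist_head_cases[of l "[]" h w] by auto
next
  case (Cons k p)
  have k: "irr (k # p)" and l: "slist l" "\<forall>h\<in>fst ` set (hds k). \<not> can_addl l h" using Cons.prems by auto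
  have "l @ concat (k # p) \<approx> h # w" using Cons.prems by simp
  from slist_head_cases[OF l(1) this] show ?case
  proof (elim disjE exE conjE)
    fix h' w' assume h': "concat (k # p) \<approx> h' # w'" "\<forall>t\<in>set l. adj t h'"
    from Cons.IH[OF k h'(1)] show ?thesis using h'(2) l(2) by (auto simp: can_addl_def)
  qed simp
qed

text \<open>A second syllable at a vertex of \<open>l\<close> that could be brought to the front of
  the tail would be a head of the next stratum, hence addable through the first alternative of
  \<open>can_addl\<close>.\<close>

lemma irr_reduced: "irr p \<Longrightarrow> reduced (concat p)"
proof (induction p)
  case (Cons l p)
  then have l: "slist l" and p: "irr p" "reduced (concat p)" by auto
  have nh: "nohead (fst t) (concat p)" if "t \<in> set l" for t
  proof (cases p)
    case (Cons k q)
    then have n: "\<forall>h\<in>fst ` set (hds k). \<not> can_addl l h" using \<open>irr (l # p)\<close> by auto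
    show ?thesis
      unfolding nohead_def
    proof (intro allI notI)
      fix b w assume "concat p \<approx> (fst t, b) # w"
      then have "(fst t, b) \<in> fst ` set (hds k)" using irr_head p(1) Cons by blast
      then show False using n that by (auto simp: can_addl_def)
    qed
  qed simp
  have "reduced (l @ concat p)" using l nh
  proof (induction l)
    case (Cons s l)
    obtain x a where s: "s = (x, a)" by fastforce
    have "nohead x (l @ concat p)"
      using slist_same_vertex_head[of x a l "concat p"] Cons.prems(1) Cons.prems(2)[of s] s
      by (fastforce simp: nohead_def)
    then show ?case using Cons s by (auto simp: slist_Cons intro!: reduced.Cons)
  qed (simp add: p)
  then show ?case by simp
qed (simp add: reduced.Nil)

lemma irr_shuffle_unique:
  "irr p \<Longrightarrow> irr p' \<Longrightarrow> concat p \<approx> concat p' \<Longrightarrow> map set p = map set p'"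
proof (induction p arbitrary: p')
  case Nil
  then show ?case by (cases p') auto
next
  case (Cons l p)
  then obtain l' q where p': "p' = l' # q" by (cases p') auto
  have l: "slist l" "irr p" and l': "slist l'" "irr q" using Cons.prems p' by auto
  have sh: "concat (l # p) \<approx> concat (l' # q)" using Cons.prems p' by simp
  \<comment> \<open>Every head of \<open>l\<close> is a head of the common word, hence of
    \<open>l'\<close> by \<open>irr_head\<close>; so \<open>l'\<close> is a multiple of
    \<open>l\<close>.\<close>
  have *: "\<exists>v. l' \<approx> l @ v"
    if irr: "irr (l # p)" "irr (l' # q)" and sh: "concat (l # p) \<approx> concat (l' # q)" for l l' p q
  proof (rule slist_lcm)
    show l: "slist l" using irr by simp
    fix h assume "h \<in> fst ` set (hds l)"
    then obtain w where "l \<approx> h # w" using hds_iff[OF l] by blast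
    then have "concat (l # p) \<approx> h # w @ concat p" using shuffle_append[of l "h # w"] by simp
    then have "concat (l' # q) \<approx> h # w @ concat p" using sh shuffle_sym shuffle_trans by blast
    then have "h \<in> fst ` set (hds l')" using irr_head irr(2) by blast
    then show "\<exists>w. l' \<approx> h # w" using hds_iff irr(2) by simp
  qed
  obtain v where v: "l' \<approx> l @ v" using * Cons.prems sh p' by blast
  obtain v' where v': "l \<approx> l' @ v'" using * Cons.prems shuffle_sym[OF sh] p' by blast
  \<comment> \<open>Divisibility in both directions leaves no remainder, because shuffles preserve
    length.\<close>
  have "v = []" using shuffle_length[OF v] shuffle_length[OF v'] by simp
  then have ll': "l \<approx> l'" using v shuffle_sym by simp
  have "l @ concat p \<approx> l' @ concat q" using sh by simp
  also have "\<dots> \<approx> l @ concat q" using shuffle_append[OF shuffle_sym[OF ll']] by blast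
  finally have "l @ concat p \<approx> l @ concat q" .
  then have "map set p = map set q" using Cons.IH[OF l(2) l'(2)] shuffle_append_cancel by blast
  moreover have "set l = set l'" by (rule slist_shuffle_set[OF l(1) l'(1) ll'])
  ultimately show ?case using p' by simp
qed

lemma irr_V: "irr p \<Longrightarrow> fst ` set (concat p) \<subseteq> V"
proof (induction p)
  case (Cons l p)
  then show ?case using slist_V[of l] by auto
qed simp

theorem irr_unique:
  assumes "irr p" "irr p'" "syl_prod (concat p) = syl_prod (concat p')"
  shows "map set p = map set p'"
proof (rule irr_shuffle_unique[OF assms(1,2)], rule reduced_unique)
  show "peq (syl_word (concat p)) (syl_word (concat p'))"
    using assms irr_V syl_prod_word element_eq_iff syl_word_words by metis
qed (use assms irr_reduced in auto)

text \<open>Identifies the heads with the fold in \<open>\<gamma>\<close>. Each letter is adjacent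
  to the heads behind it, so \<open>ph\<close> and \<open>perm_pow\<close> agree on them.\<close>

lemma hds_gamma:
  assumes "slist l"
  shows "fst ` set (hds l) =
    (\<lambda>s. (foldr (\<lambda>(x, a). perm_pow G x a) (takeWhile (\<lambda>t. t \<noteq> s) l) (fst s), snd s)) ` set l"
  using assms
proof (induction l)
  case (Cons t l)
  let ?g = "\<lambda>l s. (foldr (\<lambda>(x, a). perm_pow G x a) (takeWhile (\<lambda>t. t \<noteq> s) l) (fst s), snd s)"
  have IH: "fst ` set (hds l) = ?g l ` set l" using Cons by (simp add: slist_Cons)
  have "unres t (?g l s) = ?g (t # l) s" if s: "s \<in> set l" for s
  proof -
    have "?g l s \<in> fst ` set (hds l)" using IH s by auto
    then obtain r where "(?g l s, r) \<in> set (hds l)" by auto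
    then have "adj t (?g l s)" using hds_adj Cons.prems by blast
    moreover have "t \<noteq> s" using s slist_distinct[OF Cons.prems] by auto
    ultimately show ?thesis by (auto simp: unres_def ph_def star_iff split_beta)
  qed
  then have "unres t ` ?g l ` set l = ?g (t # l) ` set l" by (simp add: image_image)
  moreover have "fst ` set (hds (t # l)) = insert t (unres t ` fst ` set (hds l))" by force
  ultimately show ?case using IH by simp
qed simp

end

section \<open>Sorted strata and pilings\<close>

locale ordered_trickle_group = trickle_group G for G :: "('a, 'm) trickle_scheme" +
  fixes T :: "'a rel"
  assumes linear: "linear_order_on (verts G) T"
    and vle_T: "vle G \<subseteq> T"
begin

subsection \<open>Sorted strata\<close>

definition before :: "'a syllable \<Rightarrow> 'a syllable \<Rightarrow> bool" where
  "before s t \<longleftrightarrow> (fst t, fst s) \<in> T \<and> fst t \<noteq> fst s"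

text \<open>Insertion by two filters, so that its computability follows from that of filtering and
  appending.\<close>

definition tins :: "'a syllable \<Rightarrow> 'a syllable list \<Rightarrow> 'a syllable list" where
  "tins s l = filter (\<lambda>t. before t s) l @ s # filter (\<lambda>t. \<not> before t s) l"

definition tsort :: "'a syllable list \<Rightarrow> 'a syllable list" where
  "tsort l = foldr tins l []"

definition slist_sorted :: "'a syllable list \<Rightarrow> bool" where
  "slist_sorted l \<longleftrightarrow> set l \<in> strata G \<and> sorted_wrt before l"

lemma T_facts: "antisym T" "trans T" "total_on V T"
  using linear by (auto simp: linear_order_on_def partial_order_on_def preorder_on_def)

lemma before_trans: "before s t \<Longrightarrow> before t u \<Longrightarrow> before s u"
  using T_facts(1,2) unfolding before_def antisym_def trans_def by metis

lemma before_total: "fst s \<in> V \<Longrightarrow> fst t \<in> V \<Longrightarrow> fst s \<noteq> fst t \<Longrightarrow> before s t \<or> before t s"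
  using T_facts(3) unfolding before_def total_on_def by metis

lemma before_asym: "before s t \<Longrightarrow> \<not> before t s"
  using T_facts(1) unfolding before_def antisym_def by metis

lemma before_not_prec: "before s t \<Longrightarrow> \<not> fst s \<prec> fst t"
  using vle_T T_facts(1) unfolding before_def vless_def antisym_def by auto

lemma sorted_before_unique:
  "sorted_wrt before l \<Longrightarrow> sorted_wrt before l' \<Longrightarrow> set l = set l' \<Longrightarrow> l = l'"
proof (induction l arbitrary: l')
  case (Cons s l)
  then obtain t k where l': "l' = t # k" by (cases l') auto
  have "s \<in> set (t # k)" "t \<in> set (s # l)" using Cons.prems(3) l' by auto
  then have st: "s = t" using Cons.prems(1,2) before_asym[of s t] unfolding l' by auto
  have "s \<notin> set l" "t \<notin> set k" using Cons.prems(1,2) before_asym unfolding l' by fastforce+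
  then have "set l = set k" using Cons.prems(3) st unfolding l' by auto
  then show ?case using Cons.IH[of k] Cons.prems(1,2) st unfolding l' by simp
qed simp

lemma set_tins [simp]: "set (tins s l) = insert s (set l)"
  by (auto simp: tins_def)

lemma set_tsort [simp]: "set (tsort l) = set l"
  by (induction l) (auto simp: tsort_def)

lemma length_tins [simp]: "length (tins s l) = Suc (length l)"
  unfolding tins_def using sum_length_filter_compl[of "\<lambda>t. before t s" l] by simp

lemma length_tsort [simp]: "length (tsort l) = length l"
  by (induction l) (auto simp: tsort_def)

lemma sorted_tins:
  assumes "sorted_wrt before l" "fst ` set l \<subseteq> V" "fst s \<in> V" "fst s \<notin> fst ` set l"
  shows "sorted_wrt before (tins s l)"
proof -
  have "before s t" if "t \<in> set l" "\<not> before t s" for t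
    using before_total[of s t] assms that by force
  then show ?thesis using assms(1)
    by (auto simp: tins_def sorted_wrt_append sorted_wrt_filter intro: before_trans)
qed

lemma sorted_tsort: "distinct (map fst l) \<Longrightarrow> fst ` set l \<subseteq> V \<Longrightarrow> sorted_wrt before (tsort l)"
proof (induction l)
  case (Cons s l)
  have "fst ` set (tsort l) \<subseteq> V" using Cons.prems by auto
  then show ?case using Cons sorted_tins[of "tsort l" s] by (simp add: tsort_def[of "s # l"] flip: tsort_def)
qed (simp add: tsort_def)

lemma sorted_slist: "slist_sorted l \<Longrightarrow> slist l"
proof -
  assume l: "slist_sorted l"
  then have b: "sorted_wrt before l" by (simp add: slist_sorted_def)
  then have "distinct l"
  proof (induction l)
    case (Cons s l)
    then show ?case using before_asym[of s s] by auto
  qed simp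
  moreover have "sorted_wrt (\<lambda>s t. \<not> fst s \<prec> fst t) l"
    using b before_not_prec by (rule sorted_wrt_mono_rel[rotated])
  ultimately show ?thesis using l by (simp add: slist_iff_strata slist_sorted_def)
qed

lemma slist_distinct_fst: "slist l \<Longrightarrow> distinct (map fst l)"
  by (induction l) (auto simp: slist_Cons edge_irrefl)

lemma slist_sorted_tsort: "slist l \<Longrightarrow> set l = set l' \<Longrightarrow> distinct (map fst l') \<Longrightarrow> slist_sorted (tsort l')"
  using slist_iff_strata[of l] sorted_tsort[of l'] slist_V[of l] by (simp add: slist_sorted_def)

lemma stratum_numbering:
  assumes "U \<in> strata G"
  obtains l where "slist_sorted l" "set l = U"
proof -
  have "finite U" using assms by (simp add: strata_def)
  then obtain l where l: "set l = U" "distinct l" using finite_distinct_list by blast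
  have "inj_on fst U" using assms unfolding strata_def inj_on_def by blast
  moreover have "fst ` U \<subseteq> V" using assms syllables_V by (auto simp: strata_def)
  ultimately have "sorted_wrt before (tsort l)" using l sorted_tsort[of l] by (simp add: distinct_map)
  then show ?thesis using that[of "tsort l"] l assms by (simp add: slist_sorted_def)
qed

section \<open>Strata and pilings in terms of lists\<close>

definition numb :: "'a stratum \<Rightarrow> 'a syllable list" where
  "numb U = (SOME ss. numbering G U ss)"

lemma numb: assumes "U \<in> strata G" shows "slist (numb U)" "set (numb U) = U"
proof -
  obtain l where "slist l" "set l = U" using stratum_numbering[OF assms] sorted_slist by metis
  then have "numbering G U l" by (simp add: slist_iff_numbering)
  then have "numbering G U (numb U)" unfolding numb_def by (rule someI)
  then show "slist (numb U)" "set (numb U) = U"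
    using assms by (auto simp: slist_iff_numbering numbering_def)
qed

lemma gamma_hds: "U \<in> strata G \<Longrightarrow> fst ` set (hds (numb U)) = \<gamma> G U ` U"
  using hds_gamma[of "numb U"] numb[of U] by (simp add: \<gamma>_def Let_def flip: numb_def)

lemma omega_eq: assumes "slist l" shows "\<omega> G (set l) = syl_prod l"
proof -
  have U: "set l \<in> strata G" using assms slist_iff_strata by blast
  have "\<omega> G (set l) = syl_prod (numb (set l))"
    by (simp add: \<omega>_def numb_def syl_prod_def Let_def)
  also have "\<dots> = syl_prod l"
    using shuffle_syl_prod slist_shuffle numb[OF U] assms slist_V by metis
  finally show ?thesis .
qed

lemma piling_element_eq:
  "\<forall>l\<in>set p. slist l \<Longrightarrow> piling_element G (map set p) = syl_prod (concat p)"
proof (induction p)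
  case (Cons l p)
  then have "fst ` set (concat p) \<subseteq> V" using slist_V by fastforce
  then show ?case using Cons slist_V[of l]
    by (simp add: piling_element_def omega_eq syl_prod_append)
qed (simp add: piling_element_def syl_prod_Nil)

lemma omega_hat_eq:
  assumes "slist_sorted l"
  shows "\<omega>_hat T (set l) = syl_word l"
proof -
  have "ss = l" if "set ss = set l" "sorted_wrt before ss" for ss
    using that assms sorted_before_unique unfolding slist_sorted_def by blast
  then have "(THE ss. set ss = set l \<and> sorted_wrt before ss) = l"
    using assms by (intro the_equality) (simp_all add: slist_sorted_def)
  then show ?thesis unfolding \<omega>_hat_def syl_word_def before_def[abs_def] by simp
qed

subsection \<open>Adding a syllable to a stratum\<close>

text \<open>At most one syllable of a stratum has the vertex of \<open>h\<close>; the sum is its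
  exponent, or 0 if there is none, so one formula covers both cases of \<open>Radd\<close>.
  Conjugation may disturb the order \<open>T\<close>, hence the final sort.\<close>

definition radd :: "'a syllable list \<Rightarrow> 'a syllable \<Rightarrow> 'a syllable list" where
  "radd l h = (let r = map (res h) (filter (\<lambda>t. fst t \<noteq> fst h) l);
       c = (sum_list (map snd (filter (\<lambda>t. fst t = fst h) l)) + snd h) mod modulus (fst h)
     in tsort (if c = 0 then r else (fst h, c) # r))"

lemma syl_prod_append3:
  assumes "fst ` set u \<subseteq> V" "fst ` set v \<subseteq> V" "fst ` set w \<subseteq> V"
  shows "syl_prod (u @ v @ w) = syl_prod u \<otimes>\<^bsub>Tr G\<^esub> (syl_prod v \<otimes>\<^bsub>Tr G\<^esub> syl_prod w)"
  using assms syl_prod_append[of v w] syl_prod_append[of u "v @ w"] by (simp add: image_Un)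

text \<open>Relative to the vertex \<open>y\<close> of \<open>h\<close>, the stratum is split into
  other vertices not below \<open>y\<close>, the syllable at \<open>y\<close>, and the vertices
  below \<open>y\<close>. In the product, \<open>h\<close> moves left through the last group,
  conjugating it, and merges with the middle; the first group is fixed by conjugation.\<close>

lemma radd:
  assumes l: "slist l" and h: "h \<in> syllables G" and add: "can_addl l h"
  shows "slist_sorted (radd l h)" "syl_prod (radd l h) = syl_prod (l @ [h])"
    "set (radd l h) = Radd G (set l) h" "length (radd l h) \<le> Suc (length l)"
proof -
  obtain y b where hyb: "h = (y, b)" by fastforce
  have y: "y \<in> V" using h hyb syllables_V by fastforce
  have adj: "adj t h" if t: "t \<in> set l" "fst t \<noteq> y" for t
    using add unfolding can_addl_def
  proof
    assume "\<exists>u\<in>set l. fst u = fst h"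
    then obtain u where u: "u \<in> set l" "fst u = y" by (auto simp: hyb)
    then have "adj t u" using slist_adj[OF l t(1) u(1)] t(2) by auto
    then show ?thesis using u by (simp add: hyb)
  qed (use t in blast)
  define l1 mid l2 where "l1 = filter (\<lambda>t. fst t \<noteq> y \<and> \<not> fst t \<prec> y) l"
    and "mid = filter (\<lambda>t. fst t = y) l" and "l2 = filter (\<lambda>t. fst t \<prec> y) l"
  have st: "fst t \<in> star G y" if "t \<in> set l1 \<union> set l2" for t
    using that adj[of t] edge_sym[of "fst t" y] by (auto simp: l1_def l2_def star_iff hyb less_irrefl)
  have ord: "\<not> fst s \<prec> fst t" if "s \<in> set l1" "t \<in> set l2" for s t
    using that less_trans by (auto simp: l1_def l2_def)
  have sl: "slist l1" "slist mid" "slist l2"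
    using l by (auto simp: slist_def l1_def l2_def mid_def sorted_wrt_filter)
  have adj12: "adj s t" if "s \<in> set l1" "t \<in> set l2" for s t
    using that slist_adj[OF l, of s t] by (auto simp: l1_def l2_def)
  have l': "slist (l1 @ mid @ l2)"
  proof -
    have "edge (fst s) y \<and> \<not> fst s \<prec> y" if "s \<in> set l1" for s
      using that adj[of s] by (simp add: l1_def hyb)
    moreover have "edge y (fst t) \<and> \<not> y \<prec> fst t" if "t \<in> set l2" for t
      using that adj[of t] less_asym less_irrefl edge_sym[of y "fst t"] by (auto simp: l2_def hyb)
    moreover have "fst t = y" if "t \<in> set mid" for t using that by (simp add: mid_def)
    ultimately show ?thesis using sl ord adj12 unfolding slist_append set_append by fastforce
  qed
  have setl: "set l = set (l1 @ mid @ l2)" by (auto simp: l1_def l2_def mid_def)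
  have mid: "mid = [] \<or> (\<exists>a. mid = [(y, a)])"
  proof (cases mid rule: remdups_adj.cases)
    case (2 t)
    then have "t \<in> set mid" by simp
    then have "fst t = y" by (simp add: mid_def)
    then show ?thesis using 2 by (cases t) simp
  next
    case (3 s t k)
    then have "s \<in> set mid" "t \<in> set mid" by simp_all
    then have "fst s = y" "fst t = y" by (simp_all add: mid_def)
    then show ?thesis using 3 sl(2) edge_irrefl by (simp add: slist_Cons)
  qed simp
  define a where "a = sum_list (map snd mid)"
  define c where "c = (a + b) mod modulus y"
  define m' where "m' = (if c = 0 then [] else [(y, c)])"
  \<comment> \<open>The resulting stratum in the order in which the product produces it.\<close>
  define N where "N = map (res h) l1 @ m' @ map (res h) l2"
  have V: "fst ` set l1 \<subseteq> V" "fst ` set mid \<subseteq> V" "fst ` set l2 \<subseteq> V"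
    using slist_V sl by blast+
  have rl1: "map (res h) l1 = l1"
    using y by (intro map_idI res_fix) (auto simp: l1_def hyb)
  have rV: "fst ` set (map (res h) l2) \<subseteq> V" using V(3) y ph_V by (auto simp: res_def hyb)
  have m'V: "fst ` set m' \<subseteq> V" using y by (simp add: m'_def)
  have m': "m' \<noteq> [] \<Longrightarrow> m' = [(y, c)] \<and> (y, c) \<in> syllables G"
    using y by (auto simp: m'_def c_def syllables_iff split: if_splits)
  have res_slist: "slist (map (res h) k)" if "slist k" "set k \<subseteq> set l1 \<union> set l2" for k
  proof -
    have "adj (res h s) (res h t) \<and> \<not> fst (res h s) \<prec> fst (res h t)"
      if "s \<in> set k" "t \<in> set k" "adj s t \<and> \<not> fst s \<prec> fst t" for s t
    proof -
      have "fst s \<in> star G y" "fst t \<in> star G y" using that \<open>set k \<subseteq> _\<close> st by blast+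
      then show ?thesis using that(3) ph_edge[OF y] ph_less[OF y] by (simp add: res_def hyb)
    qed
    then have "sorted_wrt (\<lambda>s t. adj (res h s) (res h t) \<and> \<not> fst (res h s) \<prec> fst (res h t)) k"
      using that(1) unfolding slist_def by (auto intro: sorted_wrt_mono_rel[rotated])
    moreover have "res h s \<in> syllables G" if "s \<in> set k" for s
      using that \<open>slist k\<close> syllable_ph[OF y, of "- b" "fst s" "snd s"] by (auto simp: slist_def res_def hyb)
    ultimately show ?thesis by (auto simp: slist_def sorted_wrt_map)
  qed
  have "slist (map (res h) (l1 @ l2))"
    by (rule res_slist) (use sl ord adj12 in \<open>auto simp: slist_append\<close>)
  then have sl12: "slist (map (res h) l1 @ map (res h) l2)" by simp
  have ac: "adj (res h s) (y, c)" if "s \<in> set (l1 @ l2)" for s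
  proof -
    have "fst s \<noteq> y" "s \<in> set l" using that by (auto simp: l1_def l2_def less_irrefl)
    then show ?thesis using adj[of s] ph_edge_self[OF y] edge_sym by (simp add: res_def hyb)
  qed
  have nc1: "\<not> fst (res h s) \<prec> y" if "s \<in> set l1" for s
    using that ph_less_self[OF y] by (simp add: l1_def res_def hyb)
  have nc2: "\<not> y \<prec> fst (res h s)" if "s \<in> set l2" for s
    using that self_less_ph[OF y] less_asym by (simp add: l2_def res_def hyb)
  have N: "slist N"
  proof (cases "m' = []")
    case True
    then show ?thesis using sl12 by (simp add: N_def)
  next
    case False
    let ?c = "(y, c)"
    have "m' = [?c]" "slist [?c]" using m'[OF False] by (auto simp: slist_Cons)
    moreover have "\<forall>s\<in>set (map (res h) l1). adj s ?c \<and> \<not> fst s \<prec> y"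
      using ac nc1 by auto
    moreover have "\<forall>s\<in>set (map (res h) l2). adj ?c s \<and> \<not> y \<prec> fst s"
      using ac[THEN adj_sym] nc2 by auto
    ultimately show ?thesis using sl12 by (auto simp: N_def slist_append slist_Cons)
  qed
  have mb: "syl_prod (mid @ [h]) = syl_prod m'"
  proof -
    have "syl_prod (mid @ [h]) = gen y [^]\<^bsub>Tr G\<^esub> (a + b)"
      using mid
    proof (elim disjE exE)
      fix a' assume "mid = [(y, a')]"
      then show ?thesis using y by (simp add: hyb a_def syl_prod_Cons syl_prod_Nil Tr.int_pow_mult)
    qed (use y in \<open>simp add: hyb a_def syl_prod_Cons syl_prod_Nil\<close>)
    also have "\<dots> = syl_prod m'"
    proof (cases "c = 0")
      case True
      then show ?thesis
        using gen_modulus[OF y, of "a + b", folded c_def] by (simp add: m'_def syl_prod_Nil)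
    next
      case False
      then show ?thesis using gen_modulus[OF y, of "a + b", folded c_def] y
        by (simp add: m'_def syl_prod_Cons syl_prod_Nil)
    qed
    finally show ?thesis .
  qed
  have "syl_prod (l @ [h]) = syl_prod ((l1 @ mid) @ (l2 @ [h]))"
    using shuffle_append[OF slist_shuffle[OF l l' setl] shuffle_refl[of "[h]"]] shuffle_syl_prod
      slist_V[OF l] y by (simp add: hyb)
  also have "\<dots> = syl_prod (l1 @ mid) \<otimes>\<^bsub>Tr G\<^esub> syl_prod (l2 @ [h])"
    using V y by (intro syl_prod_append) (auto simp: hyb)
  also have "l2 @ h # [] \<approx> h # map (res h) l2 @ []"
  proof (intro shuffle_commuting ballI)
    fix t assume "t \<in> set l2"
    then have "t \<in> set l" "fst t \<prec> y" by (auto simp: l2_def)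
    then show "adj t h \<and> \<not> fst h \<prec> fst t"
      using adj[of t] less_asym less_irrefl by (auto simp: hyb)
  qed
  then have "syl_prod (l2 @ [h]) = syl_prod (h # map (res h) l2)"
    using shuffle_syl_prod V y by (auto simp: hyb)
  also have "syl_prod (l1 @ mid) \<otimes>\<^bsub>Tr G\<^esub> syl_prod (h # map (res h) l2)
      = syl_prod ((l1 @ mid) @ (h # map (res h) l2))"
    using V y rV by (intro syl_prod_append[symmetric]) (auto simp: hyb)
  also have "(l1 @ mid) @ (h # map (res h) l2) = l1 @ (mid @ [h]) @ map (res h) l2" by simp
  also have "syl_prod \<dots> = syl_prod l1 \<otimes>\<^bsub>Tr G\<^esub> (syl_prod (mid @ [h]) \<otimes>\<^bsub>Tr G\<^esub> syl_prod (map (res h) l2))"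
    using V y rV by (intro syl_prod_append3) (auto simp: hyb)
  also have "\<dots> = syl_prod l1 \<otimes>\<^bsub>Tr G\<^esub> (syl_prod m' \<otimes>\<^bsub>Tr G\<^esub> syl_prod (map (res h) l2))"
    using mb by simp
  also have "\<dots> = syl_prod N"
    unfolding N_def rl1 using V y rV m'V by (intro syl_prod_append3[symmetric]) auto
  finally have prodN: "syl_prod (l @ [h]) = syl_prod N" .
  \<comment> \<open>\<open>radd\<close> keeps the order of \<open>l\<close> and sorts afterwards; it
    has the same set as \<open>N\<close>, and the product of a stratum does not depend on the
    order.\<close>
  define r where "r = map (res h) (filter (\<lambda>t. fst t \<noteq> fst h) l)"
  have ra: "radd l h = tsort (m' @ r)"
    by (simp add: radd_def Let_def r_def m'_def c_def a_def mid_def hyb)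
  have setr: "set r = res h ` (set l1 \<union> set l2)"
    by (auto simp: r_def l1_def l2_def hyb less_irrefl)
  have setN: "set N = set (m' @ r)" by (auto simp: N_def setr)
  have "distinct (map fst (filter (\<lambda>t. fst t \<noteq> fst h) l))"
    using slist_distinct_fst[OF l] by (simp add: distinct_map_filter)
  moreover have "map fst r = map (ph y (- b)) (map fst (filter (\<lambda>t. fst t \<noteq> fst h) l))"
    by (simp add: r_def res_def hyb)
  ultimately have "distinct (map fst r)"
    using ph_inj[OF y] by (simp add: distinct_map[of "ph y (- b)"] inj_on_def del: map_map)
  moreover have "y \<notin> fst ` set r"
  proof
    assume "y \<in> fst ` set r"
    then obtain x where "y = ph y (- b) x" "x \<noteq> y" by (auto simp: r_def res_def hyb)
    then show False using ph_inj[OF y, of "- b" x y] ph_self[OF y] by simp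
  qed
  ultimately have "distinct (map fst (m' @ r))" by (auto simp: m'_def)
  then show s: "slist_sorted (radd l h)" using slist_sorted_tsort[OF N setN] ra by simp
  show "syl_prod (radd l h) = syl_prod (l @ [h])"
    unfolding prodN using sorted_slist[OF s] N setN ra slist_shuffle shuffle_syl_prod slist_V
    by (metis set_tsort)
  have "length r \<le> length l" by (simp add: r_def)
  then show "length (radd l h) \<le> Suc (length l)" by (simp add: ra m'_def)
  have rest: "{(perm_pow G y (- b) x, a) | x a. (x, a) \<in> set l \<and> x \<noteq> y} = set r" (is "?A = _")
  proof -
    have "?A = (\<lambda>(x, a). (perm_pow G y (- b) x, a)) ` {t \<in> set l. fst t \<noteq> y}" by force
    also have "\<dots> = res h ` {t \<in> set l. fst t \<noteq> y}"
      using adj edge_sym by (intro image_cong) (auto simp: res_def hyb ph_def star_iff)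
    finally show ?thesis by (simp add: r_def hyb)
  qed
  show "set (radd l h) = Radd G (set l) h"
  proof (cases "mid = []")
    case True
    then have n: "y \<notin> supp (set l)" by (auto simp: mid_def filter_empty_conv supp_def)
    have "c = b" "b \<noteq> 0" using h by (auto simp: c_def a_def True hyb syllables_iff)
    then show ?thesis using n rest unfolding ra by (simp add: Radd_def Let_def hyb m'_def)
  next
    case False
    then obtain a' where a': "mid = [(y, a')]" using mid by blast
    then have "(y, a') \<in> set mid" by simp
    then have ya: "(y, a') \<in> set l" by (simp add: mid_def)
    then have "(THE a. (y, a) \<in> set l) = a'" using slist_vertex_unique[OF l] by blast
    moreover have "y \<in> supp (set l)" using ya by (force simp: supp_def)
    moreover have "a' \<otimes>\<^bsub>Zlab (label G y)\<^esub> b = c"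
      by (simp add: c_def a_def a' Zlab_def modulus_def split: enat.split)
    ultimately show ?thesis using rest unfolding ra by (simp add: Radd_def Let_def hyb m'_def)
  qed
qed

subsection \<open>Normalising pilings\<close>

text \<open>Applies at most one rule at the front: it drops an empty stratum or moves the first
  movable head of the next stratum.\<close>

definition norm_cons :: "'a syllable list \<Rightarrow> 'a syllable list list \<Rightarrow> 'a syllable list list" where
  "norm_cons l q = (if l = [] then q else case q of [] \<Rightarrow> [l] | k # q' \<Rightarrow>
     (case filter (\<lambda>hr. can_addl l (fst hr)) (hds k) of [] \<Rightarrow> l # q
      | hr # _ \<Rightarrow> radd l (fst hr) # snd hr # q'))"

text \<open>The fold works from the back, so each stratum meets a tail that has already been
  treated.\<close>

definition pass :: "'a syllable list list \<Rightarrow> 'a syllable list list" where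
  "pass p = foldr norm_cons p []"

definition good :: "'a syllable list list \<Rightarrow> bool" where
  "good p \<longleftrightarrow> (\<forall>l\<in>set p. slist_sorted l)"

definition psize :: "'a syllable list list \<Rightarrow> nat" where
  "psize p = length (concat p)"

text \<open>\<open>weight p\<close> is the number of strata plus the sum, over all syllables, of the number of strata in
  front of it.\<close>

fun weight :: "'a syllable list list \<Rightarrow> nat" where
  "weight [] = 0"
| "weight (l # p) = Suc (psize p + weight p)"

lemma good_V: "good p \<Longrightarrow> fst ` set (concat p) \<subseteq> V"
  using sorted_slist slist_V unfolding good_def by fastforce

text \<open>A moved syllable leaves the part behind \<open>l\<close>, which lowers the weight by
  one. The bound on \<open>psize\<close> is needed because the weight of a longer piling counts the
  syllables behind each stratum.\<close>

lemma norm_cons: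
  assumes g: "good (l # q)"
  shows "good (norm_cons l q)" "syl_prod (concat (norm_cons l q)) = syl_prod (concat (l # q))"
    "psize (norm_cons l q) \<le> psize (l # q)"
    "weight (norm_cons l q) < weight (l # q) \<or> (norm_cons l q = l # q \<and>
      l \<noteq> [] \<and> (case q of [] \<Rightarrow> True | k # _ \<Rightarrow> \<forall>h\<in>fst ` set (hds k). \<not> can_addl l h))"
proof -
  have "good (norm_cons l q) \<and> syl_prod (concat (norm_cons l q)) = syl_prod (concat (l # q)) \<and>
    psize (norm_cons l q) \<le> psize (l # q) \<and>
    (weight (norm_cons l q) < weight (l # q) \<or> (norm_cons l q = l # q \<and>
      l \<noteq> [] \<and> (case q of [] \<Rightarrow> True | k # _ \<Rightarrow> \<forall>h\<in>fst ` set (hds k). \<not> can_addl l h)))"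
  proof (cases "l = [] \<or> q = [] \<or> filter (\<lambda>hr. can_addl l (fst hr)) (hds (hd q)) = []")
    case True
    then show ?thesis using g
      by (cases q) (auto simp: norm_cons_def good_def psize_def filter_empty_conv)
  next
    case False
    then obtain k q' h r hs where q: "q = k # q'" and l: "l \<noteq> []"
      and hs: "filter (\<lambda>hr. can_addl l (fst hr)) (hds k) = (h, r) # hs"
      by (cases q) (auto simp: neq_Nil_conv)
    have nc: "norm_cons l q = radd l h # r # q'" using l q hs by (simp add: norm_cons_def)
    have "(h, r) \<in> set (filter (\<lambda>hr. can_addl l (fst hr)) (hds k))" by (simp add: hs)
    then have hr: "(h, r) \<in> set (hds k)" and add: "can_addl l h" by auto
    have sl: "slist l" "slist k" "slist_sorted k" and q': "good q'"
      using g sorted_slist by (auto simp: good_def q)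
    note hk = hds_slist[OF sl(2) hr] and hset = hds_set[OF hr]
    note ra = radd[OF sl(1) hk(2) add]
    have "sorted_wrt before r" using hds_sorted[OF hr] sl(3) by (simp add: slist_sorted_def)
    then have "slist_sorted r" using hk(1) slist_iff_strata by (simp add: slist_sorted_def)
    then have good: "good (norm_cons l q)" using ra(1) q' by (simp add: nc good_def)
    have V: "fst ` set l \<subseteq> V" "fst ` set [h] \<subseteq> V" "fst ` set r \<subseteq> V" "fst ` set k \<subseteq> V"
      "fst ` set (concat q') \<subseteq> V" "fst ` set (radd l h) \<subseteq> V" "fst ` set (h # r) \<subseteq> V"
      using slist_V sl hk syllables_V good_V[OF q'] sorted_slist[OF ra(1)] by auto
    have "syl_prod k = syl_prod (h # r)" using shuffle_syl_prod[OF hk(3) V(4)] .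
    also have "\<dots> = syl_prod [h] \<otimes>\<^bsub>Tr G\<^esub> syl_prod r" using syl_prod_append[OF V(2,3)] by simp
    finally have kp: "syl_prod k = syl_prod [h] \<otimes>\<^bsub>Tr G\<^esub> syl_prod r" .
    have "syl_prod (radd l h @ r @ concat q') = (syl_prod l \<otimes>\<^bsub>Tr G\<^esub> syl_prod [h]) \<otimes>\<^bsub>Tr G\<^esub>
        (syl_prod r \<otimes>\<^bsub>Tr G\<^esub> syl_prod (concat q'))"
      using syl_prod_append3[OF V(6,3,5)] ra(2) syl_prod_append[OF V(1,2)] by simp
    also have "\<dots> = syl_prod l \<otimes>\<^bsub>Tr G\<^esub> (syl_prod k \<otimes>\<^bsub>Tr G\<^esub> syl_prod (concat q'))"
      unfolding kp using V(1,2,3,5)[THEN syl_prod_closed] by (simp only: Tr.m_assoc Tr.m_closed)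
    also have "\<dots> = syl_prod (l @ k @ concat q')" using syl_prod_append3[OF V(1,4,5)] by simp
    finally have "syl_prod (concat (norm_cons l q)) = syl_prod (concat (l # q))"
      unfolding nc by (simp add: q)
    then show ?thesis using good hset ra(4) unfolding nc by (simp add: q psize_def)
  qed
  then show "good (norm_cons l q)" "syl_prod (concat (norm_cons l q)) = syl_prod (concat (l # q))"
    "psize (norm_cons l q) \<le> psize (l # q)"
    "weight (norm_cons l q) < weight (l # q) \<or> (norm_cons l q = l # q \<and>
      l \<noteq> [] \<and> (case q of [] \<Rightarrow> True | k # _ \<Rightarrow> \<forall>h\<in>fst ` set (hds k). \<not> can_addl l h))"
    by blast+
qed

lemma pass_Cons: "pass (l # p) = norm_cons l (pass p)"
  by (simp add: pass_def)

text \<open>If no position changes, then no head can be moved anywhere and the piling is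
  irreducible; otherwise the weight drops. This makes the weight a bound for the number of
  passes.\<close>

lemma pass:
  assumes "good p"
  shows "good (pass p) \<and> syl_prod (concat (pass p)) = syl_prod (concat p) \<and> psize (pass p) \<le> psize p \<and>
    (weight (pass p) < weight p \<or> (pass p = p \<and> irr p))"
  using assms
proof (induction p)
  case (Cons l p)
  then have g: "good (l # pass p)" and l: "slist_sorted l" "slist l" and p: "good p" and
    IH: "good (pass p) \<and> syl_prod (concat (pass p)) = syl_prod (concat p) \<and> psize (pass p) \<le> psize p \<and>
    (weight (pass p) < weight p \<or> (pass p = p \<and> irr p))"
    using sorted_slist by (auto simp: good_def)
  note nc = norm_cons[OF g]
  have "syl_prod (concat (l # pass p)) = syl_prod (concat (l # p))"
    using IH slist_V[OF l(2)] good_V[OF p] good_V[of "pass p"] by (simp add: syl_prod_append)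
  moreover have "psize (l # pass p) \<le> psize (l # p)" using IH by (simp add: psize_def)
  moreover have "weight (norm_cons l (pass p)) < weight (l # p) \<or>
      (norm_cons l (pass p) = l # p \<and> irr (l # p))"
    using nc(4)
  proof (elim disjE conjE)
    assume "weight (norm_cons l (pass p)) < weight (l # pass p)"
    moreover have "weight (l # pass p) \<le> weight (l # p)" using IH by auto
    ultimately show ?thesis by linarith
  next
    assume *: "norm_cons l (pass p) = l # pass p" "l \<noteq> []"
      "case pass p of [] \<Rightarrow> True | k # _ \<Rightarrow> \<forall>h\<in>fst ` set (hds k). \<not> can_addl l h"
    show ?thesis
    proof (cases "pass p = p \<and> irr p")
      case True
      then have "irr (l # p)" unfolding irr.simps using * l(2) by metis
      then show ?thesis using * True by simp
    next
      case False
      then have "weight (pass p) < weight p" "psize (pass p) \<le> psize p" using IH by auto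
      then show ?thesis using *(1) by simp
    qed
  qed
  ultimately show ?case using nc(1,2,3) by (auto simp: pass_Cons)
qed (simp add: pass_def syl_prod_Nil)

lemma pass_funpow:
  assumes "good p" "weight p \<le> n"
  shows "good ((pass ^^ n) p) \<and> irr ((pass ^^ n) p) \<and>
    syl_prod (concat ((pass ^^ n) p)) = syl_prod (concat p)"
  using assms
proof (induction n arbitrary: p)
  case 0
  then show ?case using pass[of p] by auto
next
  case (Suc n)
  have p: "good (pass p)" "syl_prod (concat (pass p)) = syl_prod (concat p)" using pass Suc.prems by auto
  show ?case
  proof (cases "weight (pass p) \<le> n")
    case True
    then show ?thesis using Suc.IH[OF p(1) True] p(2) by (simp add: funpow_Suc_right del: funpow.simps)
  next
    case False
    then have fp: "pass p = p" "irr p" using pass[OF Suc.prems(1)] Suc.prems(2) by auto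
    then have "(pass ^^ Suc n) p = p" by (induction n) auto
    then show ?thesis using fp Suc.prems by simp
  qed
qed

section \<open>The piling of a word and the number of passes\<close>

definition letter_syl :: "'a + 'a \<Rightarrow> 'a syllable" where
  "letter_syl l = (case l of Inl x \<Rightarrow> (x, 1) | Inr x \<Rightarrow> (x, (- 1) mod modulus x))"

definition initial :: "'a word \<Rightarrow> 'a syllable list list" where
  "initial w = map (\<lambda>l. [letter_syl l]) w"

text \<open>Initially every letter forms its own stratum, so \<open>weight_initial\<close> bounds
  the weight quadratically. The fixed number of passes avoids an unbounded search, and surplus
  passes change nothing.\<close>

definition normalise :: "'a word \<Rightarrow> 'a word" where
  "normalise w = syl_word (concat ((pass ^^ (length w * Suc (length w))) (initial w)))"

lemma modulus_cases: "x \<in> V \<Longrightarrow> modulus x = 0 \<or> modulus x \<ge> 2"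
  using label_ge[of x] by (cases "label G x") (auto simp: modulus_def numeral_eq_enat)

lemma letter_syl_syllables: "l \<in> Inl ` V \<union> Inr ` V \<Longrightarrow> letter_syl l \<in> syllables G"
proof -
  have "(x, 1) \<in> syllables G \<and> (x, (- 1) mod modulus x) \<in> syllables G" if "x \<in> V" for x
    using modulus_cases[OF that] that by (auto simp: syllables_iff zmod_minus1)
  then show "l \<in> Inl ` V \<union> Inr ` V \<Longrightarrow> letter_syl l \<in> syllables G" by (auto simp: letter_syl_def)
qed

lemma good_initial: "w \<in> words_over V \<Longrightarrow> good (initial w)"
  using letter_syl_syllables
  by (induction w) (auto simp: good_def initial_def slist_sorted_def strata_def)

lemma psize_initial: "psize (initial w) = length w"
  by (induction w) (auto simp: psize_def initial_def)

lemma weight_initial: "weight (initial w) \<le> length w * Suc (length w)"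
proof (induction w)
  case (Cons l w)
  then show ?case using psize_initial[of w] by (simp add: initial_def)
qed (simp add: initial_def)

lemma prod_initial: "w \<in> words_over V \<Longrightarrow> syl_prod (concat (initial w)) = element G w"
proof (induction w)
  case (Cons l w)
  then have w: "w \<in> words_over V" and l: "l \<in> Inl ` V \<union> Inr ` V" by auto
  have "syl_prod (concat (initial (l # w))) = syl_prod ([letter_syl l] @ concat (initial w))"
    by (simp add: initial_def)
  also have "\<dots> = syl_prod [letter_syl l] \<otimes>\<^bsub>Tr G\<^esub> element G w"
    using good_V[OF good_initial[OF w]] syllables_V[OF letter_syl_syllables[OF l]] Cons.IH[OF w]
    by (subst syl_prod_append) auto
  also have "syl_prod [letter_syl l] = element G [l]"
    using l gen_modulus[of _ "- 1"]
    by (auto simp: letter_syl_def syl_prod_Cons syl_prod_Nil element_Inr Tr.int_pow_neg)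
  also have "\<dots> \<otimes>\<^bsub>Tr G\<^esub> element G w = element G ([l] @ w)"
    using l w by (subst element_append) auto
  finally show ?case by simp
qed (simp add: initial_def syl_prod_Nil element_Nil)

subsection \<open>Normal forms\<close>

lemma irr_irreducible:
  assumes "irr p"
  shows "irreducible_piling G (map set p)"
proof -
  have "irr p \<Longrightarrow> set (map set p) \<subseteq> strata G"
    by (induction p) (auto simp: slist_iff_strata)
  moreover have "\<not> sublist u (map set p)" if uv: "(u, v) \<in> rules G" for u v
    using assms
  proof (induction p)
    case Nil
    then show ?case using uv by (auto simp: rules_def rules1_def)
  next
    case (Cons l p)
    have "\<not> prefix u (map set (l # p))"
    proof
      assume pre: "prefix u (map set (l # p))"
      show False
        using uv unfolding rules_def
      proof
        assume "(u, v) \<in> rules1 G"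
        then obtain U W s where *: "u = [U, W]" "U \<in> strata G" "W \<in> strata G" "s \<in> W"
          "can_add G U (\<gamma> G W s)" unfolding rules1_def by blast
        then obtain k q where p: "p = k # q" "U = set l" "W = set k" using pre by (cases p) auto
        then have k: "slist k" using Cons.prems by simp
        have "\<gamma> G W s \<in> fst ` set (hds (numb W))" using gamma_hds * by blast
        \<comment> \<open>\<open>\<gamma>\<close> uses a selected numbering of \<open>W\<close>,
          while \<open>k\<close> is possibly another one. The two words are shuffles of each other
          and so have the same heads.\<close>
        moreover have "numb W \<approx> k" using slist_shuffle numb * p k by simp
        ultimately have "\<gamma> G W s \<in> fst ` set (hds k)"
          using hds_iff numb(1)[OF *(3)] k shuffle_sym shuffle_trans by meson
        then show False using *(5) p Cons.prems can_addl_iff by auto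
      next
        assume "(u, v) \<in> {([{}], [])}"
        then show False using pre Cons.prems by simp
      qed
    qed
    then show ?case using Cons by (simp add: sublist_Cons_right)
  qed
  ultimately show ?thesis using assms by (auto simp: irreducible_piling_def)
qed

lemma irreducible_irr:
  assumes "irreducible_piling G P"
  shows "irr (map numb P)"
  using assms
proof (induction P)
  case (Cons U P)
  have st: "U \<in> strata G" "P \<in> lists (strata G)"
    and n: "\<And>u v. (u, v) \<in> rules G \<Longrightarrow> \<not> sublist u (U # P)"
    using Cons.prems by (auto simp: irreducible_piling_def)
  have "irreducible_piling G P"
    using st n unfolding irreducible_piling_def by (auto simp: sublist_Cons_right)
  then have IH: "irr (map numb P)" by (rule Cons.IH)
  have "([{}], []) \<in> rules G" by (simp add: rules_def)
  then have "\<not> prefix [{}] (U # P)" using n by (meson prefix_imp_sublist)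
  then have "numb U \<noteq> []" using numb(2)[OF st(1)] by auto
  moreover have "\<not> can_addl (numb U) h" if W: "P = W # Q" and h: "h \<in> fst ` set (hds (numb W))" for W Q h
  proof
    assume add: "can_addl (numb U) h"
    have Ws: "W \<in> strata G" using st W by simp
    obtain s where s: "s \<in> W" "h = \<gamma> G W s" using gamma_hds[OF Ws] h by auto
    have "h \<in> syllables G" using hds_slist(2) numb(1)[OF Ws] h by fastforce
    note ra = radd[OF numb(1)[OF st(1)] this add]
    \<comment> \<open>Membership in \<open>rules1\<close> also demands that the right-hand side
      consists of strata.\<close>
    have "Radd G U h \<in> strata G"
      using ra(1,3) numb(2)[OF st(1)] by (simp add: slist_sorted_def)
    moreover have "Lrem W s \<in> strata G" using Ws by (auto simp: strata_def Lrem_def)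
    moreover have "can_add G U h" using add can_addl_iff numb(2)[OF st(1)] by simp
    ultimately have "([U, W], [Radd G U h, Lrem W s]) \<in> rules G"
      using s st Ws unfolding rules_def rules1_def by blast
    then have "\<not> sublist [U, W] (U # W # Q)" using n W by blast
    then show False by (simp add: sublist_Cons_right)
  qed
  ultimately show ?case using IH numb(1)[OF st(1)] by (cases P) auto
qed simp

text \<open>Takes the place of confluence: equal elements give reduced words that are shuffles of
  each other, and these determine the strata.\<close>

lemma irreducible_unique:
  assumes "irreducible_piling G P" "irreducible_piling G Q" "piling_element G P = piling_element G Q"
  shows "P = Q"
proof -
  have *: "irr (map numb P) \<and> map set (map numb P) = P \<and>
      piling_element G P = syl_prod (concat (map numb P))" if "irreducible_piling G P" for P
  proof -
    have i: "irr (map numb P)" and st: "set P \<subseteq> strata G"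
      using irreducible_irr that by (auto simp: irreducible_piling_def)
    then have m: "map set (map numb P) = P" using numb(2) unfolding map_map by (intro map_idI) auto
    have "\<forall>l\<in>set (map numb P). slist l" using st numb(1) by auto
    from piling_element_eq[OF this] show ?thesis using i m by simp
  qed
  show ?thesis using irr_unique[of "map numb P" "map numb Q"] *[of P] *[of Q] assms by metis
qed

theorem nf_normalise:
  assumes w: "w \<in> words_over V"
  shows "nf G T (element G w) = normalise w" "element G (normalise w) = element G w"
    "normalise w \<in> words_over V"
proof -
  define p where "p = (pass ^^ (length w * Suc (length w))) (initial w)"
  have p: "good p" "irr p" "syl_prod (concat p) = element G w"
    using pass_funpow[OF good_initial[OF w] weight_initial] prod_initial[OF w] by (auto simp: p_def)
  have "\<forall>l\<in>set p. slist l" using p(1) sorted_slist by (simp add: good_def)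
  then have pe: "piling_element G (map set p) = element G w" using piling_element_eq p(3) by simp
  \<comment> \<open>The passes provide existence, and \<open>irreducible_unique\<close> makes the
    description definite.\<close>
  have "(THE q. irreducible_piling G q \<and> piling_element G q = element G w) = map set p"
    using irr_irreducible[OF p(2)] pe irreducible_unique by (intro the_equality) auto
  then have "nf G T (element G w) = concat (map (\<omega>_hat T) (map set p))" by (simp add: nf_def)
  also have "\<dots> = concat (map syl_word p)"
    using p(1) omega_hat_eq by (auto simp: good_def intro!: arg_cong[of _ _ concat])
  also have "\<dots> = normalise w"
    unfolding normalise_def p_def[symmetric] by (induction p) (auto simp: syl_word_append syl_word_def)
  finally show "nf G T (element G w) = normalise w" .
  show "normalise w \<in> words_over V" "element G (normalise w) = element G w"
    unfolding normalise_def p_def[symmetric]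
    using syl_word_words[OF good_V[OF p(1)]] syl_prod_word[OF good_V[OF p(1)]] p(3) by auto
qed

lemma normal_forms_nf: "normal_forms G (nf G T ` carrier (Tr G))"
proof -
  have *: "nf G T g \<in> words_over V \<and> element G (nf G T g) = g" if "g \<in> carrier (Tr G)" for g
    using that nf_normalise by (auto simp: carrier_Tr)
  show ?thesis
    unfolding normal_forms_def trickle_words_def
  proof (intro conjI ballI)
    show "nf G T ` carrier (Tr G) \<subseteq> words_over V" using * by blast
    fix g assume g: "g \<in> carrier (Tr G)"
    show "\<exists>!w. w \<in> nf G T ` carrier (Tr G) \<and> element G w = g"
      by (rule ex1I[of _ "nf G T g"]) (use * g in auto)
  qed
qed

lemma normalise_Nil_iff:
  assumes "w \<in> words_over V"
  shows "normalise w = [] \<longleftrightarrow> element G w = \<one>\<^bsub>Tr G\<^esub>"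
proof
  assume "normalise w = []"
  then show "element G w = \<one>\<^bsub>Tr G\<^esub>" using nf_normalise(2)[OF assms] element_Nil by simp
next
  assume "element G w = \<one>\<^bsub>Tr G\<^esub>"
  then have "normalise w = normalise []"
    using nf_normalise(1)[OF assms] nf_normalise(1)[of "[]"] element_Nil by simp
  then show "normalise w = []" by (simp add: normalise_def initial_def syl_word_def)
qed

end

section \<open>The algorithm\<close>

locale finite_trickle_group = ordered_trickle_group G T
  for G :: "('a, 'm) trickle_scheme" and T :: "'a rel" +
  fixes e :: "'a \<Rightarrow> nat"
  assumes finite_V: "finite (verts G)" and inj_e: "inj_on e (verts G)"
begin

section \<open>Encoding of vertices and computability of the operations\<close>

definition vE :: "'a encoding" where "vE = (V, e)"

definition letterE :: "('a + 'a) encoding" where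
  "letterE = (Inl ` V \<union> Inr ` V, \<lambda>l. sum_encode (map_sum e e l))"

abbreviation sylE :: "'a syllable encoding" where "sylE \<equiv> prodE vE intE"

lemma finite_codes:
  "finite (fst vE)" "inj_on (snd vE) (fst vE)" "finite (fst letterE)" "inj_on (snd letterE) (fst letterE)"
  "finite (fst (prodE vE vE))" "inj_on (snd (prodE vE vE)) (fst (prodE vE vE))"
proof -
  show v: "finite (fst vE)" "inj_on (snd vE) (fst vE)"
    using finite_V inj_e by (simp_all add: vE_def)
  show "finite (fst letterE)" using finite_V by (simp add: letterE_def)
  show "finite (fst (prodE vE vE))" using v by (simp add: prodE_def)
  show "inj_on (snd letterE) (fst letterE)"
    by (rule inj_onI) (auto simp: letterE_def sum_encode_eq dest: inj_onD[OF inj_e])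
  show "inj_on (snd (prodE vE vE)) (fst (prodE vE vE))"
    by (rule inj_onI) (auto simp: prodE_def dest: inj_onD[OF v(2)])
qed

lemma computable_vertex_table: "(\<And>x. x \<in> V \<Longrightarrow> f x \<in> fst E) \<Longrightarrow> computable vE E f"
  by (rule computable_finite[OF finite_codes(1,2)]) (simp add: vE_def)

lemma computable_vertex_table2:
  "computable D vE f \<Longrightarrow> computable D vE g \<Longrightarrow> (\<And>x y. x \<in> V \<Longrightarrow> y \<in> V \<Longrightarrow> F x y \<in> fst E) \<Longrightarrow>
    computable D E (\<lambda>d. F (f d) (g d))"
  by (rule computable_comp2[of vE vE], rule computable_finite[OF finite_codes(5,6)])
    (auto simp: vE_def prodE_def)

text \<open>The exponent ranges over infinitely many integers, so only \<phi>_x and its inverse are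
  tabulated. They are iterated \<open>nat a\<close> and \<open>nat (- a)\<close> times, at least one
  of which is 0.\<close>

lemma computable_ph:
  assumes x: "computable D vE x" and a: "computable D intE a" and y: "computable D vE y"
  shows "computable D vE (\<lambda>d. ph (x d) (a d) (y d))"
proof -
  have f: "(ph x i ^^ n) y = ph x (int n * i) y" if "x \<in> V" for x y i n
    using that by (induction n) (auto simp: ph_0 distrib_right simp flip: ph_add)
  have step: "computable (prodE D vE) vE (\<lambda>z. ph (x (fst z)) i (snd z))" for i
    by (rule computable_vertex_table2[where F = "\<lambda>x y. ph x i y"] computable_comp[OF x] computable_proj)+
      (simp add: vE_def ph_V)
  have "computable D vE (\<lambda>d. (ph (x d) 1 ^^ nat (a d)) ((ph (x d) (- 1) ^^ nat (- a d)) (y d)))"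
    by (rule computable_funpow computable_int_nat a step y)+
  then show ?thesis
  proof (rule computable_cong)
    fix d assume "d \<in> fst D"
    then have V: "x d \<in> V" using computable_carrier[OF x] by (simp add: vE_def)
    show "(ph (x d) 1 ^^ nat (a d)) ((ph (x d) (- 1) ^^ nat (- a d)) (y d)) = ph (x d) (a d) (y d)"
      using V by (simp add: f flip: ph_add)
  qed
qed

lemma computable_modulus:
  assumes x: "computable D vE x" and a: "computable D intE a"
  shows "computable D intE (\<lambda>d. a d mod modulus (x d))"
proof -
  have m: "int (nat (modulus x)) = modulus x" for x by (simp add: modulus_def split: enat.split)
  have "computable D natE (\<lambda>d. nat (modulus (x d)))"
    by (rule computable_comp[OF _ x], rule computable_vertex_table) (simp add: natE_def)
  then have "computable D intE (\<lambda>d. a d mod int (nat (modulus (x d))))"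
    by (rule computable_int_mod[OF a])
  then show ?thesis by (simp only: m)
qed

lemma computable_res:
  assumes "computable D sylE s" "computable D sylE t"
  shows "computable D sylE (\<lambda>d. res (s d) (t d))" "computable D sylE (\<lambda>d. unres (s d) (t d))"
  unfolding res_def unres_def
  by (rule computable_pair computable_ph computable_int_minus computable_fst[of _ _ intE] computable_snd[of _ vE] assms)+

lemma computable_vertex_rel:
  assumes "computable D vE f" "computable D vE g"
  shows "computable D boolE (\<lambda>d. f d = g d)" "computable D boolE (\<lambda>d. (f d, g d) \<in> T)"
    "computable D boolE (\<lambda>d. edge (f d) (g d))"
  using assms by (auto simp: boolE_def intro: computable_vertex_table2)

lemma computable_before:
  assumes "computable D sylE s" "computable D sylE t"
  shows "computable D boolE (\<lambda>d. before (s d) (t d))"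
  unfolding before_def
  by (rule computable_bool computable_vertex_rel computable_fst[of _ _ intE] assms)+

lemma computable_tins:
  assumes "computable D sylE s" "computable D (listE sylE) l"
  shows "computable D (listE sylE) (\<lambda>d. tins (s d) (l d))"
  unfolding tins_def
  by (rule computable_append computable_Cons computable_filter computable_bool computable_before
      computable_comp[OF assms(1)] computable_proj assms)+

lemma computable_tsort:
  assumes "computable D (listE sylE) l"
  shows "computable D (listE sylE) (\<lambda>d. tsort (l d))"
  unfolding tsort_def
  by (rule computable_foldr computable_Nil computable_tins computable_proj assms)+

text \<open>Quantifiers over a list become emptiness tests for filters.\<close>

lemma computable_can_addl:
  assumes "computable D (listE sylE) l" "computable D sylE h"
  shows "computable D boolE (\<lambda>d. can_addl (l d) (h d))"
proof -
  have "can_addl l h \<longleftrightarrow> \<not> filter (\<lambda>t. fst t = fst h) l = [] \<or> filter (\<lambda>t. \<not> adj t h) l = []" for l h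
    by (auto simp: can_addl_def filter_empty_conv)
  moreover have "computable D boolE (\<lambda>d. \<not> filter (\<lambda>t. fst t = fst (h d)) (l d) = [] \<or>
      filter (\<lambda>t. \<not> adj t (h d)) (l d) = [])"
    by (rule computable_bool computable_is_Nil computable_filter assms computable_vertex_rel
        computable_fst[of _ _ intE] computable_comp[OF assms(2)] computable_proj)+
  ultimately show ?thesis by simp
qed

lemma computable_sum_list:
  assumes "computable D (listE intE) l"
  shows "computable D intE (\<lambda>d. sum_list (l d))"
proof -
  have "computable D intE (\<lambda>d. foldr (\<lambda>a b. a + b) (l d) 0)"
    by (rule computable_foldr computable_int_0 computable_int_add computable_proj assms)+
  then show ?thesis by (simp add: sum_list.eq_foldr)
qed

lemma computable_radd:
  assumes l: "computable D (listE sylE) l" and h: "computable D sylE h"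
  shows "computable D (listE sylE) (\<lambda>d. radd (l d) (h d))"
proof -
  have r: "computable D (listE sylE) (\<lambda>d. map (res (h d)) (filter (\<lambda>t. fst t \<noteq> fst (h d)) (l d)))"
    by (rule computable_map computable_filter computable_res computable_bool computable_vertex_rel
        computable_fst[of _ _ intE] l computable_comp[OF h] computable_proj)+
  have s: "computable D (listE intE) (\<lambda>d. map snd (filter (\<lambda>t. fst t = fst (h d)) (l d)))"
    by (rule computable_map[where A = sylE] computable_filter computable_vertex_rel
        computable_fst[of _ _ intE] l computable_comp[OF h] computable_proj)+
  have c: "computable D intE (\<lambda>d. (sum_list (map snd (filter (\<lambda>t. fst t = fst (h d)) (l d))) + snd (h d))
      mod modulus (fst (h d)))"
    by (rule computable_modulus computable_int_add computable_sum_list s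
        computable_fst[of _ _ intE] computable_snd[of _ vE] h)+
  have z: "computable D boolE (\<lambda>d. c d = 0)" if "computable D intE c" for c
  proof -
    have "c d = 0 \<longleftrightarrow> nat (c d) = 0 \<and> nat (- c d) = 0" for d by auto
    moreover have "computable D boolE (\<lambda>d. nat (c d) = 0 \<and> nat (- c d) = 0)"
      by (rule computable_bool computable_nat computable_int_nat that)+
    ultimately show ?thesis by simp
  qed
  show ?thesis
    unfolding radd_def Let_def
    by (rule computable_tsort computable_if z c r computable_Cons computable_pair
        computable_fst[of _ _ intE] h)+
qed

lemma computable_hds:
  assumes "computable D (listE sylE) l"
  shows "computable D (listE (prodE sylE (listE sylE))) (\<lambda>d. hds (l d))"
proof -
  \<comment> \<open>The fold rebuilds the list alongside \<open>hds\<close>, because the first entry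
    of \<open>hds (s # l)\<close> contains \<open>l\<close>, which a right fold does not pass to its
    step.\<close>
  let ?f = "\<lambda>s r. ((s, snd r) # map (\<lambda>p. (unres s (fst p), s # snd p)) (fst r), s # snd r)"
  have "foldr ?f l ([], []) = (hds l, l)" for l by (induction l) (auto simp: split_beta)
  moreover have "computable D (prodE (listE (prodE sylE (listE sylE))) (listE sylE))
      (\<lambda>d. foldr ?f (l d) ([], []))"
    by (rule computable_foldr assms computable_pair computable_Nil computable_Cons
        computable_map[where A = "prodE sylE (listE sylE)"] computable_res computable_proj)+
  then have "computable D (listE (prodE sylE (listE sylE))) (\<lambda>d. fst (foldr ?f (l d) ([], [])))"
    by (rule computable_fst)
  ultimately show ?thesis by simp
qed

lemma computable_norm_cons:
  "computable (prodE (listE sylE) (listE (listE sylE))) (listE (listE sylE)) (\<lambda>x. norm_cons (fst x) (snd x))"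
proof -
  let ?H = "prodE sylE (listE sylE)"
  let ?c = "\<lambda>x k. filter (\<lambda>hr. can_addl (fst x) (fst hr)) (hds k)"
  show ?thesis
    unfolding norm_cons_def
    by (rule computable_if computable_is_Nil computable_list_case[where E = "listE sylE"]
        computable_list_case[where E = ?H] computable_filter[where A = ?H] computable_hds
        computable_can_addl computable_radd computable_Cons computable_Nil computable_proj)+
qed

lemma computable_pass:
  assumes "computable D (listE (listE sylE)) p"
  shows "computable D (listE (listE sylE)) (\<lambda>d. pass (p d))"
  unfolding pass_def
  by (rule computable_foldr computable_Nil computable_comp2[OF computable_norm_cons] computable_proj assms)+

lemma computable_letters:
  assumes "computable D vE f"
  shows "computable D letterE (\<lambda>d. Inl (f d))" "computable D letterE (\<lambda>d. Inr (f d))"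
  by (rule computable_comp[OF computable_vertex_table assms], simp add: letterE_def)+

lemma computable_power_word:
  assumes "computable D sylE s"
  shows "computable D (listE letterE) (\<lambda>d. power_word (s d))"
proof -
  have p: "replicate n a = (Cons a ^^ n) []" for a :: "'a + 'a" and n by (induction n) auto
  \<comment> \<open>For either sign, at least one of the two factors is empty, so no case
    distinction is needed.\<close>
  have "power_word s = (Cons (Inl (fst s)) ^^ nat (snd s)) [] @ (Cons (Inr (fst s)) ^^ nat (- snd s)) []"
    for s :: "'a syllable"
    by (cases s) (simp add: p)
  moreover have "computable D (listE letterE) (\<lambda>d. (Cons (Inl (fst (s d))) ^^ nat (snd (s d))) [] @
      (Cons (Inr (fst (s d))) ^^ nat (- snd (s d))) [])"
    by (rule computable_append computable_funpow computable_int_nat computable_Cons computable_Nil computable_letters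
        computable_fst[of _ _ intE] computable_snd[of _ vE] assms computable_comp[OF assms] computable_proj)+
  ultimately show ?thesis by simp
qed

lemma computable_normalise:
  "computable (listE letterE) (listE letterE) normalise"
proof -
  have l: "computable letterE sylE letter_syl"
    by (rule computable_finite[OF finite_codes(3,4)])
      (auto simp: letterE_def prodE_def vE_def intE_def letter_syl_def)
  have "computable (listE letterE) (listE letterE)
     (\<lambda>w. concat (map power_word (concat ((pass ^^ (length w * Suc (length w))) (map (\<lambda>l. [letter_syl l]) w)))))"
    by (rule computable_concat computable_map[where A = sylE] computable_power_word computable_funpow computable_times
        computable_nat(1) computable_length[where A = letterE] computable_pass
        computable_map[where A = letterE] computable_Cons
        computable_Nil computable_comp[OF l] computable_proj)+
  then show ?thesis unfolding normalise_def[abs_def] syl_word_def initial_def .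
qed

lemma word_code_listE: "word_code e w = snd (listE letterE) w"
  by (simp add: word_code_def listE_def letterE_def)

lemma trickle_words_letterE: "trickle_words G = fst (listE letterE)"
  by (simp add: trickle_words_def words_over_def listE_def letterE_def)

lemma normalise_program:
  obtains g where "recursive1 g"
    "\<And>w. w \<in> trickle_words G \<Longrightarrow> g (word_code e w) = word_code e (normalise w)"
  using computableD[OF computable_normalise] unfolding word_code_listE trickle_words_letterE by metis

theorem nf_algorithm: "\<exists>f. computes_nf G T e f \<and> output_detects_identity G e f"
proof -
  obtain g where g: "recursive1 g"
    "\<And>w. w \<in> trickle_words G \<Longrightarrow> g (word_code e w) = word_code e (normalise w)"
    using normalise_program by metis
  obtain f where f: "\<And>x. rec_eval f [x] (g x)" using recursive1_program[OF g(1)] by metis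
  have *: "rec_eval f [word_code e w] (word_code e (normalise w))" if "w \<in> trickle_words G" for w
    using f[of "word_code e w"] g(2)[OF that] by simp
  have c: "word_code e v = word_code e [] \<longleftrightarrow> v = []" for v by (cases v) (auto simp: word_code_def)
  have "output_detects_identity G e f"
    unfolding output_detects_identity_def
  proof
    fix w assume w: "w \<in> trickle_words G"
    then have "element G w = \<one>\<^bsub>Tr G\<^esub> \<longleftrightarrow> word_code e (normalise w) = word_code e []"
      unfolding c using normalise_Nil_iff by (simp add: trickle_words_def)
    then show "\<exists>y. rec_eval f [word_code e w] y \<and> (element G w = \<one>\<^bsub>Tr G\<^esub> \<longleftrightarrow> y = word_code e [])"
      using *[OF w] by blast
  qed
  moreover have "computes_nf G T e f"
    unfolding computes_nf_def
  proof
    fix w assume w: "w \<in> trickle_words G"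
    then have "nf G T (element G w) = normalise w" using nf_normalise(1) by (simp add: trickle_words_def)
    then show "rec_eval f [word_code e w] (word_code e (nf G T (element G w)))" using *[OF w] by simp
  qed
  ultimately show ?thesis by blast
qed

theorem word_problem_algorithm: "\<exists>d. decides_word_problem G e d"
proof -
  obtain g where g: "recursive1 g"
    "\<And>w. w \<in> trickle_words G \<Longrightarrow> g (word_code e w) = word_code e (normalise w)"
    using normalise_program by metis
  \<comment> \<open>The empty word is the only one with code 0, so testing the code of the normal
    form decides triviality.\<close>
  have "recursive1 (\<lambda>x. if g x = 0 then 1 else 0)" by (intro recursive1_intros g(1))
  then obtain d where d: "\<And>x. rec_eval d [x] (if g x = 0 then 1 else 0)"
    using recursive1_program by metis
  have "word_code e v = 0 \<longleftrightarrow> v = []" for v by (cases v) (auto simp: word_code_def)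
  then have "(if g (word_code e w) = 0 then 1 else 0) = (if element G w = \<one>\<^bsub>Tr G\<^esub> then 1 else (0 :: nat))"
    if "w \<in> trickle_words G" for w
    using g(2)[OF that] normalise_Nil_iff that by (simp add: trickle_words_def)
  then have "rec_eval d [word_code e w] (if element G w = \<one>\<^bsub>Tr G\<^esub> then 1 else 0)"
    if "w \<in> trickle_words G" for w
    using d[of "word_code e w"] that by simp
  then show ?thesis unfolding decides_word_problem_def by blast
qed

end

theorem corollary2p5:
  fixes G :: "'a trickle" and T :: "'a rel"
  assumes "trickle_graph G"
    and "linear_order_on (verts G) T"
    and "vle G \<subseteq> T"
  shows "normal_forms G (nf G T ` carrier (Tr G)) \<and>
    (finite (verts G) \<longrightarrow>
      (\<forall>e. inj_on e (verts G) \<longrightarrow>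
        (\<exists>f. computes_nf G T e f \<and> output_detects_identity G e f) \<and>
        (\<exists>d. decides_word_problem G e d)))"
proof -
  interpret ordered_trickle_group G T by unfold_locales (use assms in auto)
  have "(\<exists>f. computes_nf G T e f \<and> output_detects_identity G e f) \<and> (\<exists>d. decides_word_problem G e d)"
    if "finite (verts G)" "inj_on e (verts G)" for e
  proof -
    interpret finite_trickle_group G T e by unfold_locales (use that in auto)
    show ?thesis using nf_algorithm word_problem_algorithm by blast
  qed
  then show ?thesis using normal_forms_nf by blast
qed

end
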